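(* There exist universal constants $C_0,c,c',C>0$ such that the following holds for all $\delta>0$ and integers $k'\ge1$ with $$m\ge C_0\,\frac{dk'\big(\log(\frac1\delta)\vee1\big)}{\delta^4}.$$ (a) Under the arbitrary corruption model with rate $p$, the $\big(k',\ \delta+3\sqrt{\tfrac{dp}{m}}+3p\big)$-RDPP holds with scaling function $\psi(X)=\sqrt{\tfrac2\pi}$ with probability at least $1-\exp(-(pm+d))-\exp(-c'm\delta^4)$. (b) Under the random corruption model with rate $p$, the $(k',\delta)$-RDPP holds with scaling function $$\psi(X)=\frac1m\sum_{i=1}^m\sqrt{\frac2\pi}\Big(1-p+p\,\mathbb{E}_{s_i\sim\mathbb P_i}\Big[\exp\Big(-\frac{s_i^2}{2\|X\|_{\mathrm F}^2}\Big)\Big]\Big)$$ with probability at least $1-Ce^{-cm\delta^4}$.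
   Context: $A_1,\dots,A_m$ are i.i.d. $d\times d$ GOE matrices: each $A_i$ is symmetric, with i.i.d. $N(0,1)$ diagonal entries and i.i.d. $N(0,\frac12)$ strictly upper triangular entries independent of the diagonal. $s=(s_1,\dots,s_m)\in\mathbb{R}^m$ is the corruption vector. Arbitrary corruption model with rate $p$: the index set $S\subset\{1,\dots,m\}$ of nonzero entries of $s$ is uniformly random of size $\lfloor pm\rfloor$, independent of $\{A_i\}$, and the values of the nonzero entries are arbitrary (possibly depending on $\{A_i\}$). Random corruption model with rate $p\in(0,1)$: the $s_i$ are random variables, independent of $\{A_i\}$ and of each other; each $s_i$ is nonzero (corrupted) with probability $p$, in which case it is drawn from an arbitrary distribution $\mathbb P_i$, and $s_i=0$ otherwise. With $\langle A,B\rangle=\mathrm{tr}(A^\top B)$, $\mathrm{sign}(x)=-1$ for $x<0$ and $\mathrm{sign}(x)=1$ for $x\ge0$, put $D(X)=\frac1m\sum_{i=1}^m\mathrm{sign}(\langle A_i,X\rangle-s_i)A_i$. The pairs $\{(A_i,s_i)\}_{i=1}^m$ satisfy the $(k',\delta)$-RDPP (restricted direction preserving property) with scaling function $\psi:\mathbb{R}^{d\times d}\to\mathbb{R}$ if for every nonzero symmetric $X\in\mathbb{R}^{d\times d}$ of rank at most $k'$, $\ \big\|D(X)-\psi(X)\frac{X}{\|X\|_{\mathrm F}}\big\|\le\delta$, where $\|\cdot\|$ is the operator norm and $\|\cdot\|_{\mathrm F}$ the Frobenius norm.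
   Formalization: Proved for 0 < δ ≤ 1 rather than all δ > 0: with universal constants the claim fails for large δ (e.g. d = m = k' = 1, p = 1/2 in (b): failure has probability about exp(-δ²/2), exceeding C·exp(-cδ⁴)). *)

theory Defs
  imports
    "HOL-Probability.Probability"
    "Jordan_Normal_Form.DL_Rank"
begin

(* Matrices are those of Jordan_Normal_Form, because the constants of the theorem must not depend
   on the dimension d: a dimension that is a type could not be quantified below them. *)

definition trace_mat :: "real mat \<Rightarrow> real" where
  "trace_mat A = (\<Sum>i<dim_row A. A $$ (i, i))"

definition inner_mat :: "real mat \<Rightarrow> real mat \<Rightarrow> real" where
  "inner_mat A B = trace_mat (transpose_mat A * B)"

definition frob_norm :: "real mat \<Rightarrow> real" where
  "frob_norm A = sqrt (inner_mat A A)"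

definition euclid_norm :: "real vec \<Rightarrow> real" where
  "euclid_norm v = sqrt (scalar_prod v v)"

(* The supremum is over a nonempty set as soon as A has a column. *)
definition op_norm :: "real mat \<Rightarrow> real" where
  "op_norm A = (SUP v\<in>{v \<in> carrier_vec (dim_col A). euclid_norm v = 1}. euclid_norm (A *\<^sub>v v))"

(* Unlike sgn, this takes the value 1 at 0. *)
definition sign_pm :: "real \<Rightarrow> real" where
  "sign_pm x = (if x < 0 then -1 else 1)"

definition D_mat :: "nat \<Rightarrow> nat \<Rightarrow> (nat \<Rightarrow> real mat) \<Rightarrow> (nat \<Rightarrow> real) \<Rightarrow> real mat \<Rightarrow> real mat" where
  "D_mat d m A s X = mat d d (\<lambda>(a, b).
     (1 / real m) * (\<Sum>i<m. sign_pm (inner_mat (A i) X - s i) * A i $$ (a, b)))"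

definition RDPP :: "nat \<Rightarrow> nat \<Rightarrow> nat \<Rightarrow> real \<Rightarrow> (real mat \<Rightarrow> real)
    \<Rightarrow> (nat \<Rightarrow> real mat) \<Rightarrow> (nat \<Rightarrow> real) \<Rightarrow> bool" where
  "RDPP d m k \<delta> \<psi> A s \<longleftrightarrow>
     (\<forall>X \<in> carrier_mat d d. X \<noteq> 0\<^sub>m d d \<and> transpose_mat X = X \<and> vec_space.rank d X \<le> k \<longrightarrow>
        op_norm (D_mat d m A s X - (\<psi> X / frob_norm X) \<cdot>\<^sub>m X) \<le> \<delta>)"

(* The theorem takes \<delta> \<le> 1: for large \<delta> no universal constants can work, e.g. for d = m = 1 the
   scalar | |g| - sqrt (2 / pi) | with g Gaussian exceeds \<delta> with probability of order
   exp (- \<delta>^2 / 2), which is not bounded by C * exp (- c * \<delta>^4). *)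

(* A random matrix is a random element of the finite product of borel over the index pairs. *)
definition entry_space :: "nat \<Rightarrow> (nat \<times> nat \<Rightarrow> real) measure" where
  "entry_space d = PiM ({..<d} \<times> {..<d}) (\<lambda>_. borel)"

definition entries :: "nat \<Rightarrow> real mat \<Rightarrow> nat \<times> nat \<Rightarrow> real" where
  "entries d A = (\<lambda>ab \<in> {..<d} \<times> {..<d}. A $$ ab)"

context prob_space
begin

definition GOE :: "nat \<Rightarrow> ('a \<Rightarrow> real mat) \<Rightarrow> bool" where
  "GOE d A \<longleftrightarrow>
     (\<forall>\<omega>\<in>space M. A \<omega> \<in> carrier_mat d d \<and> transpose_mat (A \<omega>) = A \<omega>) \<and>
     indep_vars (\<lambda>_. borel) (\<lambda>ab \<omega>. A \<omega> $$ ab) {(a, b). a \<le> b \<and> b < d} \<and>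
     (\<forall>a<d. distributed M lborel (\<lambda>\<omega>. A \<omega> $$ (a, a)) (normal_density 0 1)) \<and>
     (\<forall>b<d. \<forall>a<b. distributed M lborel (\<lambda>\<omega>. A \<omega> $$ (a, b)) (normal_density 0 (sqrt (1/2))))"

definition iid_GOE :: "nat \<Rightarrow> nat \<Rightarrow> (nat \<Rightarrow> 'a \<Rightarrow> real mat) \<Rightarrow> bool" where
  "iid_GOE d m A \<longleftrightarrow>
     (\<forall>i<m. GOE d (A i)) \<and>
     indep_vars (\<lambda>_. entry_space d) (\<lambda>i \<omega>. entries d (A i \<omega>)) {..<m}"

(* Independence of the family of matrices from a random element Y of N. The library's indep_var
   wants both variables to have the same type; this is what it unfolds to (indep_var_eq). *)
definition indep_of_mats ::
    "nat \<Rightarrow> nat \<Rightarrow> (nat \<Rightarrow> 'a \<Rightarrow> real mat) \<Rightarrow> 'b measure \<Rightarrow> ('a \<Rightarrow> 'b) \<Rightarrow> bool" where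
  "indep_of_mats d m A N Y \<longleftrightarrow>
     (let \<A> = PiM {..<m} (\<lambda>_. entry_space d); Z = (\<lambda>\<omega>. \<lambda>i\<in>{..<m}. entries d (A i \<omega>)) in
      Z \<in> measurable M \<A> \<and> Y \<in> measurable M N \<and>
      indep_set {Z -` U \<inter> space M |U. U \<in> sets \<A>} {Y -` V \<inter> space M |V. V \<in> sets N})"

(* Nothing is assumed about the nonzero values of s, not even measurability: they may be any
   function of the sample point. *)
definition arbitrary_corruption ::
    "nat \<Rightarrow> nat \<Rightarrow> real \<Rightarrow> (nat \<Rightarrow> 'a \<Rightarrow> real mat) \<Rightarrow> (nat \<Rightarrow> 'a \<Rightarrow> real) \<Rightarrow> bool" where
  "arbitrary_corruption d m p A s \<longleftrightarrow>
     (let S = (\<lambda>\<omega>. {i \<in> {..<m}. s i \<omega> \<noteq> 0}) in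
      indep_of_mats d m A (count_space UNIV) S \<and>
      distr M (count_space UNIV) S =
        measure_pmf (pmf_of_set {T. T \<subseteq> {..<m} \<and> card T = nat \<lfloor>p * real m\<rfloor>}))"

(* The law of s i is the mixture (1 - p) * (point mass at 0) + p * P i. *)
definition random_corruption ::
    "nat \<Rightarrow> nat \<Rightarrow> real \<Rightarrow> (nat \<Rightarrow> real measure) \<Rightarrow> (nat \<Rightarrow> 'a \<Rightarrow> real mat) \<Rightarrow> (nat \<Rightarrow> 'a \<Rightarrow> real) \<Rightarrow> bool"
    where
  "random_corruption d m p P A s \<longleftrightarrow>
     (\<forall>i<m. prob_space (P i) \<and> sets (P i) = sets borel) \<and>
     indep_vars (\<lambda>_. borel) s {..<m} \<and>
     indep_of_mats d m A (PiM {..<m} (\<lambda>_. borel)) (\<lambda>\<omega>. \<lambda>i\<in>{..<m}. s i \<omega>) \<and>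
     (\<forall>i<m. \<forall>B\<in>sets borel.
        prob {\<omega> \<in> space M. s i \<omega> \<in> B} = (1 - p) * indicator B 0 + p * measure (P i) B)"

(* The values of s may fail to be measurable in the arbitrary model, so "Q holds with probability
   at least b" is read as: Q holds on some event of probability at least b. *)
definition with_prob_ge :: "real \<Rightarrow> ('a \<Rightarrow> bool) \<Rightarrow> bool" where
  "with_prob_ge b Q \<longleftrightarrow> (\<exists>E\<in>events. (\<forall>\<omega>\<in>E. Q \<omega>) \<and> b \<le> prob E)"

lemma with_prob_ge_iff_prob:
  assumes "{\<omega> \<in> space M. Q \<omega>} \<in> events"
  shows "with_prob_ge b Q \<longleftrightarrow> b \<le> prob {\<omega> \<in> space M. Q \<omega>}"
proof
  assume "with_prob_ge b Q"
  then obtain E where E: "E \<in> events" "\<forall>\<omega>\<in>E. Q \<omega>" "b \<le> prob E"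
    unfolding with_prob_ge_def by (elim bexE conjE)
  have "E \<subseteq> {\<omega> \<in> space M. Q \<omega>}"
    using sets.sets_into_space[OF E(1)] E(2) by auto
  from finite_measure_mono[OF this assms] E(3) show "b \<le> prob {\<omega> \<in> space M. Q \<omega>}"
    by (rule order_trans[rotated])
next
  assume *: "b \<le> prob {\<omega> \<in> space M. Q \<omega>}"
  show "with_prob_ge b Q"
    unfolding with_prob_ge_def by (rule bexI[OF _ assms]) (simp add: *)
qed

end

definition psi_arbitrary :: "real mat \<Rightarrow> real" where
  "psi_arbitrary X = sqrt (2 / pi)"

definition psi_random :: "nat \<Rightarrow> real \<Rightarrow> (nat \<Rightarrow> real measure) \<Rightarrow> real mat \<Rightarrow> real" where
  "psi_random m p P X = (1 / real m) * (\<Sum>i<m. sqrt (2 / pi) *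
     (1 - p + p * (\<integral>t. exp (- (t\<^sup>2 / (2 * (frob_norm X)\<^sup>2))) \<partial>(P i))))"

end

theory Submission
  imports Defs
begin

text \<open>
  It suffices to control the quadratic forms \<open>v\<^sup>T (D(X) - \<psi>(X) X / \<parallel>X\<parallel>) v\<close>. After rescaling \<open>X\<close> to the
  unit sphere the sign becomes \<open>sign (\<langle>A\<^sub>i, X\<rangle> - u s\<^sub>i)\<close> with \<open>u = 1 / \<parallel>X\<parallel>\<close>, so besides \<open>X\<close> and \<open>v\<close> there is a
  scale \<open>u\<close> on which no Lipschitz control is available. For fixed \<open>X\<close> and \<open>v\<close> each summand changes at
  most once as \<open>u\<close> grows, and the law of the place of change has a distribution function that is continuous on
  the half-line and does not depend on \<open>X\<close>; the half-line is therefore cut into few closed intervals on each of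
  which only a small fraction of the signs change.

  For fixed \<open>X\<close>, \<open>u\<close> and \<open>v\<close> the sum is centred at \<open>\<psi>(X) v\<^sup>T X v\<close> and concentrates, because its terms are
  dominated by standard Gaussians. Moving from a net point to a general \<open>X\<close> flips a fraction \<open>O(\<delta>\<^sup>2)\<close> of the
  signs: a sign flips only if \<open>\<langle>A\<^sub>i, X\<^sub>0\<rangle> - u s\<^sub>i\<close> is small, which is rare, or \<open>\<langle>A\<^sub>i, X - X\<^sub>0\<rangle>\<close> is large, which is
  excluded for most \<open>i\<close> by an upper restricted isometry bound. By Cauchy-Schwarz the flipped terms contribute
  \<open>O(\<delta>)\<close>, and the Chernoff bound for their number produces the exponent \<open>m \<delta>\<^sup>4\<close>.

  Arbitrary corruptions change at most \<open>p m\<close> of the signs, on a set of indices independent of the matrices. A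
  Chernoff bound for \<open>\<Sum>i\<in>S. \<bar>v\<^sup>T A\<^sub>i v\<bar>\<close> gives the term \<open>3 p\<close>; everything else is absorbed by \<open>\<delta>\<close>.
\<close>

section \<open>Nets for low-rank matrices\<close>

text \<open>The sample size pays only for the entropy d k log(1/delta), and this shapes the nets.
  Rounding the factors of a low-rank matrix carelessly costs an extra logarithm, hence the counting
  in an l1 ball and the greedy rounding. Net points must themselves be symmetric, of rank at most k
  and of norm 1, so they are representatives of code classes and not the codes. Differences from the
  net are then sums of four matrices of rank at most k that need not be symmetric, and the isometry
  bound is therefore proved without symmetry. The corruption has no moments, so derivatives in
  \<open>u\<close> are out of reach even for the mean. Every sign is compared with the sign at the
  left endpoint of its cell, which leaves concentration to be asked only at finitely many triples of
  a matrix, a left endpoint and a vector. A flipped fraction kappa costs about sqrt kappa. This loss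
  is why counting flips, and not the signed sums with their rate m delta^2, is the
  bottleneck.\<close>

lemma sum_exp_abs_int_le:
  fixes L :: real assumes "L > 0"
  shows "(\<Sum>j\<in>{-int K..int K}. exp (- real_of_int \<bar>j\<bar> / L)) \<le> 1 + 2 * L"
proof -
  define q where "q = exp (- 1 / L)"
  have q: "0 < q" "q < 1" using assms by (auto simp: q_def)
  have *: "(\<Sum>j\<in>{-int K..int K}. exp (- real_of_int \<bar>j\<bar> / L)) = 1 + 2 * (\<Sum>j<K. q ^ Suc j)"
  proof (induction K)
    case (Suc K)
    have "{- int (Suc K)..int (Suc K)} = insert (int (Suc K)) (insert (- int (Suc K)) {-int K..int K})"
      by auto
    moreover have "exp (- real_of_int \<bar>int (Suc K)\<bar> / L) = q ^ Suc K"
      unfolding q_def exp_of_nat_mult[symmetric] by (rule arg_cong[of _ _ exp]) (use assms in \<open>simp add: field_simps\<close>)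
    moreover have "\<bar>- int (Suc K)\<bar> = \<bar>int (Suc K)\<bar>" by simp
    ultimately show ?case using Suc by (simp del: of_nat_Suc power_Suc abs_minus_cancel)
  qed simp
  \<comment> \<open>The series of the powers of q sums to q / (1 - q), and 1 + 1/L <= 1/q gives q <=
    L (1 - q).\<close>
  have "1 + 1 / L \<le> exp (1 / L)" by (rule exp_ge_add_one_self)
  hence "(1 + 1 / L) * q \<le> exp (1 / L) * q" using q by (intro mult_right_mono) auto
  hence "q + q / L \<le> 1" by (simp add: q_def exp_minus field_simps)
  hence "q \<le> L * (1 - q)" using assms by (simp add: field_simps)
  moreover have "(1 - q) * (\<Sum>j<K. q ^ Suc j) = q - q ^ Suc K"
  proof (induction K)
    case (Suc K)
    thus ?case by (simp only: sum.lessThan_Suc distrib_left) (simp add: algebra_simps)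
  qed simp
  hence "(1 - q) * (\<Sum>j<K. q ^ Suc j) \<le> q" using q by simp
  ultimately have "(1 - q) * (\<Sum>j<K. q ^ Suc j) \<le> (1 - q) * L" by (simp add: mult.commute)
  hence "(\<Sum>j<K. q ^ Suc j) \<le> L" using q by simp
  thus ?thesis unfolding * by simp
qed

text \<open>The radius is proportional to the dimension: \<open>L\<close> bounds the average
  absolute coordinate. Such a ball has a number of points exponential in \<open>card I\<close> with
  a base depending on \<open>L\<close> alone, whereas the cube around it would bring in the
  logarithm of the dimension.\<close>

definition int_l1_ball :: "'i set \<Rightarrow> real \<Rightarrow> ('i \<Rightarrow> int) set" where
  "int_l1_ball I L = {z \<in> I \<rightarrow>\<^sub>E UNIV. (\<Sum>i\<in>I. real_of_int \<bar>z i\<bar>) \<le> L * real (card I)}"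

text \<open>Counting with the weight \<open>exp (card I - (\<Sum>i\<in>I. \<bar>z i\<bar>) / L) \<ge> 1\<close> makes the sum factorise.\<close>

lemma int_l1_ball_card:
  fixes L :: real assumes fin: "finite I" and L: "L > 0"
  shows "finite (int_l1_ball I L)" "real (card (int_l1_ball I L)) \<le> (exp 1 * (1 + 2 * L)) ^ card I"
proof -
  \<comment> \<open>A crude cube, as one coordinate may carry the whole l1 mass. It makes the sums
    finite and drops out of the bound.\<close>
  define K where "K = nat \<lceil>L * real (card I)\<rceil>"
  define P where "P = I \<rightarrow>\<^sub>E {-int K..int K}"
  have sub: "int_l1_ball I L \<subseteq> P"
  proof
    fix z assume z: "z \<in> int_l1_ball I L"
    show "z \<in> P" unfolding P_def
    proof (rule PiE_I)
      fix i assume i: "i \<in> I"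
      have "real_of_int \<bar>z i\<bar> \<le> (\<Sum>i\<in>I. real_of_int \<bar>z i\<bar>)"
        by (rule member_le_sum) (use i fin in auto)
      also have "\<dots> \<le> L * real (card I)" using z by (auto simp: int_l1_ball_def)
      finally have "\<bar>z i\<bar> \<le> \<lceil>L * real (card I)\<rceil>" by linarith
      moreover have "\<bar>z i\<bar> \<le> int K" unfolding K_def using calculation by linarith
      ultimately show "z i \<in> {-int K..int K}" by auto
    qed (use z in \<open>auto simp: int_l1_ball_def PiE_def extensional_def\<close>)
  qed
  have finP: "finite P" unfolding P_def by (intro finite_PiE fin) auto
  show fin2: "finite (int_l1_ball I L)" using sub finP by (rule finite_subset)
  have "real (card (int_l1_ball I L)) = (\<Sum>z\<in>int_l1_ball I L. 1)" by simp
  also have "\<dots> \<le> (\<Sum>z\<in>int_l1_ball I L. exp (real (card I)) * (\<Prod>i\<in>I. exp (- real_of_int \<bar>z i\<bar> / L)))"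
  proof (rule sum_mono)
    fix z assume z: "z \<in> int_l1_ball I L"
    have "(\<Sum>i\<in>I. real_of_int \<bar>z i\<bar>) / L \<le> real (card I)"
      using z L by (simp add: int_l1_ball_def divide_le_eq mult.commute)
    hence "1 \<le> exp (real (card I) + (\<Sum>i\<in>I. - real_of_int \<bar>z i\<bar> / L))"
      by (simp add: sum_divide_distrib sum_negf)
    thus "1 \<le> exp (real (card I)) * (\<Prod>i\<in>I. exp (- real_of_int \<bar>z i\<bar> / L))"
      by (simp add: exp_add exp_sum[OF fin])
  qed
  also have "\<dots> \<le> (\<Sum>z\<in>P. exp (real (card I)) * (\<Prod>i\<in>I. exp (- real_of_int \<bar>z i\<bar> / L)))"
    by (rule sum_mono2[OF finP sub]) (auto intro!: mult_nonneg_nonneg prod_nonneg)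
  also have "\<dots> = exp (real (card I)) * (\<Prod>i\<in>I. \<Sum>j\<in>{-int K..int K}. exp (- real_of_int \<bar>j\<bar> / L))"
    unfolding P_def sum_distrib_left[symmetric] by (subst prod_sum_PiE) (auto simp: fin)
  also have "\<dots> \<le> exp (real (card I)) * (\<Prod>i\<in>I. 1 + 2 * L)"
    by (intro mult_left_mono prod_mono conjI sum_exp_abs_int_le L sum_nonneg) auto
  also have "\<dots> = (exp 1 * (1 + 2 * L)) ^ card I"
    by (simp add: power_mult_distrib exp_of_nat_mult[symmetric])
  finally show "real (card (int_l1_ball I L)) \<le> (exp 1 * (1 + 2 * L)) ^ card I" .
qed

text \<open>Cauchy-Schwarz against the constant vector turns the Euclidean norm into a sum of
  absolute values. With a step \<open>h\<close> of order \<open>L2_set x I / sqrt (card I)\<close>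
  the right-hand side is proportional to \<open>card I\<close>, as \<open>int_l1_ball\<close>
  requires.\<close>

lemma l1_le_of_rounding:
  fixes x :: "'i \<Rightarrow> real" and z :: "'i \<Rightarrow> int" and h :: real
  assumes fin: "finite I" and h: "h > 0" and z: "\<And>i. i \<in> I \<Longrightarrow> \<bar>x i - h * z i\<bar> \<le> h"
  shows "(\<Sum>i\<in>I. real_of_int \<bar>z i\<bar>) \<le> sqrt (real (card I)) * L2_set x I / h + real (card I)"
proof -
  have "(\<Sum>i\<in>I. real_of_int \<bar>z i\<bar>) \<le> (\<Sum>i\<in>I. \<bar>1\<bar> * \<bar>x i\<bar> / h + 1)"
  proof (rule sum_mono)
    fix i assume "i \<in> I"
    have "h * \<bar>real_of_int (z i)\<bar> = \<bar>h * z i\<bar>" using h by (simp add: abs_mult)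
    also have "\<dots> \<le> \<bar>x i\<bar> + h" using z[OF \<open>i \<in> I\<close>] by linarith
    finally show "real_of_int \<bar>z i\<bar> \<le> \<bar>1\<bar> * \<bar>x i\<bar> / h + 1" using h by (simp add: field_simps)
  qed
  also have "\<dots> = (\<Sum>i\<in>I. \<bar>1\<bar> * \<bar>x i\<bar>) / h + real (card I)"
    by (simp add: sum.distrib sum_divide_distrib)
  also have "\<dots> \<le> (L2_set (\<lambda>_. 1) I * L2_set x I) / h + real (card I)"
    by (intro add_right_mono divide_right_mono L2_set_mult_ineq) (use h in auto)
  also have "L2_set (\<lambda>_. 1) I = sqrt (real (card I))" by (simp add: L2_set_def)
  finally show ?thesis .
qed

lemma power2_le_of_abs_le: "\<bar>x :: real\<bar> \<le> y \<Longrightarrow> x\<^sup>2 \<le> y\<^sup>2"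
  by (simp add: abs_le_square_iff[symmetric])

lemma floor_mult_bounds:
  fixes x h :: real assumes "h > 0"
  shows "h * of_int \<lfloor>x / h\<rfloor> \<le> x" "x \<le> h * of_int \<lfloor>x / h\<rfloor> + h"
proof -
  have "h * of_int \<lfloor>x / h\<rfloor> \<le> h * (x / h)" by (rule mult_left_mono) (use assms in auto)
  thus "h * of_int \<lfloor>x / h\<rfloor> \<le> x" using assms by simp
  have "h * (x / h) \<le> h * (of_int \<lfloor>x / h\<rfloor> + 1)"
    by (rule mult_left_mono) (use assms in \<open>auto intro: less_imp_le\<close>)
  thus "x \<le> h * of_int \<lfloor>x / h\<rfloor> + h" using assms by (simp add: distrib_left)
qed

lemma floor_rounding:
  fixes x h :: real assumes "h > 0"
  shows "\<bar>x - h * of_int \<lfloor>x / h\<rfloor>\<bar> \<le> h"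
  using floor_mult_bounds[OF assms, of x] assms by linarith

text \<open>Rounding up or down so that each new term has nonpositive inner product with the partial
  sum keeps the error as small as if the vectors were orthogonal.\<close>

lemma greedy_rounding:
  fixes x :: "'l \<Rightarrow> real" and r :: "'l \<Rightarrow> 'j \<Rightarrow> real"
  assumes fin: "finite L" and h: "h > 0"
  shows "\<exists>z :: 'l \<Rightarrow> int. (\<forall>l\<in>L. \<bar>x l - h * z l\<bar> \<le> h) \<and>
     (\<Sum>j\<in>J. (\<Sum>l\<in>L. (x l - h * z l) * r l j)\<^sup>2) \<le> h\<^sup>2 * (\<Sum>l\<in>L. \<Sum>j\<in>J. (r l j)\<^sup>2)"
  using fin
proof (induction L)
  case (insert k L)
  then obtain z :: "'l \<Rightarrow> int" where z: "\<forall>l\<in>L. \<bar>x l - h * z l\<bar> \<le> h"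
    "(\<Sum>j\<in>J. (\<Sum>l\<in>L. (x l - h * z l) * r l j)\<^sup>2) \<le> h\<^sup>2 * (\<Sum>l\<in>L. \<Sum>j\<in>J. (r l j)\<^sup>2)" by (elim exE conjE)
  define s where "s j = (\<Sum>l\<in>L. (x l - h * z l) * r l j)" for j
  define c where "c = (\<Sum>j\<in>J. s j * r k j)"
  define f where "f = \<lfloor>x k / h\<rfloor>"
  define y :: int where "y = (if c \<le> 0 then f else f + 1)"
  define e where "e = x k - h * y"
  have f: "h * f \<le> x k" "x k \<le> h * f + h"
    using floor_mult_bounds[OF h, of "x k"] by (auto simp: f_def)
  have e: "\<bar>e\<bar> \<le> h" "e * c \<le> 0"
    using f by (auto simp: e_def y_def distrib_left mult_le_0_iff)
  have "(\<Sum>j\<in>J. (s j + e * r k j)\<^sup>2) = (\<Sum>j\<in>J. (s j)\<^sup>2) + 2 * (e * c) + e\<^sup>2 * (\<Sum>j\<in>J. (r k j)\<^sup>2)"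
    by (simp add: power2_sum c_def sum.distrib sum_distrib_left power_mult_distrib algebra_simps)
  also have "\<dots> \<le> (\<Sum>j\<in>J. (s j)\<^sup>2) + h\<^sup>2 * (\<Sum>j\<in>J. (r k j)\<^sup>2)"
  proof -
    have "e\<^sup>2 \<le> h\<^sup>2" using e(1) by (rule power2_le_of_abs_le)
    hence "e\<^sup>2 * (\<Sum>j\<in>J. (r k j)\<^sup>2) \<le> h\<^sup>2 * (\<Sum>j\<in>J. (r k j)\<^sup>2)"
      by (intro mult_right_mono sum_nonneg) auto
    thus ?thesis using e(2) by linarith
  qed
  also have "\<dots> \<le> h\<^sup>2 * (\<Sum>l\<in>insert k L. \<Sum>j\<in>J. (r l j)\<^sup>2)"
    using z(2) insert.hyps by (simp add: s_def algebra_simps)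
  finally have main: "(\<Sum>j\<in>J. (s j + e * r k j)\<^sup>2) \<le> h\<^sup>2 * (\<Sum>l\<in>insert k L. \<Sum>j\<in>J. (r l j)\<^sup>2)" .
  define z' where "z' = z(k := y)"
  have eq: "(\<Sum>l\<in>insert k L. (x l - h * z' l) * r l j) = s j + e * r k j" for j
  proof -
    have "(\<Sum>l\<in>L. (x l - h * z' l) * r l j) = s j"
      unfolding s_def z'_def by (rule sum.cong) (use insert.hyps in auto)
    thus ?thesis using insert.hyps by (simp add: z'_def e_def)
  qed
  show ?case
  proof (intro exI[of _ z'] conjI ballI)
    fix l assume "l \<in> insert k L"
    thus "\<bar>x l - h * z' l\<bar> \<le> h" using z(1) e(1) by (auto simp: z'_def e_def)
  qed (unfold eq, rule main)
qed auto

text \<open>Gram-Schmidt for the columns, with the triangular factor moved into \<open>r\<close>: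
  the part of \<open>u n\<close> along an earlier \<open>q l\<close> is compensated by adding
  \<open>c l * w n\<close> to \<open>r l\<close>. A column in the span of its predecessors becomes
  zero on both sides, so that the squares of \<open>r\<close> still add up to those of the
  product.\<close>

lemma gram_schmidt_factors:
  fixes u :: "nat \<Rightarrow> 'a \<Rightarrow> real" and w :: "nat \<Rightarrow> 'b \<Rightarrow> real"
  assumes fin: "finite A"
  shows "\<exists>q r. (\<forall>a\<in>A. \<forall>b. (\<Sum>l<n. u l a * w l b) = (\<Sum>l<n. q l a * r l b)) \<and>
    (\<forall>l<n. \<forall>l'<n. l \<noteq> l' \<longrightarrow> (\<Sum>a\<in>A. q l a * q l' a) = 0) \<and>
    (\<forall>l<n. (\<Sum>a\<in>A. (q l a)\<^sup>2) = (1::real) \<or> (\<forall>a. q l a = 0) \<and> (\<forall>b. r l b = 0))"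
proof (induction n)
  case (Suc n)
  then obtain q r where
    eq0: "\<forall>a\<in>A. \<forall>b. (\<Sum>l<n. u l a * w l b) = (\<Sum>l<n. q l a * r l b)" and
    orth0: "\<forall>l<n. \<forall>l'<n. l \<noteq> l' \<longrightarrow> (\<Sum>a\<in>A. q l a * q l' a) = 0" and
    unit0: "\<forall>l<n. (\<Sum>a\<in>A. (q l a)\<^sup>2) = (1::real) \<or> (\<forall>a. q l a = 0) \<and> (\<forall>b. r l b = 0)"
    by (elim exE conjE)
  have eq: "(\<Sum>l<n. u l a * w l b) = (\<Sum>l<n. q l a * r l b)" if "a \<in> A" for a b
    using eq0 that by simp
  have orth: "(\<Sum>a\<in>A. q l a * q l' a) = 0" if "l < n" "l' < n" "l \<noteq> l'" for l l'
    using orth0 that by simp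
  have unit: "(\<Sum>a\<in>A. (q l a)\<^sup>2) = 1 \<or> (\<forall>a. q l a = 0) \<and> (\<forall>b. r l b = 0)" if "l < n" for l
    using unit0 that by simp
  define c where "c l = (\<Sum>a\<in>A. u n a * q l a)" for l
  define p where "p a = u n a - (\<Sum>l<n. c l * q l a)" for a
  define N where "N = (\<Sum>a\<in>A. (p a)\<^sup>2)"
  have N0: "N \<ge> 0" unfolding N_def by (intro sum_nonneg) auto
  have pq: "(\<Sum>a\<in>A. p a * q l a) = 0" if l: "l < n" for l
  proof -
    have "(\<Sum>a\<in>A. p a * q l a) = c l - (\<Sum>a\<in>A. \<Sum>l'<n. c l' * (q l' a * q l a))"
      unfolding p_def c_def[of l] left_diff_distrib sum_distrib_right sum_subtractf mult.assoc ..
    also have "(\<Sum>a\<in>A. \<Sum>l'<n. c l' * (q l' a * q l a)) = (\<Sum>l'<n. c l' * (\<Sum>a\<in>A. q l' a * q l a))"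
      by (subst sum.swap) (simp only: sum_distrib_left)
    also have "(\<Sum>l'<n. c l' * (\<Sum>a\<in>A. q l' a * q l a)) = (\<Sum>l'<n. if l' = l then c l * (\<Sum>a\<in>A. q l a * q l a) else 0)"
      by (rule sum.cong) (use l orth in auto)
    also have "\<dots> = c l * (\<Sum>a\<in>A. (q l a)\<^sup>2)" using l by (simp add: power2_eq_square)
    also have "\<dots> = c l" using unit[OF l] by (auto simp: c_def)
    finally show ?thesis by simp
  qed
  define q' where "q' = q(n := (\<lambda>a. if N = 0 then 0 else p a / sqrt N))"
  define r' where "r' = (\<lambda>l b. if l = n then sqrt N * w n b else r l b + c l * w n b)"
  have pA: "p a = (if N = 0 then 0 else p a / sqrt N) * sqrt N" if "a \<in> A" for a
  proof (cases "N = 0")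
    case True
    hence "p a = 0" using that fin unfolding N_def by (simp add: sum_nonneg_eq_0_iff)
    thus ?thesis by simp
  qed auto
  have 1: "(\<Sum>l<Suc n. u l a * w l b) = (\<Sum>l<Suc n. q' l a * r' l b)" if a: "a \<in> A" for a b
  proof -
    have "(\<Sum>l<n. q' l a * r' l b) = (\<Sum>l<n. q l a * r l b) + (\<Sum>l<n. c l * q l a) * w n b"
      unfolding q'_def r'_def by (simp add: algebra_simps sum.distrib sum_distrib_left)
    moreover have "q' n a * r' n b = p a * w n b" using pA[OF a] by (auto simp: q'_def r'_def)
    ultimately show ?thesis using eq[OF a] by (simp add: p_def algebra_simps)
  qed
  have n0: "(\<Sum>a\<in>A. q' n a * q' l a) = 0" if "l < n" for l
  proof -
    have "(\<Sum>a\<in>A. q' n a * q' l a) = (if N = 0 then 0 else (\<Sum>a\<in>A. p a * q l a) / sqrt N)"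
      using that by (auto simp: q'_def sum_divide_distrib)
    thus ?thesis using pq[OF that] by simp
  qed
  have 2: "(\<Sum>a\<in>A. q' l a * q' l' a) = 0" if ll: "l < Suc n" "l' < Suc n" "l \<noteq> l'" for l l'
  proof -
    consider "l = n" "l' < n" | "l < n" "l' = n" | "l < n" "l' < n" using ll by (auto simp: less_Suc_eq)
    thus ?thesis
    proof cases
      case 1 thus ?thesis using n0 by simp
    next
      case 2 thus ?thesis using n0[of l] by (simp add: mult.commute)
    next
      case 3 thus ?thesis using orth ll by (simp add: q'_def)
    qed
  qed
  have 3: "(\<Sum>a\<in>A. (q' l a)\<^sup>2) = 1 \<or> (\<forall>a. q' l a = 0) \<and> (\<forall>b. r' l b = 0)" if "l < Suc n" for l
  proof (cases "l = n")
    case True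
    have "(\<Sum>a\<in>A. (p a / sqrt N)\<^sup>2) = N / N"
      using N0 by (simp add: power_divide sum_divide_distrib[symmetric] N_def[symmetric])
    thus ?thesis using True by (auto simp: q'_def r'_def)
  next
    case False
    hence l: "l < n" using that by simp
    from unit[OF l] show ?thesis
    proof
      assume "(\<forall>a. q l a = 0) \<and> (\<forall>b. r l b = 0)"
      thus ?thesis using l by (auto simp: q'_def r'_def c_def)
    qed (use l in \<open>auto simp: q'_def\<close>)
  qed
  show ?case
    by (intro exI[of _ q'] exI[of _ r'] conjI ballI allI impI) (use 1 2 3 in \<open>assumption | simp\<close>)+
qed auto

text \<open>For orthonormal columns this is the invariance of the Frobenius norm under an isometry.
  The column norms stay in the formula because \<open>gram_schmidt_factors\<close> may return zero
  columns.\<close>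

lemma sum_squares_orthogonal:
  fixes q :: "nat \<Rightarrow> 'a \<Rightarrow> real" and s :: "nat \<Rightarrow> 'b \<Rightarrow> real"
  assumes orth: "\<And>l l'. l < n \<Longrightarrow> l' < n \<Longrightarrow> l \<noteq> l' \<Longrightarrow> (\<Sum>a\<in>A. q l a * q l' a) = 0"
  shows "(\<Sum>(a, b)\<in>A \<times> B. (\<Sum>l<n. q l a * s l b)\<^sup>2) = (\<Sum>l<n. (\<Sum>a\<in>A. (q l a)\<^sup>2) * (\<Sum>b\<in>B. (s l b)\<^sup>2))"
proof -
  have "(\<Sum>a\<in>A. (\<Sum>l<n. q l a * s l b)\<^sup>2) = (\<Sum>l<n. (\<Sum>a\<in>A. (q l a)\<^sup>2) * (s l b)\<^sup>2)" for b
  proof -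
    have "(\<Sum>a\<in>A. (\<Sum>l<n. q l a * s l b)\<^sup>2) = (\<Sum>a\<in>A. \<Sum>l<n. \<Sum>l'<n. s l b * s l' b * (q l a * q l' a))"
      by (simp add: power2_eq_square sum_product mult_ac)
    also have "\<dots> = (\<Sum>l<n. \<Sum>l'<n. s l b * s l' b * (\<Sum>a\<in>A. q l a * q l' a))"
      by (subst sum.swap, rule sum.cong[OF refl], subst sum.swap) (simp add: sum_distrib_left)
    also have "\<dots> = (\<Sum>l<n. \<Sum>l'<n. if l' = l then s l b * s l b * (\<Sum>a\<in>A. q l a * q l a) else 0)"
      by (intro sum.cong refl) (use orth in auto)
    also have "\<dots> = (\<Sum>l<n. (\<Sum>a\<in>A. (q l a)\<^sup>2) * (s l b)\<^sup>2)"
      by (intro sum.cong refl) (simp add: power2_eq_square mult_ac)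
    finally show ?thesis .
  qed
  hence "(\<Sum>b\<in>B. \<Sum>a\<in>A. (\<Sum>l<n. q l a * s l b)\<^sup>2) = (\<Sum>l<n. \<Sum>b\<in>B. (\<Sum>a\<in>A. (q l a)\<^sup>2) * (s l b)\<^sup>2)"
    by (simp only:) (rule sum.swap)
  moreover have "(\<Sum>(a, b)\<in>A \<times> B. (\<Sum>l<n. q l a * s l b)\<^sup>2) = (\<Sum>b\<in>B. \<Sum>a\<in>A. (\<Sum>l<n. q l a * s l b)\<^sup>2)"
    unfolding sum.cartesian_product[symmetric] by (rule sum.swap)
  ultimately show ?thesis by (simp add: sum_distrib_left)
qed

section \<open>Low-rank matrices as functions on index pairs, and their nets\<close>

definition Sq :: "nat \<Rightarrow> (nat \<times> nat) set" where "Sq d = {..<d} \<times> {..<d}"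

text \<open>Rank is encoded as a sum of \<open>k\<close> dyads, constrained only at indices below
  \<open>d\<close>. Closure under scaling and sums is then immediate, with ranks adding; the link
  with the rank of a matrix is made only once, at the end.\<close>

definition low_rank :: "nat \<Rightarrow> nat \<Rightarrow> (nat \<times> nat \<Rightarrow> real) \<Rightarrow> bool" where
  "low_rank d k X \<longleftrightarrow> (\<exists>q r. \<forall>a<d. \<forall>b<d. X (a, b) = (\<Sum>l<k. q l a * r l b))"

lemma finite_Sq [simp]: "finite (Sq d)" by (simp add: Sq_def)

lemma low_rank_smult: "low_rank d k X \<Longrightarrow> low_rank d k (\<lambda>e. c * X e)"
proof -
  assume "low_rank d k X"
  then obtain q r where "\<forall>a<d. \<forall>b<d. X (a, b) = (\<Sum>l<k. q l a * r l b)" unfolding low_rank_def by blast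
  hence "\<forall>a<d. \<forall>b<d. c * X (a, b) = (\<Sum>l<k. (c * q l a) * r l b)"
    by (simp add: sum_distrib_left mult_ac)
  thus ?thesis unfolding low_rank_def by (intro exI[of _ "\<lambda>l a. c * q l a"] exI[of _ r]) auto
qed

lemma low_rank_add:
  assumes "low_rank d j X" "low_rank d k Y" shows "low_rank d (j + k) (\<lambda>e. X e + Y e)"
proof -
  from assms obtain q r q' r' where X: "\<forall>a<d. \<forall>b<d. X (a, b) = (\<Sum>l<j. q l a * r l b)"
    and Y: "\<forall>a<d. \<forall>b<d. Y (a, b) = (\<Sum>l<k. q' l a * r' l b)" unfolding low_rank_def by blast
  define p where "p l = (if l < j then q l else q' (l - j))" for l
  define s where "s l = (if l < j then r l else r' (l - j))" for l
  have "(\<Sum>l<j + k. p l a * s l b) = (\<Sum>l<j. q l a * r l b) + (\<Sum>l<k. q' l a * r' l b)" for a b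
  proof (induction k)
    case 0 show ?case by (auto simp: p_def s_def)
  next
    case (Suc k) thus ?case by (simp add: p_def s_def)
  qed
  thus ?thesis using X Y unfolding low_rank_def by (intro exI[of _ p] exI[of _ s]) auto
qed

lemma low_rank_mono: assumes "low_rank d j X" "j \<le> k" shows "low_rank d k X"
proof -
  have "low_rank d (k - j) (\<lambda>_. 0)" unfolding low_rank_def by (intro exI[of _ "\<lambda>_ _. 0"]) auto
  from low_rank_add[OF assms(1) this] show ?thesis using assms(2) by simp
qed

text \<open>The two steps fit the two factors: over \<open>k * d\<close> entries the squares of the
  orthonormal factor sum to at most \<open>k\<close>, those of the other one to at most 1. Each step
  is the fraction \<open>\<epsilon>\<close> of a typical entry, so both integer vectors lie in the
  same l1 ball.\<close>

definition lr_code :: "nat \<Rightarrow> nat \<Rightarrow> real \<Rightarrow> (nat \<times> nat \<Rightarrow> int) \<Rightarrow> (nat \<times> nat \<Rightarrow> int) \<Rightarrow> nat \<times> nat \<Rightarrow> real" where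
  "lr_code d k \<epsilon> zq zr = (\<lambda>(a, b). \<Sum>l<k. (\<epsilon> / sqrt (real d) * zq (l, a)) * (\<epsilon> / sqrt (real (k * d)) * zr (l, b)))"

lemma L2_set_sq: "(L2_set f A)\<^sup>2 = (\<Sum>i\<in>A. (f i)\<^sup>2)"
  unfolding L2_set_def by (intro real_sqrt_pow2 sum_nonneg) auto

text \<open>Write \<open>X = Q R\<close> with the columns of \<open>Q\<close> orthonormal. Rounding \<open>R\<close> is harmless since \<open>Q\<close> is an
  isometry; \<open>Q\<close> is then rounded greedily against the rounded \<open>R\<close>, which allows the step
  \<open>\<epsilon> / sqrt d\<close> and avoids a factor \<open>log k\<close> in the exponent.\<close>

lemma low_rank_rounding:
  assumes X: "low_rank d k X" and nX: "L2_set X (Sq d) \<le> 1" and \<epsilon>: "0 < \<epsilon>" "\<epsilon> \<le> 1"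
    and d: "d \<ge> 1" and k: "k \<ge> 1"
  shows "\<exists>zq\<in>int_l1_ball ({..<k} \<times> {..<d}) (1 / \<epsilon> + 1). \<exists>zr\<in>int_l1_ball ({..<k} \<times> {..<d}) (1 / \<epsilon> + 1).
    \<exists>Y Z. low_rank d k Y \<and> low_rank d k Z \<and> L2_set Y (Sq d) \<le> 2 * \<epsilon> \<and> L2_set Z (Sq d) \<le> 2 * \<epsilon> \<and>
      (\<forall>e\<in>Sq d. X e = lr_code d k \<epsilon> zq zr e + Y e + Z e)"
proof -
  define I where "I = {..<k} \<times> {..<d}"
  have finI: "finite I" and cI: "card I = k * d" by (auto simp: I_def)
  obtain u w where uw: "\<forall>a<d. \<forall>b<d. X (a, b) = (\<Sum>l<k. u l a * w l b)" using X unfolding low_rank_def by blast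
  obtain q r where qr: "\<forall>a\<in>{..<d}. \<forall>b. (\<Sum>l<k. u l a * w l b) = (\<Sum>l<k. q l a * r l b)"
    "\<forall>l<k. \<forall>l'<k. l \<noteq> l' \<longrightarrow> (\<Sum>a<d. q l a * q l' a) = 0"
    "\<forall>l<k. (\<Sum>a<d. (q l a)\<^sup>2) = (1::real) \<or> (\<forall>a. q l a = 0) \<and> (\<forall>b. r l b = 0)"
    using gram_schmidt_factors[OF finite_lessThan[of d], of u w k] by (elim exE conjE)
  have orth: "(\<Sum>a<d. q l a * q l' a) = 0" if "l < k" "l' < k" "l \<noteq> l'" for l l'
    using qr(2) that by simp
  have unit: "(\<Sum>a<d. (q l a)\<^sup>2) = 1 \<or> (\<forall>a. q l a = 0) \<and> (\<forall>b. r l b = 0)" if "l < k" for l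
    using qr(3) that by simp
  have Xqr: "X (a, b) = (\<Sum>l<k. q l a * r l b)" if "a < d" "b < d" for a b
    using uw qr(1) that by simp
  have unit_le: "(\<Sum>a<d. (q l a)\<^sup>2) \<le> 1" if "l < k" for l using unit[OF that] by auto
  have "(\<Sum>l<k. \<Sum>b<d. (r l b)\<^sup>2) = (\<Sum>l<k. (\<Sum>a<d. (q l a)\<^sup>2) * (\<Sum>b<d. (r l b)\<^sup>2))"
  proof (rule sum.cong[OF refl])
    fix l assume "l \<in> {..<k}"
    hence "l < k" by simp
    from unit[OF this] show "(\<Sum>b<d. (r l b)\<^sup>2) = (\<Sum>a<d. (q l a)\<^sup>2) * (\<Sum>b<d. (r l b)\<^sup>2)"
      by (elim disjE) simp_all
  qed
  also have "\<dots> = (\<Sum>(a, b)\<in>{..<d} \<times> {..<d}. (\<Sum>l<k. q l a * r l b)\<^sup>2)"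
    by (rule sum_squares_orthogonal[symmetric]) (use orth in auto)
  also have "\<dots> = (\<Sum>e\<in>Sq d. (X e)\<^sup>2)" unfolding Sq_def by (rule sum.cong) (auto simp: Xqr)
  also have "\<dots> = (L2_set X (Sq d))\<^sup>2" by (simp add: L2_set_sq)
  also have "\<dots> \<le> 1\<^sup>2" by (rule power_mono[OF nX]) (simp add: L2_set_nonneg)
  finally have R1: "(\<Sum>l<k. \<Sum>b<d. (r l b)\<^sup>2) \<le> 1" by simp

  define h where "h = \<epsilon> / sqrt (real (k * d))"
  have h: "h > 0" using \<epsilon> d k by (simp add: h_def)
  define zr where "zr = (\<lambda>(l, b)\<in>I. \<lfloor>r l b / h\<rfloor>)"
  have zr: "\<bar>r l b - h * zr (l, b)\<bar> \<le> h" if "l < k" "b < d" for l b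
    using floor_rounding[OF h] that by (simp add: zr_def I_def)
  define r0 where "r0 l b = h * zr (l, b)" for l b
  have nr: "L2_set (\<lambda>(l, b). r l b) I \<le> 1"
    unfolding L2_set_def I_def using R1 by (simp add: sum.cartesian_product case_prod_beta)
  have "(\<Sum>i\<in>I. real_of_int \<bar>zr i\<bar>) \<le> sqrt (real (card I)) * L2_set (\<lambda>(l, b). r l b) I / h + real (card I)"
    by (rule l1_le_of_rounding[OF finI h]) (use zr in \<open>auto simp: I_def\<close>)
  also have "\<dots> \<le> sqrt (real (card I)) * 1 / h + real (card I)"
    by (intro add_right_mono divide_right_mono mult_left_mono nr) (use h in auto)
  also have "\<dots> = (1 / \<epsilon> + 1) * real (card I)"
    using \<epsilon> by (simp add: h_def cI distrib_right)
  finally have zr_ball: "zr \<in> int_l1_ball I (1 / \<epsilon> + 1)" by (auto simp: int_l1_ball_def zr_def)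

  have err: "(\<Sum>l<k. \<Sum>b<d. (r l b - r0 l b)\<^sup>2) \<le> \<epsilon>\<^sup>2"
  proof -
    have "(\<Sum>l<k. \<Sum>b<d. (r l b - r0 l b)\<^sup>2) \<le> (\<Sum>l<k. \<Sum>b<d. h\<^sup>2)"
      using zr by (intro sum_mono power2_le_of_abs_le) (auto simp: r0_def)
    also have "\<dots> = real (k * d) * h\<^sup>2" by simp
    also have "\<dots> = \<epsilon>\<^sup>2" using d k by (simp add: h_def power_divide)
    finally show ?thesis .
  qed
  have R0: "(\<Sum>l<k. \<Sum>b<d. (r0 l b)\<^sup>2) \<le> 4"
  proof -
    have "(\<Sum>l<k. \<Sum>b<d. (r0 l b)\<^sup>2) \<le> (\<Sum>l<k. \<Sum>b<d. 2 * (r l b)\<^sup>2 + 2 * (r l b - r0 l b)\<^sup>2)"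
    proof (intro sum_mono)
      fix l b
      have "2 * (r l b)\<^sup>2 + 2 * (r l b - r0 l b)\<^sup>2 - (r0 l b)\<^sup>2 = (2 * r l b - r0 l b)\<^sup>2"
        by (simp add: power2_eq_square algebra_simps)
      thus "(r0 l b)\<^sup>2 \<le> 2 * (r l b)\<^sup>2 + 2 * (r l b - r0 l b)\<^sup>2"
        using zero_le_power2[of "2 * r l b - r0 l b"] by linarith
    qed
    also have "\<dots> = 2 * (\<Sum>l<k. \<Sum>b<d. (r l b)\<^sup>2) + 2 * (\<Sum>l<k. \<Sum>b<d. (r l b - r0 l b)\<^sup>2)"
      by (simp add: sum.distrib sum_distrib_left)
    also have "\<dots> \<le> 2 * 1 + 2 * \<epsilon>\<^sup>2" using R1 err by linarith
    also have "\<dots> \<le> 4" using \<epsilon> by (simp add: power_le_one)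
    finally show ?thesis .
  qed

  \<comment> \<open>One greedy rounding per row \<open>a\<close>: each row costs at most
    \<open>4 * g\<^sup>2\<close>, and \<open>d\<close> rows give
    \<open>(2 * \<epsilon>)\<^sup>2\<close>.\<close>
  define g where "g = \<epsilon> / sqrt (real d)"
  have g: "g > 0" using \<epsilon> d by (simp add: g_def)
  have "\<forall>a. \<exists>z :: nat \<Rightarrow> int. (\<forall>l\<in>{..<k}. \<bar>q l a - g * z l\<bar> \<le> g) \<and>
     (\<Sum>b<d. (\<Sum>l<k. (q l a - g * z l) * r0 l b)\<^sup>2) \<le> g\<^sup>2 * (\<Sum>l<k. \<Sum>b<d. (r0 l b)\<^sup>2)"
    by (intro allI greedy_rounding g) auto
  then obtain z where z: "\<And>a l. l < k \<Longrightarrow> \<bar>q l a - g * of_int (z a l)\<bar> \<le> g"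
    "\<And>a. (\<Sum>b<d. (\<Sum>l<k. (q l a - g * of_int (z a l)) * r0 l b)\<^sup>2) \<le> g\<^sup>2 * (\<Sum>l<k. \<Sum>b<d. (r0 l b)\<^sup>2)"
    unfolding choice_iff by (auto simp: Ball_def)
  define zq where "zq = (\<lambda>(l, a)\<in>I. z a l)"
  have nq: "L2_set (\<lambda>(l, b). q l b) I \<le> sqrt (real k)"
  proof -
    have "(\<Sum>l<k. \<Sum>a<d. (q l a)\<^sup>2) \<le> (\<Sum>l<k. 1)" by (intro sum_mono) (use unit_le in auto)
    thus ?thesis unfolding L2_set_def I_def by (simp add: sum.cartesian_product case_prod_beta)
  qed
  have "(\<Sum>i\<in>I. real_of_int \<bar>zq i\<bar>) \<le> sqrt (real (card I)) * L2_set (\<lambda>(l, b). q l b) I / g + real (card I)"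
    by (rule l1_le_of_rounding[OF finI g]) (use z in \<open>auto simp: I_def zq_def\<close>)
  also have "\<dots> \<le> sqrt (real (card I)) * sqrt (real k) / g + real (card I)"
    by (intro add_right_mono divide_right_mono mult_left_mono nq) (use g in auto)
  also have "\<dots> = (1 / \<epsilon> + 1) * real (card I)"
    using \<epsilon> by (simp add: g_def cI algebra_simps real_sqrt_mult)
  finally have zq_ball: "zq \<in> int_l1_ball I (1 / \<epsilon> + 1)" by (auto simp: int_l1_ball_def zq_def)

  \<comment> \<open>The error splits as Q (R - R0) + (Q - Q0) R0, two terms that again have rank at
    most \<open>k\<close>.\<close>
  define Y where "Y = (\<lambda>(a, b). \<Sum>l<k. q l a * (r l b - r0 l b))"
  define Z where "Z = (\<lambda>(a, b). \<Sum>l<k. (q l a - g * zq (l, a)) * r0 l b)"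
  have Y: "low_rank d k Y" "low_rank d k Z"
    by (auto simp: low_rank_def Y_def Z_def)
  have "(\<Sum>e\<in>Sq d. (Y e)\<^sup>2) = (\<Sum>l<k. (\<Sum>a<d. (q l a)\<^sup>2) * (\<Sum>b<d. (r l b - r0 l b)\<^sup>2))"
    unfolding Sq_def Y_def
    by (subst sum_squares_orthogonal[symmetric]) (use orth in \<open>auto intro!: sum.cong\<close>)
  also have "\<dots> \<le> (\<Sum>l<k. 1 * (\<Sum>b<d. (r l b - r0 l b)\<^sup>2))"
    by (intro sum_mono mult_right_mono unit_le sum_nonneg) auto
  also have "\<dots> \<le> (2 * \<epsilon>)\<^sup>2"
  proof -
    have "\<epsilon>\<^sup>2 \<le> (2 * \<epsilon>)\<^sup>2" by (simp add: power_mult_distrib)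
    from order_trans[OF err this] show ?thesis by simp
  qed
  finally have nY: "L2_set Y (Sq d) \<le> 2 * \<epsilon>" unfolding L2_set_def using \<epsilon> by (intro real_le_lsqrt) auto
  have "(\<Sum>e\<in>Sq d. (Z e)\<^sup>2) = (\<Sum>a<d. \<Sum>b<d. (\<Sum>l<k. (q l a - g * of_int (z a l)) * r0 l b)\<^sup>2)"
    unfolding Sq_def Z_def sum.cartesian_product
    by (intro sum.cong refl) (auto simp: zq_def I_def)
  also have "\<dots> \<le> (\<Sum>a<d. g\<^sup>2 * (\<Sum>l<k. \<Sum>b<d. (r0 l b)\<^sup>2))" by (intro sum_mono z)
  also have "\<dots> = \<epsilon>\<^sup>2 * (\<Sum>l<k. \<Sum>b<d. (r0 l b)\<^sup>2)" using d by (simp add: g_def power_divide)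
  also have "\<dots> \<le> \<epsilon>\<^sup>2 * 4" by (intro mult_left_mono R0) auto
  also have "\<dots> = (2 * \<epsilon>)\<^sup>2" by (simp add: power_mult_distrib)
  finally have nZ: "L2_set Z (Sq d) \<le> 2 * \<epsilon>" unfolding L2_set_def using \<epsilon> by (intro real_le_lsqrt) auto
  have "X e = lr_code d k \<epsilon> zq zr e + Y e + Z e" if eS: "e \<in> Sq d" for e
  proof -
    obtain a b where e: "e = (a, b)" "a < d" "b < d" using eS by (auto simp: Sq_def)
    have "lr_code d k \<epsilon> zq zr e = (\<Sum>l<k. (g * zq (l, a)) * r0 l b)"
      by (simp add: e lr_code_def g_def h_def r0_def)
    thus ?thesis unfolding e Xqr[OF e(2,3)] Y_def Z_def
      by (simp add: sum.distrib[symmetric] algebra_simps)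
  qed
  thus ?thesis using zq_ball zr_ball Y nY nZ unfolding I_def[symmetric] by blast
qed

text \<open>A net point has to lie in \<open>K\<close>, so each nonempty code class is represented
  by one of its members. Two members of a class differ by their four rounding errors. These are kept
  apart because each has rank at most \<open>k\<close>, while their sum is only known to have rank
  at most \<open>4 * k\<close>.\<close>

lemma low_rank_net:
  assumes K: "\<And>X. X \<in> K \<Longrightarrow> low_rank d k X \<and> L2_set X (Sq d) \<le> 1" and \<epsilon>: "0 < \<epsilon>" "\<epsilon> \<le> 1"
    and d: "d \<ge> 1" and k: "k \<ge> 1"
  obtains N where "N \<subseteq> K" "finite N" "real (card N) \<le> (exp 1 * (3 + 2 / \<epsilon>)) ^ (2 * d * k)"
    "\<And>X. X \<in> K \<Longrightarrow> \<exists>X0\<in>N. \<exists>Y. (\<forall>j<4. low_rank d k (Y j) \<and> L2_set (Y j) (Sq d) \<le> 2 * \<epsilon>) \<and>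
        (\<forall>e\<in>Sq d. X e = X0 e + (\<Sum>j<4::nat. Y j e))"
proof -
  define B where "B = int_l1_ball ({..<k} \<times> {..<d}) (1 / \<epsilon> + 1)"
  define R where "R X z \<longleftrightarrow> (\<exists>Y Z. low_rank d k Y \<and> low_rank d k Z \<and> L2_set Y (Sq d) \<le> 2 * \<epsilon> \<and>
      L2_set Z (Sq d) \<le> 2 * \<epsilon> \<and> (\<forall>e\<in>Sq d. X e = lr_code d k \<epsilon> (fst z) (snd z) e + Y e + Z e))" for X z
  define C where "C = {z \<in> B \<times> B. \<exists>X\<in>K. R X z}"
  define rep where "rep z = (SOME X. X \<in> K \<and> R X z)" for z
  have rep: "rep z \<in> K" "R (rep z) z" if "z \<in> C" for z
    using someI_ex[of "\<lambda>X. X \<in> K \<and> R X z"] that unfolding rep_def C_def by blast+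
  have pos: "0 < 1 / \<epsilon> + 1" using \<epsilon> by (simp add: add_pos_pos)
  have B: "finite B" "real (card B) \<le> (exp 1 * (3 + 2 / \<epsilon>)) ^ (k * d)"
    using int_l1_ball_card[of "{..<k} \<times> {..<d}", OF _ pos] by (auto simp: B_def algebra_simps)
  have C: "finite C" by (rule finite_subset[of _ "B \<times> B"]) (use B in \<open>auto simp: C_def\<close>)
  have "card C \<le> card (B \<times> B)" by (rule card_mono) (use B in \<open>auto simp: C_def\<close>)
  moreover have "card (rep ` C) \<le> card C" by (rule card_image_le[OF C])
  ultimately have "real (card (rep ` C)) \<le> real (card B) * real (card B)"
    using B by (simp add: card_cartesian_product flip: of_nat_mult)
  also have "\<dots> \<le> (exp 1 * (3 + 2 / \<epsilon>)) ^ (k * d) * (exp 1 * (3 + 2 / \<epsilon>)) ^ (k * d)"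
    by (intro mult_mono B) (use \<epsilon> in auto)
  also have "\<dots> = (exp 1 * (3 + 2 / \<epsilon>)) ^ (2 * d * k)"
    unfolding power_add[symmetric] by (rule arg_cong[of _ _ "power _"]) simp
  finally have card: "real (card (rep ` C)) \<le> (exp 1 * (3 + 2 / \<epsilon>)) ^ (2 * d * k)" .
  have "\<exists>X0\<in>rep ` C. \<exists>Y. (\<forall>j<4. low_rank d k (Y j) \<and> L2_set (Y j) (Sq d) \<le> 2 * \<epsilon>) \<and>
        (\<forall>e\<in>Sq d. X e = X0 e + (\<Sum>j<4::nat. Y j e))" if X: "X \<in> K" for X
  proof -
    obtain zq zr where "zq \<in> B" "zr \<in> B" "R X (zq, zr)"
      using low_rank_rounding[OF _ _ \<epsilon> d k, of X] K[OF X] unfolding B_def R_def by fastforce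
    hence z: "(zq, zr) \<in> C" (is "?z \<in> C") using X by (auto simp: C_def)
    obtain Y Z where YZ: "low_rank d k Y" "low_rank d k Z" "L2_set Y (Sq d) \<le> 2 * \<epsilon>"
      "L2_set Z (Sq d) \<le> 2 * \<epsilon>" "\<forall>e\<in>Sq d. X e = lr_code d k \<epsilon> zq zr e + Y e + Z e"
      using \<open>R X ?z\<close> unfolding R_def by auto
    obtain Y' Z' where YZ': "low_rank d k Y'" "low_rank d k Z'" "L2_set Y' (Sq d) \<le> 2 * \<epsilon>"
      "L2_set Z' (Sq d) \<le> 2 * \<epsilon>" "\<forall>e\<in>Sq d. rep ?z e = lr_code d k \<epsilon> zq zr e + Y' e + Z' e"
      using rep(2)[OF z] unfolding R_def by auto
    have neg: "low_rank d k (\<lambda>e. - W e)" "L2_set (\<lambda>e. - W e) (Sq d) = L2_set W (Sq d)" if "low_rank d k W" for W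
      using low_rank_smult[OF that, of "-1"] by (auto simp: L2_set_def)
    define V where "V j = (if j = 0 then Y else if j = 1 then Z else if j = 2 then (\<lambda>e. - Y' e) else (\<lambda>e. - Z' e))" for j :: nat
    have "\<forall>j<4. low_rank d k (V j) \<and> L2_set (V j) (Sq d) \<le> 2 * \<epsilon>"
      using YZ YZ' neg by (auto simp: V_def)
    moreover have "\<forall>e\<in>Sq d. X e = rep ?z e + (\<Sum>j<4::nat. V j e)"
      using YZ(5) YZ'(5) by (auto simp: V_def eval_nat_numeral)
    ultimately show ?thesis using z by blast
  qed
  thus ?thesis using that[of "rep ` C"] rep C card by blast
qed

text \<open>The version without rank structure, for the sphere of test vectors. The error doubles
  because an element is compared with a member of \<open>K\<close> of the same code and not with the
  code itself.\<close>

lemma unit_ball_net: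
  fixes K :: "('i \<Rightarrow> real) set"
  assumes fin: "finite I" "I \<noteq> {}" and K: "\<And>x. x \<in> K \<Longrightarrow> L2_set x I \<le> 1" and \<epsilon>: "0 < \<epsilon>"
  obtains N where "N \<subseteq> K" "finite N" "real (card N) \<le> (exp 1 * (3 + 2 / \<epsilon>)) ^ card I"
    "\<And>x. x \<in> K \<Longrightarrow> \<exists>y\<in>N. L2_set (\<lambda>i. x i - y i) I \<le> 2 * \<epsilon>"
proof -
  define h where "h = \<epsilon> / sqrt (real (card I))"
  have c0: "card I > 0" using fin by (simp add: card_gt_0_iff)
  hence h: "h > 0" using \<epsilon> by (simp add: h_def)
  define code where "code x = (\<lambda>i\<in>I. \<lfloor>x i / h\<rfloor>)" for x :: "'i \<Rightarrow> real"
  have rnd: "\<bar>x i - h * of_int (code x i)\<bar> \<le> h" if "i \<in> I" for x i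
    using floor_rounding[OF h] that by (simp add: code_def)
  have code: "code x \<in> int_l1_ball I (1 / \<epsilon> + 1)" if "x \<in> K" for x
  proof -
    have "(\<Sum>i\<in>I. real_of_int \<bar>code x i\<bar>) \<le> sqrt (real (card I)) * L2_set x I / h + real (card I)"
      by (rule l1_le_of_rounding[OF fin(1) h rnd])
    also have "\<dots> \<le> sqrt (real (card I)) * 1 / h + real (card I)"
      by (intro add_right_mono divide_right_mono mult_left_mono K that) (use h in auto)
    also have "\<dots> = (1 / \<epsilon> + 1) * real (card I)"
      using \<epsilon> by (simp add: h_def distrib_right)
    finally show ?thesis by (auto simp: int_l1_ball_def code_def)
  qed
  define rep where "rep z = (SOME x. x \<in> K \<and> code x = z)" for z
  have rep: "rep (code x) \<in> K" "code (rep (code x)) = code x" if "x \<in> K" for x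
    using someI_ex[of "\<lambda>y. y \<in> K \<and> code y = code x"] that unfolding rep_def by blast+
  have pos: "0 < 1 / \<epsilon> + 1" using \<epsilon> by (simp add: add_pos_pos)
  note B = int_l1_ball_card[OF fin(1) pos]
  have sub: "code ` K \<subseteq> int_l1_ball I (1 / \<epsilon> + 1)" using code by auto
  have finC: "finite (code ` K)" by (rule finite_subset[OF sub B(1)])
  have "card (rep ` code ` K) \<le> card (code ` K)" by (rule card_image_le[OF finC])
  also have "\<dots> \<le> card (int_l1_ball I (1 / \<epsilon> + 1))" by (rule card_mono[OF B(1) sub])
  finally have card: "real (card (rep ` code ` K)) \<le> (exp 1 * (3 + 2 / \<epsilon>)) ^ card I"
    using B(2) by (simp add: algebra_simps)
  have "\<exists>y\<in>rep ` code ` K. L2_set (\<lambda>i. x i - y i) I \<le> 2 * \<epsilon>" if x: "x \<in> K" for x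
  proof -
    let ?y = "rep (code x)"
    have "\<bar>x i - ?y i\<bar> \<le> 2 * h" if i: "i \<in> I" for i
      using rnd[OF i, of x] rnd[OF i, of ?y] rep(2)[OF x] by auto
    hence "(\<Sum>i\<in>I. (x i - ?y i)\<^sup>2) \<le> (\<Sum>i\<in>I. (2 * h)\<^sup>2)"
      using h by (intro sum_mono power2_le_of_abs_le) auto
    also have "\<dots> = (2 * \<epsilon>)\<^sup>2" using c0 by (simp add: h_def power_mult_distrib power_divide)
    finally have "L2_set (\<lambda>i. x i - ?y i) I \<le> 2 * \<epsilon>" unfolding L2_set_def using \<epsilon> by (intro real_le_lsqrt) auto
    thus ?thesis using x by blast
  qed
  thus ?thesis using that[of "rep ` code ` K"] rep finC card by blast
qed

section \<open>Exponential moments and Chernoff bounds\<close>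

text \<open>The linear term is kept exact, so that integration turns it into the mean, and the rest
  is a moment of Gaussian type. For \<open>x \<ge> 1\<close> it is just x <= x^2; elsewhere a
  quadratic Taylor bound suffices.\<close>

lemma exp_le_add_exp_sq: "exp (x::real) \<le> x + exp (x\<^sup>2)"
proof -
  have sq: "1 + x\<^sup>2 \<le> exp (x\<^sup>2)" by (rule exp_ge_add_one_self)
  consider "x \<ge> 1" | "0 \<le> x" "x \<le> 1" | "x \<le> 0" by linarith
  thus ?thesis
  proof cases
    case 1
    hence "x * 1 \<le> x * x" by (intro mult_left_mono) auto
    hence "exp x \<le> exp (x\<^sup>2)" by (simp add: power2_eq_square)
    thus ?thesis using 1 by linarith
  next
    case 2
    have "exp x \<le> 1 + x + x\<^sup>2" by (rule exp_bound) (use 2 in auto)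
    thus ?thesis using sq by linarith
  next
    case 3
    define y where "y = - x"
    have y: "y \<ge> 0" using 3 by (simp add: y_def)
    have "(1 + y + y\<^sup>2 / 2) \<le> exp y" using exp_lower_Taylor_quadratic[OF y] by simp
    moreover have "0 < 1 + y + y\<^sup>2 / 2" using y by (intro add_pos_nonneg) auto
    ultimately have "exp (- y) \<le> 1 / (1 + y + y\<^sup>2 / 2)"
      by (simp add: exp_minus divide_simps)
    also have "\<dots> \<le> 1 - y + y\<^sup>2"
    proof -
      have "(1 - y + y\<^sup>2) * (1 + y + y\<^sup>2 / 2) - 1 = y\<^sup>2 / 2 + y ^ 3 / 2 + y ^ 4 / 2"
        by (simp add: field_simps power2_eq_square power3_eq_cube power4_eq_xxxx)
      hence "1 \<le> (1 - y + y\<^sup>2) * (1 + y + y\<^sup>2 / 2)" using y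
        by (smt (verit) zero_le_power divide_nonneg_nonneg)
      thus ?thesis using \<open>0 < 1 + y + y\<^sup>2 / 2\<close> by (simp add: divide_le_eq)
    qed
    finally have "exp x \<le> 1 + x + x\<^sup>2" by (simp add: y_def)
    thus ?thesis using sq by linarith
  qed
qed

text \<open>Convexity of \<open>exp\<close> on the segment from 0 to \<open>y\<close>, obtained from
  the tangent at \<open>s * y\<close> evaluated at the two ends.\<close>

lemma exp_convex_combination: 
  fixes s y :: real assumes "0 \<le> s" "s \<le> 1"
  shows "exp (s * y) \<le> 1 + s * (exp y - 1)"
proof -
  have "exp (s * y) * (1 - s * y + y * s) \<le> 1 + s * (exp y - 1)"
  proof -
    have 1: "exp (s * y) * (1 + (y - s * y)) \<le> exp y"
    proof -
      have "exp (s * y) * (1 + (y - s * y)) \<le> exp (s * y) * exp (y - s * y)"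
        by (intro mult_left_mono exp_ge_add_one_self) auto
      thus ?thesis by (simp add: exp_diff)
    qed
    have 2: "exp (s * y) * (1 + - (s * y)) \<le> 1"
    proof -
      have "exp (s * y) * (1 + - (s * y)) \<le> exp (s * y) * exp (- (s * y))"
        by (intro mult_left_mono exp_ge_add_one_self) auto
      thus ?thesis by (simp add: exp_minus)
    qed
    have "s * (exp (s * y) * (1 + (y - s * y))) + (1 - s) * (exp (s * y) * (1 + - (s * y))) \<le> s * exp y + (1 - s) * 1"
      by (intro add_mono mult_left_mono 1 2) (use assms in auto)
    thus ?thesis by (simp add: algebra_simps)
  qed
  thus ?thesis by (simp add: mult.commute)
qed

section \<open>Exponential moments of a standard Gaussian\<close>

lemma normal_density_tilt:
  "exp (c * x) * std_normal_density x = exp (c\<^sup>2 / 2) * normal_density c 1 x"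
proof -
  have "c * x + - x\<^sup>2 / 2 = c\<^sup>2 / 2 + - (x - c)\<^sup>2 / 2"
    by (simp add: power2_eq_square field_simps)
  hence "exp (c * x) * exp (- x\<^sup>2 / 2) = exp (c\<^sup>2 / 2) * exp (- (x - c)\<^sup>2 / 2)"
    by (simp add: exp_add[symmetric])
  thus ?thesis by (simp add: normal_density_def)
qed

lemma normal_density_exp_sq:
  "exp (x\<^sup>2 / 4) * std_normal_density x = sqrt 2 * normal_density 0 (sqrt 2) x"
proof -
  have "exp (x\<^sup>2 / 4) * exp (- x\<^sup>2 / 2) = exp (- x\<^sup>2 / 4)"
    by (simp add: exp_add[symmetric])
  thus ?thesis by (simp add: normal_density_def real_sqrt_mult field_simps)
qed

lemma nn_integral_normal_density [simp]:
  "\<sigma> > 0 \<Longrightarrow> (\<integral>\<^sup>+x. ennreal (normal_density \<mu> \<sigma> x) \<partial>lborel) = 1"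
  by (subst nn_integral_eq_integral) auto

lemma std_normal_density_le_half: "std_normal_density x \<le> 1 / 2"
proof -
  have "exp (- x\<^sup>2 / 2) \<le> 1" by simp
  moreover have "2 \<le> sqrt (2 * pi)"
    by (rule real_le_rsqrt) (use pi_ge_two in \<open>simp add: power2_eq_square\<close>)
  ultimately have "exp (- x\<^sup>2 / 2) / sqrt (2 * pi) \<le> 1 / 2" by (intro frac_le) auto
  thus ?thesis by (simp add: std_normal_density_def)
qed

context prob_space
begin

abbreviation std_gaussian :: "('a \<Rightarrow> real) \<Rightarrow> bool" where
  "std_gaussian g \<equiv> distributed M lborel g std_normal_density"

lemma std_gaussian_measurable: "std_gaussian g \<Longrightarrow> g \<in> borel_measurable M"
  by (auto simp: distributed_def)

lemma std_gaussian_exp_sq: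
  assumes g: "std_gaussian g"
  shows "(\<integral>\<^sup>+\<omega>. ennreal (exp ((g \<omega>)\<^sup>2 / 4)) \<partial>M) = ennreal (sqrt 2)"
proof -
  have "(\<integral>\<^sup>+\<omega>. ennreal (exp ((g \<omega>)\<^sup>2 / 4)) \<partial>M) = (\<integral>\<^sup>+x. ennreal (std_normal_density x) * ennreal (exp (x\<^sup>2 / 4)) \<partial>lborel)"
    by (subst distributed_nn_integral[OF g]) auto
  also have "\<dots> = (\<integral>\<^sup>+x. ennreal (sqrt 2) * ennreal (normal_density 0 (sqrt 2) x) \<partial>lborel)"
    by (intro nn_integral_cong) (metis normal_density_exp_sq ennreal_mult' mult.commute normal_density_nonneg exp_ge_zero real_sqrt_ge_zero zero_le_numeral)
  also have "\<dots> = ennreal (sqrt 2)" by (subst nn_integral_cmult) auto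
  finally show ?thesis .
qed

lemma std_gaussian_exp:
  assumes g: "std_gaussian g"
  shows "(\<integral>\<^sup>+\<omega>. ennreal (exp (c * g \<omega>)) \<partial>M) = ennreal (exp (c\<^sup>2 / 2))"
proof -
  have "(\<integral>\<^sup>+\<omega>. ennreal (exp (c * g \<omega>)) \<partial>M) = (\<integral>\<^sup>+x. ennreal (std_normal_density x) * ennreal (exp (c * x)) \<partial>lborel)"
    by (subst distributed_nn_integral[OF g]) auto
  also have "\<dots> = (\<integral>\<^sup>+x. ennreal (exp (c\<^sup>2 / 2)) * ennreal (normal_density c 1 x) \<partial>lborel)"
    by (intro nn_integral_cong) (metis normal_density_tilt ennreal_mult' mult.commute normal_density_nonneg exp_ge_zero)
  also have "\<dots> = ennreal (exp (c\<^sup>2 / 2))" by (subst nn_integral_cmult) auto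
  finally show ?thesis .
qed

lemma std_gaussian_exp_abs:
  assumes g: "std_gaussian g"
  shows "(\<integral>\<^sup>+\<omega>. ennreal (exp (c * \<bar>g \<omega>\<bar>)) \<partial>M) \<le> ennreal (2 * exp (c\<^sup>2 / 2))"
proof -
  note [measurable] = std_gaussian_measurable[OF g]
  have "(\<integral>\<^sup>+\<omega>. ennreal (exp (c * \<bar>g \<omega>\<bar>)) \<partial>M) \<le> (\<integral>\<^sup>+\<omega>. ennreal (exp (c * g \<omega>)) + ennreal (exp ((- c) * g \<omega>)) \<partial>M)"
    by (intro nn_integral_mono) (auto simp: abs_if simp flip: ennreal_plus intro!: ennreal_leI)
  also have "\<dots> = ennreal (exp (c\<^sup>2 / 2)) + ennreal (exp (c\<^sup>2 / 2))"
    by (subst nn_integral_add) (auto simp: std_gaussian_exp[OF g] std_gaussian_exp[OF g, of "- c", simplified])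
  also have "\<dots> = ennreal (2 * exp (c\<^sup>2 / 2))" by (simp flip: ennreal_plus)
  finally show ?thesis .
qed

lemma std_gaussian_integrable:
  assumes g: "std_gaussian g"
  shows "integrable M g" "integrable M (\<lambda>\<omega>. (g \<omega>)\<^sup>2)" "expectation (\<lambda>\<omega>. (g \<omega>)\<^sup>2) = 1"
    "integrable M (\<lambda>\<omega>. exp ((g \<omega>)\<^sup>2 / 4))" "expectation (\<lambda>\<omega>. exp ((g \<omega>)\<^sup>2 / 4)) = sqrt 2"
proof -
  note [measurable] = std_gaussian_measurable[OF g]
  show "integrable M g"
    using distributed_integrable[OF g, of "\<lambda>x. x"] integrable_std_normal_moment[of 1] by simp
  show "integrable M (\<lambda>\<omega>. (g \<omega>)\<^sup>2)"
    using distributed_integrable[OF g, of "\<lambda>x. x\<^sup>2"] integrable_std_normal_moment[of 2] by simp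
  show "expectation (\<lambda>\<omega>. (g \<omega>)\<^sup>2) = 1"
    using distributed_integral[OF g, of "\<lambda>x. x\<^sup>2"] integral_std_normal_moment_even[of 1] by simp
  show 1: "integrable M (\<lambda>\<omega>. exp ((g \<omega>)\<^sup>2 / 4))"
    by (rule integrableI_nonneg) (auto simp: std_gaussian_exp_sq[OF g])
  show "expectation (\<lambda>\<omega>. exp ((g \<omega>)\<^sup>2 / 4)) = sqrt 2"
    using std_gaussian_exp_sq[OF g] nn_integral_eq_integral[OF 1] by simp
qed

lemma dominated_by_gaussian_integrable:
  assumes g: "std_gaussian g" and Y: "Y \<in> borel_measurable M" and dom: "\<And>\<omega>. \<omega> \<in> space M \<Longrightarrow> \<bar>Y \<omega>\<bar> \<le> \<bar>g \<omega>\<bar>"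
  shows "integrable M Y"
  by (rule Bochner_Integration.integrable_bound[OF std_gaussian_integrable(1)[OF g] Y]) (use dom in auto)

text \<open>With the weight 4 c^2 <= 1, convexity passes from exp(c^2 g^2) to exp(g^2/4), whose mean
  is sqrt 2, and 4 (sqrt 2 - 1) <= 2. Only domination by a Gaussian is asked, so \<open>Y\<close>
  may be a Gaussian times a sign that depends on it, and its mean may be nonzero.\<close>

lemma dominated_by_gaussian_exp:
  assumes g: "std_gaussian g" and Y[measurable]: "Y \<in> borel_measurable M"
    and dom: "\<And>\<omega>. \<omega> \<in> space M \<Longrightarrow> \<bar>Y \<omega>\<bar> \<le> \<bar>g \<omega>\<bar>" and c: "\<bar>c\<bar> \<le> 1 / 2"
  shows "(\<integral>\<^sup>+\<omega>. ennreal (exp (c * Y \<omega>)) \<partial>M) \<le> ennreal (exp (c * expectation Y + 2 * c\<^sup>2))"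
proof -
  note G = std_gaussian_integrable[OF g]
  note [measurable] = std_gaussian_measurable[OF g]
  have intY: "integrable M Y" by (rule dominated_by_gaussian_integrable[OF g Y dom])
  have c2: "c\<^sup>2 \<le> 1 / 4" using abs_le_square_iff[of c "1/2"] c by (simp add: power2_eq_square)
  have bnd: "exp (c * Y \<omega>) \<le> c * Y \<omega> + (1 + 4 * c\<^sup>2 * (exp ((g \<omega>)\<^sup>2 / 4) - 1))" if "\<omega> \<in> space M" for \<omega>
  proof -
    have "exp (c * Y \<omega>) \<le> c * Y \<omega> + exp ((c * Y \<omega>)\<^sup>2)" by (rule exp_le_add_exp_sq)
    also have "(c * Y \<omega>)\<^sup>2 \<le> (4 * c\<^sup>2) * ((g \<omega>)\<^sup>2 / 4)"
      using dom[OF that] by (simp add: power_mult_distrib mult_left_mono abs_le_square_iff)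
    also have "exp ((4 * c\<^sup>2) * ((g \<omega>)\<^sup>2 / 4)) \<le> 1 + 4 * c\<^sup>2 * (exp ((g \<omega>)\<^sup>2 / 4) - 1)"
      by (rule exp_convex_combination) (use c2 in auto)
    finally show ?thesis by simp
  qed
  have int: "integrable M (\<lambda>\<omega>. c * Y \<omega> + (1 + 4 * c\<^sup>2 * (exp ((g \<omega>)\<^sup>2 / 4) - 1)))"
    using G(4) intY by auto
  have "(\<integral>\<^sup>+\<omega>. ennreal (exp (c * Y \<omega>)) \<partial>M) \<le> (\<integral>\<^sup>+\<omega>. ennreal (c * Y \<omega> + (1 + 4 * c\<^sup>2 * (exp ((g \<omega>)\<^sup>2 / 4) - 1))) \<partial>M)"
    by (intro nn_integral_mono ennreal_leI bnd)
  also have "\<dots> = ennreal (expectation (\<lambda>\<omega>. c * Y \<omega> + (1 + 4 * c\<^sup>2 * (exp ((g \<omega>)\<^sup>2 / 4) - 1))))"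
    by (rule nn_integral_eq_integral[OF int]) 
       (auto intro!: AE_I2 order_trans[OF _ bnd])
  also have "expectation (\<lambda>\<omega>. c * Y \<omega> + (1 + 4 * c\<^sup>2 * (exp ((g \<omega>)\<^sup>2 / 4) - 1)))
      = c * expectation Y + (1 + 4 * c\<^sup>2 * (sqrt 2 - 1))"
    using G(4,5) intY by (simp add: prob_space)
  also have "\<dots> \<le> 1 + (c * expectation Y + 2 * c\<^sup>2)"
  proof -
    have "sqrt 2 \<le> 3 / 2" by (rule real_le_lsqrt) (auto simp: power2_eq_square)
    hence "4 * c\<^sup>2 * (sqrt 2 - 1) \<le> 4 * c\<^sup>2 * (1 / 2)" by (intro mult_left_mono) auto
    thus ?thesis by simp
  qed
  also have "\<dots> \<le> exp (c * expectation Y + 2 * c\<^sup>2)" by (rule exp_ge_add_one_self)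
  finally show ?thesis by (simp add: ennreal_leI)
qed

text \<open>The exponential parameter is absorbed into \<open>Y\<close>, so each application chooses
  it, and the summands may have different bounds \<open>b i\<close>.\<close>

lemma chernoff_bound:
  fixes Y :: "'i \<Rightarrow> 'a \<Rightarrow> real"
  assumes I: "finite I" and ind: "indep_vars (\<lambda>_. borel) Y I"
    and mgf: "\<And>i. i \<in> I \<Longrightarrow> (\<integral>\<^sup>+\<omega>. ennreal (exp (Y i \<omega>)) \<partial>M) \<le> ennreal (exp (b i))"
  shows "prob {\<omega>\<in>space M. a \<le> (\<Sum>i\<in>I. Y i \<omega>)} \<le> exp ((\<Sum>i\<in>I. b i) - a)"
proof -
  have Ym[measurable]: "\<And>i. i \<in> I \<Longrightarrow> Y i \<in> borel_measurable M" using ind by (auto simp: indep_vars_def)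
  have ind2: "indep_vars (\<lambda>_. borel) (\<lambda>i \<omega>. ennreal (exp (Y i \<omega>))) I"
    by (rule indep_vars_compose2[OF ind, where Y = "\<lambda>_ x. ennreal (exp x)"]) auto
  have "emeasure M {\<omega>\<in>space M. a \<le> (\<Sum>i\<in>I. Y i \<omega>)} = emeasure M ({\<omega>\<in>space M. 1 \<le> ennreal (exp (- a)) * ennreal (exp (\<Sum>i\<in>I. Y i \<omega>))})"
    by (intro arg_cong2[where f=emeasure] refl Collect_cong conj_cong)
       (auto simp: ennreal_mult'[symmetric] exp_add[symmetric] simp flip: ennreal_1)
  also have "\<dots> \<le> ennreal (exp (- a)) * (\<integral>\<^sup>+\<omega>. ennreal (exp (\<Sum>i\<in>I. Y i \<omega>)) * indicator (space M) \<omega> \<partial>M)"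
    by (rule nn_integral_Markov_inequality) auto
  also have "(\<integral>\<^sup>+\<omega>. ennreal (exp (\<Sum>i\<in>I. Y i \<omega>)) * indicator (space M) \<omega> \<partial>M) = (\<integral>\<^sup>+\<omega>. (\<Prod>i\<in>I. ennreal (exp (Y i \<omega>))) \<partial>M)"
    by (intro nn_integral_cong) (simp add: exp_sum I prod_ennreal)
  also have "\<dots> = (\<Prod>i\<in>I. \<integral>\<^sup>+\<omega>. ennreal (exp (Y i \<omega>)) \<partial>M)"
    by (rule indep_vars_nn_integral[OF I ind2]) auto
  also have "\<dots> \<le> (\<Prod>i\<in>I. ennreal (exp (b i)))"
    using I mgf by (induct I) (auto intro!: mult_mono)
  also have "ennreal (exp (- a)) * (\<Prod>i\<in>I. ennreal (exp (b i))) = ennreal (exp ((\<Sum>i\<in>I. b i) - a))"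
    by (simp add: prod_ennreal exp_sum[OF I, symmetric] ennreal_mult'[symmetric] exp_add[symmetric])
  finally show ?thesis by (simp add: emeasure_eq_measure mult_left_mono)
qed

lemma gaussian_dominated_deviation:
  fixes Y :: "nat \<Rightarrow> 'a \<Rightarrow> real"
  assumes ind: "indep_vars (\<lambda>_. borel) Y {..<m}" and g: "\<And>i. i < m \<Longrightarrow> std_gaussian (g i)"
    and dom: "\<And>i \<omega>. i < m \<Longrightarrow> \<omega> \<in> space M \<Longrightarrow> \<bar>Y i \<omega>\<bar> \<le> \<bar>g i \<omega>\<bar>" and x: "0 \<le> x" "x \<le> 2"
  shows "prob {\<omega>\<in>space M. real m * x \<le> \<bar>\<Sum>i<m. Y i \<omega> - expectation (Y i)\<bar>} \<le> 2 * exp (- real m * x\<^sup>2 / 8)"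
proof -
  have Ym[measurable]: "Y i \<in> borel_measurable M" if "i \<in> {..<m}" for i using ind that by (auto simp: indep_vars_def)
  have one: "prob {\<omega>\<in>space M. real m * x \<le> (\<Sum>i<m. s * (Y i \<omega> - expectation (Y i)))} \<le> exp (- real m * x\<^sup>2 / 8)"
    if s: "\<bar>s\<bar> = 1" for s :: real
  proof -
    \<comment> \<open>The minimiser of 2 l^2 - l x, with value - x^2 / 8; \<open>x \<le> 2\<close>
      keeps it within the range 1/2 of the moment bound.\<close>
    define l where "l = x / 4"
    have s2: "s\<^sup>2 = 1" using s by (metis one_power2 power2_abs)
    have l: "0 \<le> l" "l \<le> 1 / 2" using x by (auto simp: l_def)
    have ind': "indep_vars (\<lambda>_. borel) (\<lambda>i \<omega>. l * s * Y i \<omega>) {..<m}"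
      by (rule indep_vars_compose2[OF ind, where Y = "\<lambda>_ y. l * s * y"]) auto
    have "prob {\<omega>\<in>space M. l * (real m * x) + (\<Sum>i<m. l * s * expectation (Y i)) \<le> (\<Sum>i<m. l * s * Y i \<omega>)}
        \<le> exp ((\<Sum>i<m. l * s * expectation (Y i) + 2 * (l * s)\<^sup>2) - (l * (real m * x) + (\<Sum>i<m. l * s * expectation (Y i))))"
    proof (rule chernoff_bound[OF _ ind'])
      fix i assume i: "i \<in> {..<m}"
      show "(\<integral>\<^sup>+\<omega>. ennreal (exp (l * s * Y i \<omega>)) \<partial>M) \<le> ennreal (exp (l * s * expectation (Y i) + 2 * (l * s)\<^sup>2))"
        by (rule dominated_by_gaussian_exp[OF g[of i]]) (use i dom l s in \<open>auto simp: abs_mult\<close>)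
    qed auto
    also have "(\<Sum>i<m. l * s * expectation (Y i) + 2 * (l * s)\<^sup>2) - (l * (real m * x) + (\<Sum>i<m. l * s * expectation (Y i)))
        = real m * (2 * l\<^sup>2) - l * (real m * x)"
      using s2 by (simp add: sum.distrib power_mult_distrib)
    also have "real m * (2 * l\<^sup>2) - l * (real m * x) = - real m * x\<^sup>2 / 8"
      by (simp add: l_def power2_eq_square field_simps)
    finally have *: "prob {\<omega>\<in>space M. l * (real m * x) + (\<Sum>i<m. l * s * expectation (Y i)) \<le> (\<Sum>i<m. l * s * Y i \<omega>)} \<le> exp (- real m * x\<^sup>2 / 8)" .
    have "prob {\<omega>\<in>space M. real m * x \<le> (\<Sum>i<m. s * (Y i \<omega> - expectation (Y i)))} \<le>
      prob {\<omega>\<in>space M. l * (real m * x) + (\<Sum>i<m. l * s * expectation (Y i)) \<le> (\<Sum>i<m. l * s * Y i \<omega>)}"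
    proof (rule finite_measure_mono)
      show "{\<omega>\<in>space M. real m * x \<le> (\<Sum>i<m. s * (Y i \<omega> - expectation (Y i)))} \<subseteq>
        {\<omega>\<in>space M. l * (real m * x) + (\<Sum>i<m. l * s * expectation (Y i)) \<le> (\<Sum>i<m. l * s * Y i \<omega>)}"
      proof safe
        fix \<omega> assume "real m * x \<le> (\<Sum>i<m. s * (Y i \<omega> - expectation (Y i)))"
        hence "l * (real m * x) \<le> l * (\<Sum>i<m. s * (Y i \<omega> - expectation (Y i)))"
          by (rule mult_left_mono) (use l in auto)
        also have "\<dots> = (\<Sum>i<m. l * s * Y i \<omega>) - (\<Sum>i<m. l * s * expectation (Y i))"
          by (simp add: sum_distrib_left sum_subtractf algebra_simps)
        finally show "l * (real m * x) + (\<Sum>i<m. l * s * expectation (Y i)) \<le> (\<Sum>i<m. l * s * Y i \<omega>)" by simp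
      qed
    qed measurable
    with * show ?thesis by linarith
  qed
  let ?E = "\<lambda>s. {\<omega>\<in>space M. real m * x \<le> (\<Sum>i<m. s * (Y i \<omega> - expectation (Y i)))}"
  have eq: "{\<omega>\<in>space M. real m * x \<le> \<bar>\<Sum>i<m. Y i \<omega> - expectation (Y i)\<bar>} = ?E 1 \<union> ?E (-1)"
    by (auto simp: abs_real_def sum_negf sum_subtractf)
  have "prob (?E 1 \<union> ?E (-1)) \<le> prob (?E 1) + prob (?E (-1))"
    by (rule measure_Un_le) measurable
  moreover have "prob (?E 1) \<le> exp (- real m * x\<^sup>2 / 8)" "prob (?E (-1)) \<le> exp (- real m * x\<^sup>2 / 8)"
    by (rule one; simp)+
  ultimately show ?thesis unfolding eq by linarith
qed

text \<open>The additive form gives a rate in \<open>x\<close> that is free of \<open>q\<close>.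
  Only the sum of the probabilities is bounded, since the corruptions may have different
  laws.\<close>

lemma count_deviation:
  assumes ind: "indep_vars (\<lambda>_. N) \<Xi> {..<m}" and B: "\<And>i. i < m \<Longrightarrow> B i \<in> sets N"
    and x: "0 \<le> x" "x \<le> 2"
    and p: "(\<Sum>i<m. prob {\<omega>\<in>space M. \<Xi> i \<omega> \<in> B i}) \<le> real m * q"
  shows "prob {\<omega>\<in>space M. real m * (q + x) \<le> real (card {i. i < m \<and> \<Xi> i \<omega> \<in> B i})} \<le> exp (- real m * x\<^sup>2 / 4)"
proof -
  \<comment> \<open>Minimises l^2 - l x, once the total probability in the second-order term is
    bounded by \<open>m\<close>.\<close>
  define l where "l = x / 2"
  have l: "0 \<le> l" "l \<le> 1" using x by (auto simp: l_def)
  have \<Xi>[measurable]: "\<Xi> i \<in> measurable M N" if "i < m" for i using ind that by (auto simp: indep_vars_def)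
  define Y where "Y i z = l * indicat_real (B i) z" for i z
  have ind': "indep_vars (\<lambda>_. borel) (\<lambda>i \<omega>. Y i (\<Xi> i \<omega>)) {..<m}"
    by (rule indep_vars_compose2[OF ind]) (use B in \<open>auto simp: Y_def\<close>)
  have "prob {\<omega>\<in>space M. l * (real m * (q + x)) \<le> (\<Sum>i<m. Y i (\<Xi> i \<omega>))}
      \<le> exp ((\<Sum>i<m. prob {\<omega>\<in>space M. \<Xi> i \<omega> \<in> B i} * (l + l\<^sup>2)) - l * (real m * (q + x)))"
  proof (rule chernoff_bound[OF _ ind'])
    fix i assume "i \<in> {..<m}"
    hence i: "i < m" by simp
    let ?E = "{\<omega>\<in>space M. \<Xi> i \<omega> \<in> B i}"
    have E: "?E \<in> events" using B[OF i] \<Xi>[OF i] by measurable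
    have el: "exp l - 1 \<le> l + l\<^sup>2" using exp_bound[of l] l by simp
    have "(\<integral>\<^sup>+\<omega>. ennreal (exp (Y i (\<Xi> i \<omega>))) \<partial>M) \<le> (\<integral>\<^sup>+\<omega>. 1 + ennreal (l + l\<^sup>2) * indicator ?E \<omega> \<partial>M)"
    proof (rule nn_integral_mono)
      fix \<omega> assume "\<omega> \<in> space M"
      have "ennreal (exp l) \<le> ennreal (1 + (l + l\<^sup>2))" using el by (intro ennreal_leI) simp
      also have "\<dots> = 1 + ennreal (l + l\<^sup>2)" using l by (subst ennreal_plus) auto
      finally show "ennreal (exp (Y i (\<Xi> i \<omega>))) \<le> 1 + ennreal (l + l\<^sup>2) * indicator ?E \<omega>"
        using \<open>\<omega> \<in> space M\<close> by (auto simp: Y_def indicator_def)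
    qed
    also have "\<dots> = 1 + ennreal (l + l\<^sup>2) * emeasure M ?E"
      using E by (subst nn_integral_add) (auto simp: nn_integral_cmult emeasure_space_1)
    also have "\<dots> = ennreal (1 + prob ?E * (l + l\<^sup>2))"
      using l by (simp add: emeasure_eq_measure ennreal_mult'[symmetric] mult.commute flip: ennreal_1 ennreal_plus)
    also have "\<dots> \<le> ennreal (exp (prob ?E * (l + l\<^sup>2)))"
      by (intro ennreal_leI exp_ge_add_one_self)
    finally show "(\<integral>\<^sup>+\<omega>. ennreal (exp (Y i (\<Xi> i \<omega>))) \<partial>M) \<le> ennreal (exp (prob ?E * (l + l\<^sup>2)))" .
  qed auto
  also have "\<dots> \<le> exp (- real m * x\<^sup>2 / 4)"
  proof -
    let ?P = "\<Sum>i<m. prob {\<omega>\<in>space M. \<Xi> i \<omega> \<in> B i}"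
    have "?P \<le> (\<Sum>i<m. 1)" by (intro sum_mono) auto
    hence "?P \<le> real m" by simp
    hence "?P * l\<^sup>2 \<le> real m * l\<^sup>2" by (intro mult_right_mono) auto
    moreover have "?P * l \<le> real m * q * l" using p l by (intro mult_right_mono) auto
    ultimately have "?P * (l + l\<^sup>2) \<le> real m * q * l + real m * l\<^sup>2" by (simp add: distrib_left)
    moreover have "real m * q * l + real m * l\<^sup>2 - l * (real m * (q + x)) = - real m * x\<^sup>2 / 4"
      by (simp add: l_def power2_eq_square field_simps)
    ultimately show ?thesis by (simp add: sum_distrib_right)
  qed
  finally have main: "prob {\<omega>\<in>space M. l * (real m * (q + x)) \<le> (\<Sum>i<m. Y i (\<Xi> i \<omega>))} \<le> exp (- real m * x\<^sup>2 / 4)" .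
  have card: "real (card {i. i < m \<and> \<Xi> i \<omega> \<in> B i}) = (\<Sum>i<m. indicat_real (B i) (\<Xi> i \<omega>))" for \<omega>
    by (simp add: indicator_def sum.If_cases Int_def)
  have "prob {\<omega>\<in>space M. real m * (q + x) \<le> real (card {i. i < m \<and> \<Xi> i \<omega> \<in> B i})}
     \<le> prob {\<omega>\<in>space M. l * (real m * (q + x)) \<le> (\<Sum>i<m. Y i (\<Xi> i \<omega>))}"
  proof (rule finite_measure_mono)
    have "(\<lambda>\<omega>. \<Sum>i<m. Y i (\<Xi> i \<omega>)) \<in> borel_measurable M"
      by (rule borel_measurable_sum) (use ind' in \<open>auto simp: indep_vars_def\<close>)
    thus "{\<omega>\<in>space M. l * (real m * (q + x)) \<le> (\<Sum>i<m. Y i (\<Xi> i \<omega>))} \<in> events" by measurable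
  qed (use l in \<open>auto simp: Y_def card sum_distrib_left[symmetric] intro!: mult_left_mono\<close>)
  with main show ?thesis by linarith
qed

text \<open>At the parameter 1/4 the moment is sqrt 2 < exp(1/2); the threshold
  \<open>4 * real m\<close> then leaves the exponent m/2 - m.\<close>

lemma gaussian_square_sum_tail:
  fixes h :: "nat \<Rightarrow> 'a \<Rightarrow> real"
  assumes ind: "indep_vars (\<lambda>_. borel) h {..<m}" and g: "\<And>i. i < m \<Longrightarrow> std_gaussian (g i)"
    and dom: "\<And>i \<omega>. i < m \<Longrightarrow> \<omega> \<in> space M \<Longrightarrow> \<bar>h i \<omega>\<bar> \<le> \<bar>g i \<omega>\<bar>"
  shows "prob {\<omega>\<in>space M. 4 * real m \<le> (\<Sum>i<m. (h i \<omega>)\<^sup>2)} \<le> exp (- real m / 2)"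
proof -
  have hm[measurable]: "h i \<in> borel_measurable M" if "i \<in> {..<m}" for i using ind that by (auto simp: indep_vars_def)
  have ind': "indep_vars (\<lambda>_. borel) (\<lambda>i \<omega>. (h i \<omega>)\<^sup>2 / 4) {..<m}"
    by (rule indep_vars_compose2[OF ind, where Y = "\<lambda>_ y. y\<^sup>2 / 4"]) auto
  have "prob {\<omega>\<in>space M. real m \<le> (\<Sum>i<m. (h i \<omega>)\<^sup>2 / 4)} \<le> exp ((\<Sum>i<m. 1 / 2) - real m)"
  proof (rule chernoff_bound[OF _ ind'])
    fix i assume "i \<in> {..<m}"
    hence i: "i < m" by simp
    have "(\<integral>\<^sup>+\<omega>. ennreal (exp ((h i \<omega>)\<^sup>2 / 4)) \<partial>M) \<le> (\<integral>\<^sup>+\<omega>. ennreal (exp ((g i \<omega>)\<^sup>2 / 4)) \<partial>M)"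
      by (intro nn_integral_mono ennreal_leI) (use dom[OF i] in \<open>auto simp: abs_le_square_iff\<close>)
    also have "\<dots> = ennreal (sqrt 2)" by (rule std_gaussian_exp_sq[OF g[OF i]])
    also have "\<dots> \<le> ennreal (1 + 1 / 2)"
      by (intro ennreal_leI real_le_lsqrt) (auto simp: power2_eq_square)
    also have "\<dots> \<le> ennreal (exp (1 / 2))" by (intro ennreal_leI exp_ge_add_one_self)
    finally show "(\<integral>\<^sup>+\<omega>. ennreal (exp ((h i \<omega>)\<^sup>2 / 4)) \<partial>M) \<le> ennreal (exp (1 / 2))" .
  qed auto
  thus ?thesis by (simp add: sum_divide_distrib[symmetric] pos_le_divide_eq mult.commute)
qed

text \<open>Each index costs a factor 2, because both tails of \<open>w i\<close> enter the moment
  of its modulus. This is the entropy that the term 3 p has to pay for.\<close>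

lemma gaussian_abs_sum_tail:
  fixes w :: "'i \<Rightarrow> 'a \<Rightarrow> real"
  assumes T: "finite T" "T \<noteq> {}" and ind: "indep_vars (\<lambda>_. borel) w T"
    and g: "\<And>i. i \<in> T \<Longrightarrow> std_gaussian (w i)" and x: "x \<ge> 0"
  shows "prob {\<omega>\<in>space M. x \<le> (\<Sum>i\<in>T. \<bar>w i \<omega>\<bar>)} \<le> 2 ^ card T * exp (- x\<^sup>2 / (2 * real (card T)))"
proof (cases "x = 0")
  case True
  have "prob {\<omega>\<in>space M. x \<le> (\<Sum>i\<in>T. \<bar>w i \<omega>\<bar>)} \<le> 1" by (rule prob_le_1)
  also have "\<dots> \<le> 2 ^ card T * exp (- x\<^sup>2 / (2 * real (card T)))" using True by simp
  finally show ?thesis .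
next
  case False
  define n where "n = real (card T)"
  have n: "n > 0" using T by (simp add: n_def card_gt_0_iff)
  \<comment> \<open>The optimal parameter in n c^2 / 2 - c x.\<close>
  define c where "c = x / n"
  have c: "c > 0" using False x n by (simp add: c_def)
  have wm[measurable]: "w i \<in> borel_measurable M" if "i \<in> T" for i using ind that by (auto simp: indep_vars_def)
  have ind': "indep_vars (\<lambda>_. borel) (\<lambda>i \<omega>. c * \<bar>w i \<omega>\<bar>) T"
    by (rule indep_vars_compose2[OF ind, where Y = "\<lambda>_ y. c * \<bar>y\<bar>"]) auto
  have "prob {\<omega>\<in>space M. c * x \<le> (\<Sum>i\<in>T. c * \<bar>w i \<omega>\<bar>)} \<le> exp ((\<Sum>i\<in>T. ln 2 + c\<^sup>2 / 2) - c * x)"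
  proof (rule chernoff_bound[OF T(1) ind'])
    fix i assume i: "i \<in> T"
    show "(\<integral>\<^sup>+\<omega>. ennreal (exp (c * \<bar>w i \<omega>\<bar>)) \<partial>M) \<le> ennreal (exp (ln 2 + c\<^sup>2 / 2))"
      using std_gaussian_exp_abs[OF g[OF i], of c] by (simp add: exp_add)
  qed
  also have "(\<Sum>i\<in>T. ln 2 + c\<^sup>2 / 2) - c * x = n * ln 2 + - x\<^sup>2 / (2 * n)"
    using n by (simp add: n_def[symmetric] c_def power2_eq_square field_simps)
  also have "exp (n * ln 2 + - x\<^sup>2 / (2 * n)) = 2 ^ card T * exp (- x\<^sup>2 / (2 * n))"
    unfolding exp_add n_def exp_of_nat_mult by simp
  finally show ?thesis using c by (simp add: sum_distrib_left[symmetric] n_def)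
qed

text \<open>An interval of length \<open>2 * t\<close> against a density of at most 1/2. The centre
  \<open>v\<close> is free, so it may later be a frozen corruption.\<close>

lemma std_gaussian_small_ball:
  assumes g: "std_gaussian g" and t: "t \<ge> 0"
  shows "prob {\<omega>\<in>space M. \<bar>g \<omega> - v\<bar> \<le> t} \<le> t"
proof -
  have "{\<omega>\<in>space M. \<bar>g \<omega> - v\<bar> \<le> t} = g -` {v - t..v + t} \<inter> space M" by auto
  hence "emeasure M {\<omega>\<in>space M. \<bar>g \<omega> - v\<bar> \<le> t} = (\<integral>\<^sup>+x. ennreal (std_normal_density x) * indicator {v - t..v + t} x \<partial>lborel)"
    using distributed_emeasure[OF g, of "{v - t..v + t}"] by simp
  also have "\<dots> \<le> (\<integral>\<^sup>+x. ennreal (1 / 2) * indicator {v - t..v + t} x \<partial>lborel)"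
    by (intro nn_integral_mono mult_right_mono ennreal_leI std_normal_density_le_half) auto
  also have "\<dots> = ennreal (1 / 2) * emeasure lborel {v - t..v + t}" by (rule nn_integral_cmult_indicator) simp
  also have "emeasure lborel {v - t..v + t} = ennreal (2 * t)" using t by simp
  also have "ennreal (1 / 2) * ennreal (2 * t) = ennreal t" using t by (subst ennreal_mult[symmetric]) auto
  finally show ?thesis using t by (simp add: emeasure_eq_measure)
qed

end

section \<open>Linear functionals of a GOE matrix\<close>

lemma sign_pm_measurable [measurable]: "sign_pm \<in> borel_measurable borel"
  unfolding sign_pm_def[abs_def] by measurable

lemma abs_sign_pm [simp]: "\<bar>sign_pm x\<bar> = 1"
  by (simp add: sign_pm_def)

text \<open>The density f satisfies f' = - x f / sigma^2, so the integral of x f over the half-line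
  above \<open>v\<close> is sigma^2 f(v). Up to a null set the sign is twice the indicator of that
  half-line minus 1, and the full first moment vanishes.\<close>

lemma integral_sign_normal_density:
  assumes \<sigma>: "\<sigma> > 0"
  shows "(\<integral>x. normal_density 0 \<sigma> x * (sign_pm (x - v) * x) \<partial>lborel) = 2 * \<sigma>\<^sup>2 * normal_density 0 \<sigma> v"
proof -
  define f where "f x = normal_density 0 \<sigma> x * x" for x
  define F where "F x = - \<sigma>\<^sup>2 * normal_density 0 \<sigma> x" for x
  have int: "integrable lborel f" unfolding f_def by (rule integrable_normal_moment_nz_1[OF \<sigma>])
  have int0: "(\<integral>x. f x \<partial>lborel) = 0" unfolding f_def by (rule integral_normal_moment_nz_1[OF \<sigma>])
  have fm[measurable]: "f \<in> borel_measurable borel" unfolding f_def by measurable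
  have ein: "einterval (ereal v) \<infinity> = {v<..}" by (auto simp: einterval_def)
  have lim: "(F \<longlongrightarrow> 0) at_top" unfolding F_def normal_density_def using \<sigma> by real_asymp
  have der: "(F has_real_derivative f x) (at x)" for x
    unfolding F_def f_def normal_density_def
    by (rule derivative_eq_intros refl | use \<sigma> in \<open>simp; fail\<close>)+ (use \<sigma> in \<open>simp add: field_simps power2_eq_square\<close>)
  have cont: "isCont f x" for x
    unfolding f_def normal_density_def by (intro continuous_intros) (use \<sigma> in auto)
  have "(LBINT x=ereal v..\<infinity>. f x) = 0 - F v"
  proof (rule interval_integral_FTC_integrable)
    show "((F \<circ> real_of_ereal) \<longlongrightarrow> F v) (at_right (ereal v))"
      unfolding ereal_tendsto_simps
      by (rule tendsto_mono[OF at_le]) (use DERIV_isCont[OF der[of v]] in \<open>auto simp: isCont_def\<close>)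
    show "((F \<circ> real_of_ereal) \<longlongrightarrow> 0) (at_left \<infinity>)"
      unfolding ereal_tendsto_simps by (rule lim)
    show "set_integrable lborel (einterval (ereal v) \<infinity>) f"
      unfolding ein set_integrable_def using integrable_mult_indicator[OF _ int, of "{v<..}"] by simp
  qed (use der cont in \<open>auto simp: has_real_derivative_iff_has_vector_derivative\<close>)
  hence tail: "(\<integral>x. indicat_real {v<..} x * f x \<partial>lborel) = \<sigma>\<^sup>2 * normal_density 0 \<sigma> v"
    by (simp add: interval_lebesgue_integral_def ein set_lebesgue_integral_def F_def)
  have "(\<integral>x. normal_density 0 \<sigma> x * (sign_pm (x - v) * x) \<partial>lborel) = (\<integral>x. 2 * (indicat_real {v<..} x * f x) - f x \<partial>lborel)"
  proof (rule integral_cong_AE)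
    show "AE x in lborel. normal_density 0 \<sigma> x * (sign_pm (x - v) * x) = 2 * (indicat_real {v<..} x * f x) - f x"
      using AE_lborel_singleton[of v]
      by eventually_elim (auto simp: sign_pm_def f_def indicator_def)
  qed measurable
  also have "\<dots> = 2 * (\<sigma>\<^sup>2 * normal_density 0 \<sigma> v) - 0"
    using integrable_mult_indicator[OF _ int, of "{v<..}"] int
    by (subst Bochner_Integration.integral_diff) (simp_all add: tail int0)
  finally show ?thesis by simp
qed

lemma integral_sign_affine_normal_density:
  assumes \<sigma>: "\<sigma> > 0" and c: "c \<noteq> 0"
  shows "(\<integral>x. normal_density 0 \<sigma> x * (sign_pm (c * x - w) * x) \<partial>lborel) = 2 * c * \<sigma>\<^sup>2 * normal_density 0 (\<bar>c\<bar> * \<sigma>) w"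
proof -
  have scale: "normal_density 0 \<sigma> (w / c) = \<bar>c\<bar> * normal_density 0 (\<bar>c\<bar> * \<sigma>) w"
    using c \<sigma> by (simp add: normal_density_def real_sqrt_mult power_mult_distrib power_divide mult_ac)
  have "(\<integral>x. normal_density 0 \<sigma> x * (sign_pm (c * x - w) * x) \<partial>lborel)
      = (\<integral>x. sgn c * (normal_density 0 \<sigma> x * (sign_pm (x - w / c) * x)) \<partial>lborel)"
  proof (rule integral_cong_AE)
    show "AE x in lborel. normal_density 0 \<sigma> x * (sign_pm (c * x - w) * x) = sgn c * (normal_density 0 \<sigma> x * (sign_pm (x - w / c) * x))"
      using AE_lborel_singleton[of "w / c"]
    proof eventually_elim
      case (elim x)
      have "c * x - w = c * (x - w / c)" using c by (simp add: field_simps)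
      moreover have "sign_pm (c * (x - w / c)) = sgn c * sign_pm (x - w / c)"
        using c elim by (auto simp: sign_pm_def sgn_if mult_less_0_iff)
      ultimately show ?case by simp
    qed
  qed measurable
  also have "\<dots> = sgn c * (2 * \<sigma>\<^sup>2 * (\<bar>c\<bar> * normal_density 0 (\<bar>c\<bar> * \<sigma>) w))"
    by (simp add: integral_sign_normal_density[OF \<sigma>] scale)
  also have "\<dots> = 2 * (sgn c * \<bar>c\<bar>) * \<sigma>\<^sup>2 * normal_density 0 (\<bar>c\<bar> * \<sigma>) w" by (simp add: mult_ac)
  finally show ?thesis by (simp add: sgn_mult_abs)
qed

context prob_space
begin

text \<open>Freezing \<open>R\<close> moves the threshold to \<open>u - R\<close>, and the
  one-dimensional formula gives a normal density of variance (c sigma)^2 at \<open>u - r\<close>.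
  Integrating over \<open>R\<close> is a convolution, in which the variances add up to 1.\<close>

lemma gaussian_sign_mean_indep:
  assumes ind: "indep_var borel g borel R" and g: "distributed M lborel g (normal_density 0 \<sigma>)"
    and R: "distributed M lborel R (normal_density 0 \<rho>)" and pos: "\<sigma> > 0" "\<rho> > 0"
    and one: "(c * \<sigma>)\<^sup>2 + \<rho>\<^sup>2 = 1"
  shows "expectation (\<lambda>\<omega>. sign_pm (c * g \<omega> + R \<omega> - u) * g \<omega>) = c * \<sigma>\<^sup>2 * (2 * std_normal_density u)"
proof -
  have [measurable]: "g \<in> borel_measurable M" "R \<in> borel_measurable M"
    using g R by (auto simp: distributed_def)
  define f where "f x r = sign_pm (c * x + r - u) * x" for x r
  have fm[measurable]: "case_prod f \<in> borel_measurable (borel \<Otimes>\<^sub>M borel)" unfolding f_def by measurable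
  have dg: "distr M borel g = density lborel (normal_density 0 \<sigma>)"
    using g by (simp add: distributed_def cong: distr_cong)
  have dR: "distr M borel R = density lborel (normal_density 0 \<rho>)"
    using R by (simp add: distributed_def cong: distr_cong)
  interpret G: prob_space "distr M borel g" by (rule prob_space_distr) simp
  interpret H: prob_space "distr M borel R" by (rule prob_space_distr) simp
  interpret P: pair_sigma_finite "distr M borel g" "distr M borel R" ..
  have pair: "distr M (borel \<Otimes>\<^sub>M borel) (\<lambda>\<omega>. (g \<omega>, R \<omega>)) = distr M borel g \<Otimes>\<^sub>M distr M borel R"
    using ind unfolding indep_var_distribution_eq by simp
  have intg: "integrable M g"
    using distributed_integrable[OF g, of "\<lambda>x. x"] integrable_normal_moment_nz_1[OF pos(1), of 0] by simp
  have "integrable M (\<lambda>\<omega>. f (g \<omega>) (R \<omega>))"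
    by (rule Bochner_Integration.integrable_bound[OF intg]) (auto simp: f_def abs_mult)
  hence int: "integrable (distr M borel g \<Otimes>\<^sub>M distr M borel R) (case_prod f)"
    unfolding pair[symmetric] by (subst integrable_distr_eq) auto
  have inner: "(\<integral>x. f x r \<partial>distr M borel g) = 2 * c * \<sigma>\<^sup>2 * normal_density 0 (\<bar>c\<bar> * \<sigma>) (u - r)" for r
  proof -
    have "(\<integral>x. f x r \<partial>distr M borel g) = (\<integral>x. normal_density 0 \<sigma> x * f x r \<partial>lborel)"
      unfolding dg by (subst integral_real_density) (auto simp: f_def)
    also have "\<dots> = 2 * c * \<sigma>\<^sup>2 * normal_density 0 (\<bar>c\<bar> * \<sigma>) (u - r)"
    proof (cases "c = 0")
      case True
      have "(\<integral>x. normal_density 0 \<sigma> x * f x r \<partial>lborel) = (\<integral>x. sign_pm (r - u) * (normal_density 0 \<sigma> x * x) \<partial>lborel)"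
        by (simp add: f_def True mult_ac)
      thus ?thesis using integral_normal_moment_nz_1[OF pos(1), of 0] True by simp
    next
      case False
      have "f x r = sign_pm (c * x - (u - r)) * x" for x by (simp add: f_def algebra_simps)
      thus ?thesis using integral_sign_affine_normal_density[OF pos(1) False] by simp
    qed
    finally show ?thesis .
  qed
  have conv: "c * (\<integral>r. normal_density 0 \<rho> r * normal_density 0 (\<bar>c\<bar> * \<sigma>) (u - r) \<partial>lborel) = c * std_normal_density u"
  proof (cases "c = 0")
    case False
    hence "(\<integral>\<^sup>+r. ennreal (normal_density 0 (\<bar>c\<bar> * \<sigma>) (u - r) * normal_density 0 \<rho> r) \<partial>lborel) = ennreal (std_normal_density u)"
      using fun_cong[OF conv_normal_density_zero_mean[of "\<bar>c\<bar> * \<sigma>" \<rho>], of u] pos one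
      by (simp add: power_mult_distrib)
    hence "(\<integral>r. normal_density 0 (\<bar>c\<bar> * \<sigma>) (u - r) * normal_density 0 \<rho> r \<partial>lborel) = std_normal_density u"
      by (subst integral_eq_nn_integral) auto
    thus ?thesis by (simp add: mult.commute)
  qed simp
  have "expectation (\<lambda>\<omega>. f (g \<omega>) (R \<omega>)) = (\<integral>z. case_prod f z \<partial>(distr M borel g \<Otimes>\<^sub>M distr M borel R))"
    unfolding pair[symmetric] by (subst integral_distr) auto
  also have "\<dots> = (\<integral>r. (\<integral>x. f x r \<partial>distr M borel g) \<partial>distr M borel R)"
    by (rule P.integral_snd[OF int, symmetric])
  also have "\<dots> = (\<integral>r. normal_density 0 \<rho> r * (2 * c * \<sigma>\<^sup>2 * normal_density 0 (\<bar>c\<bar> * \<sigma>) (u - r)) \<partial>lborel)"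
    unfolding inner dR by (subst integral_real_density) auto
  also have "\<dots> = 2 * \<sigma>\<^sup>2 * (c * (\<integral>r. normal_density 0 \<rho> r * normal_density 0 (\<bar>c\<bar> * \<sigma>) (u - r) \<partial>lborel))"
    by (subst Bochner_Integration.integral_mult_right_zero[symmetric])+ (simp add: mult_ac)
  finally show ?thesis unfolding conv by (simp add: f_def mult_ac)
qed

text \<open>Terms with coefficient 0 are removed first, since they have no density while the
  addition theorem for normal variables wants positive variances.\<close>

lemma gaussian_combination_distributed:
  assumes fin: "finite V" and ind: "indep_vars (\<lambda>_. borel) X V"
    and X: "\<And>e. e \<in> V \<Longrightarrow> distributed M lborel (X e) (normal_density 0 (\<sigma> e))"
    and \<sigma>: "\<And>e. e \<in> V \<Longrightarrow> \<sigma> e > 0" and S: "(\<Sum>e\<in>V. (c e * \<sigma> e)\<^sup>2) \<noteq> 0"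
  shows "distributed M lborel (\<lambda>\<omega>. \<Sum>e\<in>V. c e * X e \<omega>) (normal_density 0 (sqrt (\<Sum>e\<in>V. (c e * \<sigma> e)\<^sup>2)))"
proof -
  define W where "W = {e\<in>V. c e \<noteq> 0}"
  have "W \<noteq> {}"
  proof
    assume "W = {}"
    hence "(\<Sum>e\<in>V. (c e * \<sigma> e)\<^sup>2) = (\<Sum>e\<in>V. 0)" by (intro sum.cong) (auto simp: W_def)
    thus False using S by simp
  qed
  hence W: "finite W" "W \<noteq> {}" "W \<subseteq> V" using fin by (auto simp: W_def)
  have ind': "indep_vars (\<lambda>_. borel) (\<lambda>e \<omega>. c e * X e \<omega>) W"
    using indep_vars_subset[OF ind W(3)] by (rule indep_vars_compose2[where Y = "\<lambda>e x. c e * x"]) auto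
  have "distributed M lborel (\<lambda>\<omega>. \<Sum>e\<in>W. c e * X e \<omega>) (normal_density (\<Sum>e\<in>W. 0) (sqrt (\<Sum>e\<in>W. (\<bar>c e\<bar> * \<sigma> e)\<^sup>2)))"
  proof (rule sum_indep_normal[OF W(1,2) ind'])
    fix e assume "e \<in> W"
    hence e: "e \<in> V" "c e \<noteq> 0" by (auto simp: W_def)
    show "0 < \<bar>c e\<bar> * \<sigma> e" using e \<sigma> by simp
    show "distributed M lborel (\<lambda>\<omega>. c e * X e \<omega>) (normal_density 0 (\<bar>c e\<bar> * \<sigma> e))"
      using normal_density_affine[OF X[OF e(1)] \<sigma>[OF e(1)] e(2), of 0] by simp
  qed
  moreover have "(\<Sum>e\<in>W. (\<bar>c e\<bar> * \<sigma> e)\<^sup>2) = (\<Sum>e\<in>V. (c e * \<sigma> e)\<^sup>2)"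
    by (rule sum.mono_neutral_cong_left) (use fin W in \<open>auto simp: W_def power_mult_distrib\<close>)
  moreover have "(\<Sum>e\<in>W. c e * X e \<omega>) = (\<Sum>e\<in>V. c e * X e \<omega>)" for \<omega>
    by (rule sum.mono_neutral_cong_left) (use fin W in \<open>auto simp: W_def\<close>)
  ultimately show ?thesis by simp
qed

text \<open>A Gaussian integration by parts: the covariance of \<open>X e0\<close> with the
  unit-variance sum, times the mean of the derivative of the sign. One coordinate is split off, and
  the remaining sum is the independent noise of \<open>gaussian_sign_mean_indep\<close>.\<close>

lemma gaussian_combination_sign_mean:
  assumes fin: "finite U" and ind: "indep_vars (\<lambda>_. borel) X U"
    and X: "\<And>e. e \<in> U \<Longrightarrow> distributed M lborel (X e) (normal_density 0 (\<sigma> e))"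
    and \<sigma>: "\<And>e. e \<in> U \<Longrightarrow> \<sigma> e > 0" and S: "(\<Sum>e\<in>U. (c e * \<sigma> e)\<^sup>2) = 1" and e0: "e0 \<in> U"
  shows "expectation (\<lambda>\<omega>. sign_pm ((\<Sum>e\<in>U. c e * X e \<omega>) - u) * X e0 \<omega>) = c e0 * (\<sigma> e0)\<^sup>2 * (2 * std_normal_density u)"
proof -
  define V where "V = U - {e0}"
  have V: "finite V" "V \<subseteq> U" "e0 \<notin> V" "insert e0 V = U" using fin e0 by (auto simp: V_def)
  define \<rho>2 where "\<rho>2 = (\<Sum>e\<in>V. (c e * \<sigma> e)\<^sup>2)"
  have one: "(c e0 * \<sigma> e0)\<^sup>2 + \<rho>2 = 1"
    using S V(1,3) unfolding V(4)[symmetric] \<rho>2_def by simp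
  have sum: "(\<Sum>e\<in>U. c e * X e \<omega>) = c e0 * X e0 \<omega> + (\<Sum>e\<in>V. c e * X e \<omega>)" for \<omega>
    using V(1,3) unfolding V(4)[symmetric] by simp
  have \<rho>0: "\<rho>2 \<ge> 0" unfolding \<rho>2_def by (intro sum_nonneg) auto
  show ?thesis
  \<comment> \<open>If all other coefficients vanish, the noise has no density and the
    one-dimensional formula applies directly.\<close>
  proof (cases "\<rho>2 = 0")
    case True
    have "c e = 0" if "e \<in> V" for e
    proof -
      have "(c e * \<sigma> e)\<^sup>2 = 0" using True that V(1) unfolding \<rho>2_def by (subst (asm) sum_nonneg_eq_0_iff) auto
      thus ?thesis using \<sigma>[of e] that V(2) by auto
    qed
    hence sum0: "(\<Sum>e\<in>U. c e * X e \<omega>) = c e0 * X e0 \<omega>" for \<omega> by (simp add: sum)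
    have c2: "(\<bar>c e0\<bar> * \<sigma> e0)\<^sup>2 = 1" using one True by (simp add: power_mult_distrib)
    hence c0: "c e0 \<noteq> 0" and c1: "\<bar>c e0\<bar> * \<sigma> e0 = 1"
      using \<sigma>[OF e0] by (auto simp: power2_eq_1_iff intro: mult_nonneg_nonneg)
         (smt (verit) mult_nonneg_nonneg abs_ge_zero)
    have "expectation (\<lambda>\<omega>. sign_pm (c e0 * X e0 \<omega> - u) * X e0 \<omega>) = (\<integral>x. normal_density 0 (\<sigma> e0) x * (sign_pm (c e0 * x - u) * x) \<partial>lborel)"
      by (rule distributed_integral[OF X[OF e0], symmetric]) auto
    also have "\<dots> = 2 * c e0 * (\<sigma> e0)\<^sup>2 * std_normal_density u"
      by (simp add: integral_sign_affine_normal_density[OF \<sigma>[OF e0] c0] c1)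
    finally show ?thesis by (simp add: sum0 mult_ac)
  next
    case False
    have "indep_vars (\<lambda>_. borel) (\<lambda>e \<omega>. (if e = e0 then 1 else c e) * X e \<omega>) (insert e0 V)"
      unfolding V(4) by (rule indep_vars_compose2[OF ind, where Y = "\<lambda>e x. (if e = e0 then 1 else c e) * x"]) auto
    hence "indep_var borel (\<lambda>\<omega>. (if e0 = e0 then 1 else c e0) * X e0 \<omega>) borel (\<lambda>\<omega>. \<Sum>e\<in>V. (if e = e0 then 1 else c e) * X e \<omega>)"
      by (rule indep_vars_sum[OF V(1,3)])
    moreover have "(\<Sum>e\<in>V. (if e = e0 then 1 else c e) * X e \<omega>) = (\<Sum>e\<in>V. c e * X e \<omega>)" for \<omega>
      by (rule sum.cong) (use V(3) in auto)
    ultimately have indR: "indep_var borel (X e0) borel (\<lambda>\<omega>. \<Sum>e\<in>V. c e * X e \<omega>)" by simp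
    have R: "distributed M lborel (\<lambda>\<omega>. \<Sum>e\<in>V. c e * X e \<omega>) (normal_density 0 (sqrt \<rho>2))"
      unfolding \<rho>2_def
      by (rule gaussian_combination_distributed[OF V(1) indep_vars_subset[OF ind V(2)]])
         (use X \<sigma> V False in \<open>auto simp: \<rho>2_def\<close>)
    show ?thesis unfolding sum
      by (rule gaussian_sign_mean_indep[OF indR X[OF e0] R]) (use \<sigma>[OF e0] False \<rho>0 one in auto)
  qed
qed

end

section \<open>Inner products with a GOE matrix\<close>

definition sym_on :: "nat \<Rightarrow> (nat \<times> nat \<Rightarrow> real) \<Rightarrow> bool" where
  "sym_on d X \<longleftrightarrow> (\<forall>a<d. \<forall>b<d. X (a, b) = X (b, a))"

definition ip :: "nat \<Rightarrow> (nat \<times> nat \<Rightarrow> real) \<Rightarrow> (nat \<times> nat \<Rightarrow> real) \<Rightarrow> real" where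
  "ip d w X = (\<Sum>e\<in>Sq d. w e * X e)"

definition upper_tri :: "nat \<Rightarrow> (nat \<times> nat) set" where
  "upper_tri d = {(a, b). a \<le> b \<and> b < d}"

lemma finite_upper_tri [simp]: "finite (upper_tri d)"
  by (rule finite_subset[of _ "{..<d} \<times> {..<d}"]) (auto simp: upper_tri_def)

lemma sum_Sq_upper_tri:
  fixes f :: "nat \<times> nat \<Rightarrow> real"
  assumes "sym_on d f"
  shows "(\<Sum>e\<in>Sq d. f e) = (\<Sum>e\<in>upper_tri d. (if fst e = snd e then 1 else 2) * f e)"
proof -
  define L where "L = {(a, b). b < a \<and> a < d}"
  define D where "D = {(a, b). a < b \<and> b < d}"
  define E where "E = {(a, b). a = b \<and> b < d}"
  have fin: "finite L" "finite D" "finite E"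
    by (rule finite_subset[of _ "{..<d} \<times> {..<d}"]; auto simp: L_def D_def E_def)+
  have S: "Sq d = (E \<union> D) \<union> L" "upper_tri d = E \<union> D"
    by (auto simp: Sq_def upper_tri_def L_def D_def E_def)
  have "(\<Sum>e\<in>L. f e) = (\<Sum>e\<in>D. f e)"
    by (rule sum.reindex_bij_witness[of _ prod.swap prod.swap])
       (use assms in \<open>auto simp: L_def D_def sym_on_def\<close>)
  moreover have "(\<Sum>e\<in>Sq d. f e) = ((\<Sum>e\<in>E. f e) + (\<Sum>e\<in>D. f e)) + (\<Sum>e\<in>L. f e)"
    unfolding S by (subst sum.union_disjoint; (subst sum.union_disjoint)?)
       (use fin in \<open>auto simp: L_def D_def E_def\<close>)
  moreover have "(\<Sum>e\<in>upper_tri d. (if fst e = snd e then 1 else 2) * f e) = (\<Sum>e\<in>E. f e) + (\<Sum>e\<in>D. 2 * f e)"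
    unfolding S by (subst sum.union_disjoint)
       (use fin in \<open>auto simp: D_def E_def intro!: arg_cong2[where f = "(+)"] sum.cong\<close>)
  ultimately show ?thesis by (simp add: sum_distrib_left[symmetric])
qed

lemma symmetric_mat_index:
  assumes "A \<in> carrier_mat d d" "transpose_mat A = A" "a < d" "b < d"
  shows "A $$ (a, b) = A $$ (b, a)"
proof -
  have "A $$ (a, b) = transpose_mat A $$ (a, b)" using assms by simp
  also have "\<dots> = A $$ (b, a)" using assms(1,3,4) by (subst index_transpose_mat) auto
  finally show ?thesis .
qed

context prob_space
begin

lemma GOE_entries_sym:
  assumes "GOE d A" "\<omega> \<in> space M" shows "sym_on d (entries d (A \<omega>))"
  using assms symmetric_mat_index[of "A \<omega>" d] by (auto simp: GOE_def sym_on_def entries_def)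

text \<open>An off-diagonal entry occurs twice and has variance 1/2: it adds (2 X)^2 / 2 to the
  variance, exactly what the two entries of \<open>X\<close> add to the squared norm. The covariance
  of entry \<open>e\<close> with the inner product is likewise \<open>X e\<close> on and off the
  diagonal, and this is why the sign sum points in the direction of \<open>X\<close> itself.\<close>

lemma
  assumes A: "GOE d A" and X: "sym_on d X" and X1: "L2_set X (Sq d) = 1"
  shows GOE_projection: "std_gaussian (\<lambda>\<omega>. ip d (entries d (A \<omega>)) X)"
    and GOE_sign_mean: "\<And>e u. e \<in> Sq d \<Longrightarrow>
      expectation (\<lambda>\<omega>. sign_pm (ip d (entries d (A \<omega>)) X - u) * entries d (A \<omega>) e) = X e * (2 * std_normal_density u)"
proof -
  define c where "c e = (if fst e = snd e then 1 else 2) * X e" for e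
  define \<sigma> where "\<sigma> e = (if fst e = snd e then 1 else sqrt (1 / 2))" for e :: "nat \<times> nat"
  define B where "B e \<omega> = A \<omega> $$ e" for e \<omega>
  have symA: "A \<omega> $$ (a, b) = A \<omega> $$ (b, a)" if "\<omega> \<in> space M" "a < d" "b < d" for \<omega> a b
    using symmetric_mat_index A that unfolding GOE_def by blast
  have ind: "indep_vars (\<lambda>_. borel) B (upper_tri d)"
    using A unfolding GOE_def B_def[abs_def] upper_tri_def by simp
  have dist: "distributed M lborel (B e) (normal_density 0 (\<sigma> e))" if "e \<in> upper_tri d" for e
    using A that unfolding GOE_def B_def[abs_def] \<sigma>_def by (cases e) (auto simp: upper_tri_def)
  have \<sigma>: "\<sigma> e > 0" for e by (simp add: \<sigma>_def)
  have "(\<Sum>e\<in>upper_tri d. (c e * \<sigma> e)\<^sup>2) = (\<Sum>e\<in>upper_tri d. (if fst e = snd e then 1 else 2) * (X e)\<^sup>2)"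
    by (rule sum.cong) (auto simp: c_def \<sigma>_def power_mult_distrib power_divide)
  also have "\<dots> = (\<Sum>e\<in>Sq d. (X e)\<^sup>2)"
    by (rule sum_Sq_upper_tri[symmetric]) (use X in \<open>auto simp: sym_on_def\<close>)
  also have "\<dots> = (L2_set X (Sq d))\<^sup>2" by (simp add: L2_set_sq)
  finally have S: "(\<Sum>e\<in>upper_tri d. (c e * \<sigma> e)\<^sup>2) = 1" by (simp add: X1)
  have ent: "entries d (A \<omega>) e = B e \<omega>" if "e \<in> Sq d" for e \<omega>
    using that by (simp add: entries_def B_def Sq_def)
  have ipB: "ip d (entries d (A \<omega>)) X = (\<Sum>e\<in>upper_tri d. c e * B e \<omega>)" if "\<omega> \<in> space M" for \<omega>
  proof -
    have "ip d (entries d (A \<omega>)) X = (\<Sum>e\<in>Sq d. X e * B e \<omega>)"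
      unfolding ip_def by (rule sum.cong) (simp_all add: ent)
    also have "\<dots> = (\<Sum>e\<in>upper_tri d. (if fst e = snd e then 1 else 2) * (X e * B e \<omega>))"
      by (rule sum_Sq_upper_tri) (use X symA[OF that] in \<open>simp add: sym_on_def B_def\<close>)
    finally show ?thesis by (simp add: c_def mult_ac)
  qed
  have "std_gaussian (\<lambda>\<omega>. \<Sum>e\<in>upper_tri d. c e * B e \<omega>)"
    using gaussian_combination_distributed[OF finite_upper_tri ind dist \<sigma>, of c] S by simp
  thus "std_gaussian (\<lambda>\<omega>. ip d (entries d (A \<omega>)) X)"
    using ipB unfolding distributed_def by (auto cong: measurable_cong distr_cong)
  fix e u assume e: "e \<in> Sq d"
  \<comment> \<open>The independent entries are those on and above the diagonal; an entry below is
    read through its mirror image.\<close>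
  define e' where "e' = (if fst e \<le> snd e then e else prod.swap e)"
  have e': "e' \<in> upper_tri d" using e by (auto simp: e'_def upper_tri_def Sq_def)
  have Xe: "X e' = X e" using X e by (auto simp: e'_def sym_on_def Sq_def)
  have Be: "B e' \<omega> = B e \<omega>" if "\<omega> \<in> space M" for \<omega>
    using symA[OF that] e by (auto simp: e'_def B_def Sq_def)
  have "expectation (\<lambda>\<omega>. sign_pm (ip d (entries d (A \<omega>)) X - u) * entries d (A \<omega>) e)
     = expectation (\<lambda>\<omega>. sign_pm ((\<Sum>e\<in>upper_tri d. c e * B e \<omega>) - u) * B e' \<omega>)"
    by (rule Bochner_Integration.integral_cong) (simp_all add: ipB Be ent[OF e])
  also have "\<dots> = c e' * (\<sigma> e')\<^sup>2 * (2 * std_normal_density u)"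
    by (rule gaussian_combination_sign_mean[OF finite_upper_tri ind dist \<sigma> S e'])
  also have "c e' * (\<sigma> e')\<^sup>2 = X e" by (simp add: c_def \<sigma>_def Xe power_divide)
  finally show "expectation (\<lambda>\<omega>. sign_pm (ip d (entries d (A \<omega>)) X - u) * entries d (A \<omega>) e) = X e * (2 * std_normal_density u)" .
qed

end

section \<open>Sign changes along rays and quadratic forms\<close>

text \<open>The cells are the sets where \<open>F\<close> lies between consecutive multiples of 1/n,
  replaced by the interval from infimum to supremum; continuity puts finite endpoints back into the
  level set. The value 1 of \<open>F\<close> accounts for the extra cell in
  \<open>n + 1\<close>.\<close>

lemma small_interval_cover:
  fixes F :: "real \<Rightarrow> real"
  assumes mono: "\<And>s t. 0 \<le> s \<Longrightarrow> s \<le> t \<Longrightarrow> F s \<le> F t" and cont: "\<And>t. 0 \<le> t \<Longrightarrow> isCont F t"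
    and lim: "(F \<longlongrightarrow> 1) at_top" and F0: "\<And>t. 0 \<le> F t" and n: "n \<ge> 1"
  obtains \<J> :: "(real \<times> real \<times> real set) set"
  where "finite \<J>" "card \<J> \<le> n + 1" "\<And>u. 0 \<le> u \<Longrightarrow> \<exists>(a, b, J)\<in>\<J>. u \<in> J"
    "\<And>a b J. (a, b, J) \<in> \<J> \<Longrightarrow> 0 \<le> a \<and>
       (J = {a..b} \<and> a \<le> b \<and> F b - F a \<le> 1 / real n \<or> J = {a..} \<and> b = a \<and> 1 - F a \<le> 1 / real n)"
proof -
  define C where "C j = {t. 0 \<le> t \<and> real j / real n \<le> F t \<and> F t \<le> (real j + 1) / real n}" for j
  \<comment> \<open>An unbounded level set gives a half-line. As \<open>F\<close> tends to 1, it is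
    already within 1/n of 1 at the left end. The value \<open>b = a\<close> is then a placeholder
    for the missing right end.\<close>
  define J where "J j = (Inf (C j), if bdd_above (C j) then Sup (C j) else Inf (C j),
      if bdd_above (C j) then {Inf (C j)..Sup (C j)} else {Inf (C j)..})" for j
  have F1: "F t \<le> 1" if "0 \<le> t" for t
  proof (rule tendsto_lowerbound[OF lim])
    show "\<forall>\<^sub>F s in at_top. F t \<le> F s"
      using eventually_ge_at_top[of t] by eventually_elim (rule mono[OF that])
  qed simp
  have closed: "closed (C j)" for j
  proof -
    have "C j = {0..} \<inter> F -` {real j / real n..(real j + 1) / real n}" by (auto simp: C_def)
    moreover have "continuous_on {0..} F" using cont by (intro continuous_at_imp_continuous_on) auto
    ultimately show ?thesis by (metis continuous_closed_preimage closed_atLeast closed_real_atLeastAtMost)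
  qed
  have bdd: "bdd_below (C j)" for j by (rule bdd_belowI[of _ 0]) (auto simp: C_def)
  define \<J> where "\<J> = J ` {j. j \<le> n \<and> C j \<noteq> {}}"
  have 1: "finite \<J>" by (auto simp: \<J>_def)
  have "card \<J> \<le> card {j. j \<le> n \<and> C j \<noteq> {}}" unfolding \<J>_def by (rule card_image_le) auto
  also have "\<dots> \<le> card {..n}" by (rule card_mono) auto
  finally have 2: "card \<J> \<le> n + 1" by simp
  have 3: "\<exists>(a, b, J)\<in>\<J>. u \<in> J" if u: "0 \<le> u" for u
  proof -
    define j where "j = nat \<lfloor>real n * F u\<rfloor>"
    have "real n * F u \<le> real n * 1" by (intro mult_left_mono F1 u) auto
    hence jn: "j \<le> n" unfolding j_def by linarith
    have "0 \<le> real n * F u" using F0 by simp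
    hence "real j \<le> real n * F u" "real n * F u \<le> real j + 1" unfolding j_def by linarith+
    hence uC: "u \<in> C j" using u n by (simp add: C_def field_simps)
    hence "Inf (C j) \<le> u" by (rule cInf_lower[OF _ bdd])
    moreover have "bdd_above (C j) \<Longrightarrow> u \<le> Sup (C j)" by (rule cSup_upper[OF uC])
    ultimately have "u \<in> snd (snd (J j))" by (simp add: J_def)
    moreover have "J j \<in> \<J>" using uC jn by (auto simp: \<J>_def)
    ultimately show ?thesis by (intro bexI[of _ "J j"]) (auto simp: case_prod_beta)
  qed
  have 4: "0 \<le> a \<and> (I = {a..b} \<and> a \<le> b \<and> F b - F a \<le> 1 / real n \<or> I = {a..} \<and> b = a \<and> 1 - F a \<le> 1 / real n)"
    if abI: "(a, b, I) \<in> \<J>" for a b I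
  proof -
    obtain j where j: "C j \<noteq> {}" "(a, b, I) = J j" using abI by (auto simp: \<J>_def)
    have aC: "Inf (C j) \<in> C j" by (rule closed_contains_Inf[OF j(1) bdd closed])
    have step: "(real j + 1) / real n = real j / real n + 1 / real n" by (simp add: add_divide_distrib)
    show ?thesis
    proof (cases "bdd_above (C j)")
      case True
      have bC: "Sup (C j) \<in> C j" by (rule closed_contains_Sup[OF j(1) True closed])
      have "Inf (C j) \<le> Sup (C j)" by (rule cSup_upper[OF aC True])
      thus ?thesis using aC bC True j(2) step by (auto simp: J_def C_def)
    next
      case False
      have Fle: "F t \<le> real j / real n + 1 / real n" if t: "t \<ge> 0" for t
      proof -
        obtain t' where "t' \<in> C j" "t \<le> t'" using False unfolding bdd_above_def by (meson linear)
        thus ?thesis using mono[OF t] step by (force simp: C_def)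
      qed
      have "\<forall>\<^sub>F t in at_top. F t \<le> real j / real n + 1 / real n"
        using eventually_ge_at_top[of "0::real"] by eventually_elim (rule Fle)
      hence "1 \<le> real j / real n + 1 / real n" by (rule tendsto_upperbound[OF lim]) simp
      thus ?thesis using aC False j(2) by (auto simp: J_def C_def)
    qed
  qed
  show ?thesis by (rule that[OF 1 2 3 4])
qed

definition cell_shape :: "real \<times> real \<times> real set \<Rightarrow> bool" where
  "cell_shape = (\<lambda>(a, b, J). 0 \<le> a \<and> (J = {a..b} \<and> a \<le> b \<or> J = {a..} \<and> b = a))"

text \<open>The scale \<open>u\<close> at which \<open>g - u s\<close> changes sign; the value \<open>-1\<close> lies outside all cells.\<close>

definition flip_scale :: "real \<times> real \<Rightarrow> real" where
  "flip_scale = (\<lambda>(g, s). if s = 0 then - 1 else g / s)"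

text \<open>The three ways in which the sign on a cell can be unstable: the flip occurs inside, or
  the value at one of the two ends is within \<open>\<tau>\<close> of zero. For a half-line the
  third set repeats the second.\<close>

definition near_flip :: "real \<Rightarrow> real \<times> real \<times> real set \<Rightarrow> (real \<times> real) set" where
  "near_flip \<tau> = (\<lambda>(a, b, J). {z. flip_scale z \<in> J} \<union> {(g, s). \<bar>g - a * s\<bar> \<le> \<tau>} \<union> {(g, s). \<bar>g - b * s\<bar> \<le> \<tau>})"

text \<open>As a function of \<open>u\<close> the difference is affine without a zero in the cell,
  so there its modulus is smallest at the end next to the zero, where it exceeds
  \<open>\<tau>\<close>. Changing \<open>g\<close> by at most \<open>\<tau>\<close> cannot change
  the sign.\<close>

lemma sign_pm_stable:
  assumes c: "cell_shape (a, b, J)" and u: "u \<in> J" and gs: "(g, s) \<notin> near_flip \<tau> (a, b, J)"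
    and g': "\<bar>g' - g\<bar> \<le> \<tau>"
  shows "sign_pm (g' - u * s) = sign_pm (g - a * s)"
proof -
  have far: "\<bar>g - a * s\<bar> > \<tau>" "\<bar>g - b * s\<bar> > \<tau>" and T: "flip_scale (g, s) \<notin> J"
    using gs by (auto simp: near_flip_def)
  have "\<tau> \<ge> 0" using g' by linarith
  have "\<bar>g - u * s\<bar> > \<tau> \<and> (g - u * s < 0 \<longleftrightarrow> g - a * s < 0)"
  proof (cases "s = 0")
    case True thus ?thesis using far by simp
  next
    case False
    define t where "t = g / s"
    have g: "g = t * s" using False by (simp add: t_def)
    have tJ: "t \<notin> J" using T False by (simp add: flip_scale_def t_def)
    have eq: "g - y * s = (t - y) * s" for y by (simp add: g left_diff_distrib)
    have au: "a \<le> u" using c u by (auto simp: cell_shape_def)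
    \<comment> \<open>A zero beyond the right end exists only for a bounded cell. A negative
      \<open>t\<close> falls under the first case because \<open>a\<close> is nonnegative.\<close>
    consider "t < a" | "b < t" "u \<le> b" "a \<le> b" using c u tJ by (auto simp: cell_shape_def)
    thus ?thesis
    proof cases
      case 1
      have "\<bar>t - a\<bar> * \<bar>s\<bar> \<le> \<bar>t - u\<bar> * \<bar>s\<bar>" using 1 au by (intro mult_right_mono) auto
      hence "\<bar>g - u * s\<bar> > \<tau>" using far by (simp add: eq abs_mult)
      moreover have "t - a < 0" "t - u < 0" using 1 au by auto
      ultimately show ?thesis unfolding eq by (simp add: mult_less_0_iff)
    next
      case 2
      have "\<bar>t - b\<bar> * \<bar>s\<bar> \<le> \<bar>t - u\<bar> * \<bar>s\<bar>" using 2 by (intro mult_right_mono) auto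
      hence "\<bar>g - u * s\<bar> > \<tau>" using far by (simp add: eq abs_mult)
      moreover have "t - a > 0" "t - u > 0" using 2 by auto
      ultimately show ?thesis unfolding eq by (auto simp: mult_less_0_iff)
    qed
  qed
  thus ?thesis using g' far \<open>\<tau> \<ge> 0\<close> by (auto simp: sign_pm_def)
qed

section \<open>Quadratic forms of symmetric matrices\<close>

definition outer :: "(nat \<Rightarrow> real) \<Rightarrow> nat \<times> nat \<Rightarrow> real" where
  "outer v = (\<lambda>(a, b). v a * v b)"

lemma abs_ip_le: "\<bar>ip d w X\<bar> \<le> L2_set w (Sq d) * L2_set X (Sq d)"
proof -
  have "\<bar>ip d w X\<bar> \<le> (\<Sum>e\<in>Sq d. \<bar>w e * X e\<bar>)" unfolding ip_def by (rule sum_abs)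
  also have "\<dots> = (\<Sum>e\<in>Sq d. \<bar>w e\<bar> * \<bar>X e\<bar>)" by (simp add: abs_mult)
  also have "\<dots> \<le> L2_set w (Sq d) * L2_set X (Sq d)" by (rule L2_set_mult_ineq)
  finally show ?thesis .
qed

lemma L2_set_outer: "L2_set (outer v) (Sq d) = (L2_set v {..<d})\<^sup>2"
proof -
  have "(\<Sum>e\<in>Sq d. (outer v e)\<^sup>2) = (\<Sum>a<d. (v a)\<^sup>2) * (\<Sum>b<d. (v b)\<^sup>2)"
    by (simp add: Sq_def outer_def sum_product sum.cartesian_product power_mult_distrib case_prod_beta)
  also have "\<dots> = ((L2_set v {..<d})\<^sup>2)\<^sup>2" unfolding L2_set_sq by (simp add: power2_eq_square)
  finally have eq: "(\<Sum>e\<in>Sq d. (outer v e)\<^sup>2) = ((L2_set v {..<d})\<^sup>2)\<^sup>2" .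
  show ?thesis unfolding L2_set_def[of "outer v"] eq by (simp only: real_sqrt_abs abs_power2)
qed

lemma low_rank_outer: "low_rank d 1 (outer v)"
  unfolding low_rank_def outer_def by (intro exI[of _ "\<lambda>_. v"]) auto

lemma sym_on_outer: "sym_on d (outer v)"
  by (simp add: sym_on_def outer_def)

definition unit_vecs :: "nat \<Rightarrow> (nat \<Rightarrow> real) set" where
  "unit_vecs d = {v. L2_set v {..<d} = 1}"

definition bil_form :: "nat \<Rightarrow> (nat \<times> nat \<Rightarrow> real) \<Rightarrow> (nat \<Rightarrow> real) \<Rightarrow> (nat \<Rightarrow> real) \<Rightarrow> real" where
  "bil_form d B x y = (\<Sum>a<d. \<Sum>b<d. B (a, b) * (x a * y b))"

lemma ip_outer: "ip d B (outer x) = bil_form d B x x"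
  by (simp add: ip_def outer_def Sq_def bil_form_def sum.cartesian_product case_prod_beta)

lemma bil_form_sym: "sym_on d B \<Longrightarrow> bil_form d B x y = bil_form d B y x"
  unfolding bil_form_def by (subst sum.swap) (auto simp: sym_on_def mult.commute intro!: sum.cong)

text \<open>Polarisation, 4 B(x, y) = q(x + y) - q(x - y), and the parallelogram law give the bound
  for unit vectors without losing a factor; scaling does the rest.\<close>

lemma symmetric_bil_form_bound:
  assumes sym: "sym_on d B" and \<beta>: "\<And>v. v \<in> unit_vecs d \<Longrightarrow> \<bar>ip d B (outer v)\<bar> \<le> \<beta>"
    and \<beta>0: "\<beta> \<ge> 0"
  shows "\<bar>bil_form d B x y\<bar> \<le> \<beta> * L2_set x {..<d} * L2_set y {..<d}"
proof -
  define n where "n x = L2_set x {..<d}" for x :: "nat \<Rightarrow> real"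
  define bil where "bil = bil_form d B"
  define q where "q x = bil x x" for x
  note bil_sym = bil_form_sym[OF sym, folded bil_def]
  have q_add: "q (\<lambda>i. x i + y i) = q x + 2 * bil x y + q y" for x y
  proof -
    have "B (a, b) * ((x a + y a) * (x b + y b)) =
        B (a, b) * (x a * x b) + B (a, b) * (x a * y b) + B (a, b) * (y a * x b) + B (a, b) * (y a * y b)" for a b
      by (simp add: algebra_simps)
    hence "q (\<lambda>i. x i + y i) = q x + bil x y + bil y x + q y"
      unfolding q_def bil_def bil_form_def by (simp only: sum.distrib)
    thus ?thesis using bil_sym[of x y] by simp
  qed
  have q_scale: "q (\<lambda>i. c * x i) = c\<^sup>2 * q x" and bil_scale: "bil (\<lambda>i. c * x i) y = c * bil x y" for c x y
    by (simp_all add: q_def bil_def bil_form_def sum_distrib_left power2_eq_square mult_ac)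
  have n_scale: "n (\<lambda>i. c * x i) = \<bar>c\<bar> * n x" for c x
    by (simp add: n_def L2_set_def power_mult_distrib sum_distrib_left[symmetric] real_sqrt_mult)
  have n0: "n x \<ge> 0" for x by (simp add: n_def L2_set_nonneg)
  have zero: "x i = 0" if "n x = 0" "i < d" for x i
    using that by (simp add: n_def L2_set_eq_0_iff)
  have qle: "\<bar>q x\<bar> \<le> \<beta> * (n x)\<^sup>2" for x
  proof (cases "n x = 0")
    case True
    thus ?thesis using zero[of x] by (simp add: q_def bil_def bil_form_def)
  next
    case False
    have "(\<lambda>i. 1 / n x * x i) \<in> unit_vecs d"
      using n_scale[of "1 / n x" x] n0[of x] False by (simp add: unit_vecs_def n_def[symmetric])
    from \<beta>[OF this] have "\<bar>q x\<bar> / (n x)\<^sup>2 \<le> \<beta>" unfolding ip_outer bil_def[symmetric] q_def[symmetric] q_scale by (simp add: power_divide)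
    thus ?thesis using False by (simp add: divide_le_eq)
  qed
  have bil1: "\<bar>bil x y\<bar> \<le> \<beta>" if "n x = 1" "n y = 1" for x y
  proof -
    have "bil x (\<lambda>i. (- 1) * y i) = - bil x y"
      unfolding bil_sym[of x] bil_scale by simp
    hence "4 * bil x y = q (\<lambda>i. x i + y i) - q (\<lambda>i. x i + (- 1) * y i)"
      unfolding q_add q_scale by simp
    also have "\<bar>\<dots>\<bar> \<le> \<beta> * (n (\<lambda>i. x i + y i))\<^sup>2 + \<beta> * (n (\<lambda>i. x i + (- 1) * y i))\<^sup>2"
      by (intro order_trans[OF abs_triangle_ineq4] add_mono qle)
    also have "\<dots> = \<beta> * ((n (\<lambda>i. x i + y i))\<^sup>2 + (n (\<lambda>i. x i + (- 1) * y i))\<^sup>2)" by (simp add: distrib_left)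
    also have "(n (\<lambda>i. x i + y i))\<^sup>2 + (n (\<lambda>i. x i + (- 1) * y i))\<^sup>2 = 2 * (n x)\<^sup>2 + 2 * (n y)\<^sup>2"
    proof -
      have "(x i + y i)\<^sup>2 + (x i + (- 1) * y i)\<^sup>2 = 2 * (x i)\<^sup>2 + 2 * (y i)\<^sup>2" for i
        by (simp add: power2_eq_square algebra_simps)
      thus ?thesis unfolding n_def L2_set_sq sum_distrib_left by (simp only: sum.distrib[symmetric])
    qed
    finally show ?thesis using that by (simp add: abs_mult)
  qed
  have "\<bar>bil x y\<bar> \<le> \<beta> * n x * n y"
  proof (cases "n x = 0 \<or> n y = 0")
    case True
    hence "bil x y = 0" using zero[of x] zero[of y] by (auto simp: bil_def bil_form_def)
    thus ?thesis using \<beta>0 n0 by simp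
  next
    case False
    have "\<bar>bil (\<lambda>i. 1 / n x * x i) (\<lambda>i. 1 / n y * y i)\<bar> \<le> \<beta>"
      by (rule bil1) (use False n0[of x] n0[of y] in \<open>simp_all only: n_scale, simp_all\<close>)
    moreover have "bil (\<lambda>i. 1 / n x * x i) (\<lambda>i. 1 / n y * y i) = bil x y / (n x * n y)"
      unfolding bil_scale[of "1 / n x"] bil_sym[of x] bil_scale by (simp add: bil_sym[of y x])
    ultimately have "\<bar>bil x y\<bar> / (n x * n y) \<le> \<beta>" using n0 by (simp add: abs_mult)
    moreover have "n x * n y > 0" using False n0[of x] n0[of y] by (simp add: less_le)
    ultimately show ?thesis by (simp add: divide_le_eq mult_ac)
  qed
  thus ?thesis by (simp add: bil_def n_def)
qed

text \<open>The increment of the form is B(x - v0, x + v0), at most (1/20) 2 beta by the bilinear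
  bound. So the supremum satisfies beta <= b + beta / 10, and it is finite because the Frobenius
  norm bounds it.\<close>

lemma quadratic_form_net:
  assumes sym: "sym_on d B" and V: "V \<subseteq> unit_vecs d"
    and net: "\<And>v. v \<in> unit_vecs d \<Longrightarrow> \<exists>v0\<in>V. L2_set (\<lambda>i. v i - v0 i) {..<d} \<le> 1 / 20"
    and b: "\<And>v0. v0 \<in> V \<Longrightarrow> \<bar>ip d B (outer v0)\<bar> \<le> b" and v: "v \<in> unit_vecs d"
  shows "\<bar>ip d B (outer v)\<bar> \<le> b / (9 / 10)"
proof -
  define q where "q x = bil_form d B x x" for x
  define \<beta> where "\<beta> = (SUP v\<in>unit_vecs d. \<bar>ip d B (outer v)\<bar>)"
  have "\<bar>ip d B (outer x)\<bar> \<le> L2_set B (Sq d)" if "x \<in> unit_vecs d" for x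
    using abs_ip_le[of d B "outer x"] that by (simp add: L2_set_outer unit_vecs_def)
  hence bdd: "bdd_above ((\<lambda>v. \<bar>ip d B (outer v)\<bar>) ` unit_vecs d)" by (auto simp: bdd_above_def)
  have \<beta>: "\<bar>ip d B (outer x)\<bar> \<le> \<beta>" if "x \<in> unit_vecs d" for x
    unfolding \<beta>_def by (rule cSUP_upper[OF that bdd])
  have \<beta>0: "\<beta> \<ge> 0" using \<beta>[OF v] by linarith
  have step: "\<bar>ip d B (outer x)\<bar> \<le> b + \<beta> / 10" if x: "x \<in> unit_vecs d" for x
  proof -
    obtain v0 where v0: "v0 \<in> V" "L2_set (\<lambda>i. x i - v0 i) {..<d} \<le> 1 / 20" using net[OF x] by auto
    have nn: "L2_set x {..<d} = 1" "L2_set v0 {..<d} = 1" using x v0(1) V by (auto simp: unit_vecs_def)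
    have "B (a, b) * ((x a - v0 a) * (x b + v0 b)) =
      B (a, b) * (x a * x b) - B (a, b) * (v0 a * v0 b) + (B (a, b) * (x a * v0 b) - B (a, b) * (v0 a * x b))" for a b
      by (simp add: algebra_simps)
    hence "bil_form d B (\<lambda>i. x i - v0 i) (\<lambda>i. x i + v0 i) = q x - q v0 + (bil_form d B x v0 - bil_form d B v0 x)"
      unfolding q_def bil_form_def by (simp only: sum.distrib sum_subtractf)
    hence "q x = q v0 + bil_form d B (\<lambda>i. x i - v0 i) (\<lambda>i. x i + v0 i)" using bil_form_sym[OF sym, of x v0] by simp
    moreover have "\<bar>q v0\<bar> \<le> b" using b[OF v0(1)] unfolding ip_outer q_def .
    moreover have "\<bar>bil_form d B (\<lambda>i. x i - v0 i) (\<lambda>i. x i + v0 i)\<bar> \<le> \<beta> * (1 / 20) * 2"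
    proof -
      have "L2_set (\<lambda>i. x i + v0 i) {..<d} \<le> 2" using L2_set_triangle_ineq[of x v0 "{..<d}"] nn by simp
      hence "\<beta> * L2_set (\<lambda>i. x i - v0 i) {..<d} * L2_set (\<lambda>i. x i + v0 i) {..<d} \<le> \<beta> * (1 / 20) * 2"
        by (intro mult_mono v0(2)) (use \<beta>0 in \<open>auto simp: L2_set_nonneg\<close>)
      with symmetric_bil_form_bound[OF sym \<beta> \<beta>0, of "\<lambda>i. x i - v0 i" "\<lambda>i. x i + v0 i"]
      show ?thesis by linarith
    qed
    ultimately show ?thesis unfolding ip_outer q_def by linarith
  qed
  have "\<beta> \<le> b + \<beta> / 10" unfolding \<beta>_def by (rule cSUP_least) (use v step in \<open>auto simp: \<beta>_def\<close>)
  hence "\<beta> \<le> b / (9 / 10)" by simp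
  thus ?thesis using \<beta>[OF v] by linarith
qed

section \<open>Deterministic stability of the sign sums\<close>

lemma ip_smult: "ip d w (\<lambda>e. c * X e) = c * ip d w X"
  by (simp add: ip_def sum_distrib_left mult_ac)

lemma ip_diff: "ip d w (\<lambda>e. X e - Y e) = ip d w X - ip d w Y"
  by (simp add: ip_def right_diff_distrib sum_subtractf)

lemma L2_set_smult: "L2_set (\<lambda>e. c * X e) A = \<bar>c\<bar> * L2_set X A"
  by (simp add: L2_set_def power_mult_distrib sum_distrib_left[symmetric] real_sqrt_mult)

text \<open>Since net errors are themselves sums of matrices of the same rank bound, the supremum over
  the unit ball bounds itself with a factor \<open>1/2\<close>.\<close>

lemma restricted_isometry_of_net:
  assumes net: "\<And>X. low_rank d n X \<Longrightarrow> L2_set X (Sq d) \<le> 1 \<Longrightarrow>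
      \<exists>X0\<in>N. \<exists>Y. (\<forall>j<4. low_rank d n (Y j) \<and> L2_set (Y j) (Sq d) \<le> 1 / 8) \<and>
        (\<forall>e\<in>Sq d. X e = X0 e + (\<Sum>j<4::nat. Y j e))"
    and N: "\<And>X0. X0 \<in> N \<Longrightarrow> (\<Sum>i<m. (ip d (w i) X0)\<^sup>2) \<le> 4 * real m"
    and Y: "low_rank d n Y"
  shows "(\<Sum>i<m. (ip d (w i) Y)\<^sup>2) \<le> 16 * real m * (L2_set Y (Sq d))\<^sup>2"
proof -
  define q where "q X = L2_set (\<lambda>i. ip d (w i) X) {..<m}" for X
  define K where "K = {X. low_rank d n X \<and> L2_set X (Sq d) \<le> 1}"
  have q_scale: "q (\<lambda>e. c * X e) = \<bar>c\<bar> * q X" for c X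
    unfolding q_def ip_smult by (rule L2_set_smult)
  have q0: "q X \<ge> 0" for X unfolding q_def by (rule L2_set_nonneg)
  have "q X \<le> (\<Sum>i<m. L2_set (w i) (Sq d))" if "X \<in> K" for X
  proof -
    have "q X \<le> (\<Sum>i<m. \<bar>ip d (w i) X\<bar>)" unfolding q_def by (rule L2_set_le_sum_abs)
    also have "\<dots> \<le> (\<Sum>i<m. L2_set (w i) (Sq d) * 1)"
      by (intro sum_mono order_trans[OF abs_ip_le] mult_left_mono) (use that in \<open>auto simp: K_def L2_set_nonneg\<close>)
    finally show ?thesis by simp
  qed
  \<comment> \<open>A crude bound, but the self-improving inequality for the supremum yields
    something only if the supremum is finite.\<close>
  hence bdd: "bdd_above (q ` K)" by (auto simp: bdd_above_def)
  define B where "B = (SUP X\<in>K. q X)"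
  have B: "q X \<le> B" if "X \<in> K" for X unfolding B_def by (rule cSUP_upper[OF that bdd])
  have zK: "(\<lambda>_. 0) \<in> K" unfolding K_def low_rank_def by (auto simp: L2_set_def intro!: exI[of _ "\<lambda>_ _. 0"])
  have step: "q X \<le> 2 * sqrt (real m) + B / 2" if X: "X \<in> K" for X
  proof -
    obtain X0 Y where X0: "X0 \<in> N" and Yj: "\<forall>j<4. low_rank d n (Y j) \<and> L2_set (Y j) (Sq d) \<le> 1 / 8"
      and eq: "\<forall>e\<in>Sq d. X e = X0 e + (\<Sum>j<4::nat. Y j e)"
      using net[of X] X unfolding K_def by blast
    have ip: "ip d (w i) X = ip d (w i) X0 + ip d (w i) (Y 0) + ip d (w i) (Y 1) + ip d (w i) (Y 2) + ip d (w i) (Y 3)" for i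
    proof -
      have "ip d (w i) X = (\<Sum>e\<in>Sq d. w i e * X0 e + w i e * Y 0 e + w i e * Y 1 e + w i e * Y 2 e + w i e * Y 3 e)"
        unfolding ip_def by (rule sum.cong) (use eq in \<open>auto simp: eval_nat_numeral algebra_simps\<close>)
      thus ?thesis by (simp add: ip_def sum.distrib)
    qed
    \<comment> \<open>Scaled by 8 the piece lies in \<open>K\<close> again; four such pieces make up
      the half of \<open>B\<close>.\<close>
    have qY: "q (Y j) \<le> B / 8" if "j < 4" for j
    proof -
      have "L2_set (\<lambda>e. 8 * Y j e) (Sq d) \<le> 1" using Yj[rule_format, OF that] unfolding L2_set_smult by simp
      hence "(\<lambda>e. 8 * Y j e) \<in> K" using Yj that by (simp add: K_def low_rank_smult)
      from B[OF this] show ?thesis by (simp add: q_scale)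
    qed
    define f where "f Z i = ip d (w i) Z" for Z i
    note tri = L2_set_triangle_ineq[where A = "{..<m}"]
    have fX: "f X = (\<lambda>i. f X0 i + f (Y 0) i + f (Y 1) i + f (Y 2) i + f (Y 3) i)"
      by (rule ext) (simp only: f_def ip)
    have "q X \<le> q X0 + q (Y 0) + q (Y 1) + q (Y 2) + q (Y 3)"
      unfolding q_def f_def[symmetric] fX
      using tri[of "\<lambda>i. f X0 i + f (Y 0) i + f (Y 1) i + f (Y 2) i" "f (Y 3)"]
        tri[of "\<lambda>i. f X0 i + f (Y 0) i + f (Y 1) i" "f (Y 2)"]
        tri[of "\<lambda>i. f X0 i + f (Y 0) i" "f (Y 1)"] tri[of "f X0" "f (Y 0)"] by linarith
    hence "q X \<le> q X0 + B / 8 + B / 8 + B / 8 + B / 8"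
      using qY[of 0] qY[of 1] qY[of 2] qY[of 3] by simp
    moreover have "q X0 \<le> 2 * sqrt (real m)"
    proof -
      have "q X0 \<le> sqrt (4 * real m)" unfolding q_def L2_set_def by (intro real_sqrt_le_mono N X0)
      thus ?thesis by (simp add: real_sqrt_mult)
    qed
    ultimately show ?thesis by linarith
  qed
  have "B \<le> 2 * sqrt (real m) + B / 2" unfolding B_def[symmetric]
    using zK step by (subst (1) B_def) (rule cSUP_least, auto)
  hence B4: "B \<le> 4 * sqrt (real m)" by linarith
  have "q Y \<le> 4 * sqrt (real m) * L2_set Y (Sq d)"
  proof (cases "L2_set Y (Sq d) = 0")
    case True
    hence "ip d (w i) Y = 0" for i by (simp add: L2_set_eq_0_iff ip_def)
    hence "q Y = 0" by (simp add: q_def L2_set_def)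
    thus ?thesis using True by simp
  next
    case False
    define n where "n = L2_set Y (Sq d)"
    have n: "n > 0" using False L2_set_nonneg[of Y "Sq d"] by (simp add: n_def less_le)
    have "(\<lambda>e. 1 / n * Y e) \<in> K" using low_rank_smult[OF Y, of "1 / n"] n
      by (simp add: K_def L2_set_smult[of "1 / n" Y, simplified] n_def[symmetric])
    from B[OF this] B4 have "q Y / n \<le> 4 * sqrt (real m)" using n unfolding q_scale by simp
    thus ?thesis using n by (simp add: n_def[symmetric] divide_le_eq)
  qed
  hence "(q Y)\<^sup>2 \<le> (4 * sqrt (real m) * L2_set Y (Sq d))\<^sup>2" by (rule power_mono[OF _ q0])
  thus ?thesis by (simp add: q_def L2_set_sq power_mult_distrib)
qed

definition low_rank_sphere :: "nat \<Rightarrow> nat \<Rightarrow> (nat \<times> nat \<Rightarrow> real) set" where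
  "low_rank_sphere d k = {X. sym_on d X \<and> low_rank d k X \<and> L2_set X (Sq d) = 1}"

text \<open>Passing from (X, u) to (X0, a) changes few signs; this is bounded for every
  \<open>v\<close> at once by the isometry bound and gives the terms with \<open>\<alpha>\<close>.
  With the signs frozen the remaining matrix no longer depends on \<open>v\<close>, so a net of
  vectors suffices and gives \<open>x / (9 / 10)\<close>. Moving the centre costs
  \<open>y + \<epsilon>\<close>.\<close>

lemma sign_sum_uniform_bound:
  fixes w :: "nat \<Rightarrow> nat \<times> nat \<Rightarrow> real" and s :: "nat \<Rightarrow> real" and \<Psi> :: "real \<Rightarrow> real"
  assumes k: "k \<ge> 1" and wsym: "\<And>i. i < m \<Longrightarrow> sym_on d (w i)"
    and rip: "\<And>Y. low_rank d (2 * k) Y \<Longrightarrow> (\<Sum>i<m. (ip d (w i) Y)\<^sup>2) \<le> 16 * real m * (L2_set Y (Sq d))\<^sup>2"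
    and N: "N \<subseteq> low_rank_sphere d k"
    and netN: "\<And>X. X \<in> low_rank_sphere d k \<Longrightarrow> \<exists>X0\<in>N. L2_set (\<lambda>e. X e - X0 e) (Sq d) \<le> \<epsilon>"
    and V: "V \<subseteq> unit_vecs d"
    and netV: "\<And>v. v \<in> unit_vecs d \<Longrightarrow> \<exists>v0\<in>V. L2_set (\<lambda>i. v i - v0 i) {..<d} \<le> 1 / 20"
    and shape: "\<And>c. c \<in> \<J> \<Longrightarrow> cell_shape c" and cover: "\<And>u. 0 \<le> u \<Longrightarrow> \<exists>(a, b, J)\<in>\<J>. u \<in> J"
    and cnt: "\<And>X0 c. X0 \<in> N \<Longrightarrow> c \<in> \<J> \<Longrightarrow> real (card {i. i < m \<and> (ip d (w i) X0, s i) \<in> near_flip \<tau> c}) \<le> real m * \<kappa>"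
    and dev: "\<And>X0 a b J v. X0 \<in> N \<Longrightarrow> (a, b, J) \<in> \<J> \<Longrightarrow> v \<in> V \<Longrightarrow>
      \<bar>(\<Sum>i<m. sign_pm (ip d (w i) X0 - a * s i) * ip d (w i) (outer v)) - real m * \<Psi> a * ip d X0 (outer v)\<bar> \<le> real m * x"
    and \<Psi>: "\<And>a b J u. (a, b, J) \<in> \<J> \<Longrightarrow> u \<in> J \<Longrightarrow> \<bar>\<Psi> u - \<Psi> a\<bar> \<le> y" and \<Psi>1: "\<And>u. 0 \<le> u \<Longrightarrow> \<bar>\<Psi> u\<bar> \<le> 1"
    and pos: "\<tau> > 0" "\<alpha> > 0" "\<epsilon> \<ge> 0"
    and X: "X \<in> low_rank_sphere d k" and u: "0 \<le> u" and v: "v \<in> unit_vecs d"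
  shows "\<bar>(\<Sum>i<m. sign_pm (ip d (w i) X - u * s i) * ip d (w i) (outer v)) - real m * \<Psi> u * ip d X (outer v)\<bar>
     \<le> real m * (16 * \<alpha> + (\<kappa> + 16 * \<epsilon>\<^sup>2 / \<tau>\<^sup>2) / \<alpha> + x / (9 / 10) + y + \<epsilon>)"
proof -
  obtain X0 where X0: "X0 \<in> N" and dX: "L2_set (\<lambda>e. X e - X0 e) (Sq d) \<le> \<epsilon>" using netN[OF X] by blast
  obtain a b J where c: "(a, b, J) \<in> \<J>" and uJ: "u \<in> J" using cover[OF u] by auto
  note sh = shape[OF c]
  have X0S: "X0 \<in> low_rank_sphere d k" using X0 N by auto
  define t where "t i = ip d (w i) (outer v)" for i
  define \<sigma> where "\<sigma> i = sign_pm (ip d (w i) X - u * s i)" for i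
  define \<rho> where "\<rho> i = sign_pm (ip d (w i) X0 - a * s i)" for i
  define D where "D i = (if \<sigma> i = \<rho> i then 0 else (1::real))" for i
  have ov: "L2_set (outer v) (Sq d) = 1" using v by (simp add: L2_set_outer unit_vecs_def)

  have "(\<Sum>i<m. D i) \<le> real m * (\<kappa> + 16 * \<epsilon>\<^sup>2 / \<tau>\<^sup>2)"
  proof -
    define C where "C = {i. i < m \<and> (ip d (w i) X0, s i) \<in> near_flip \<tau> (a, b, J)}"
    have lrd: "low_rank d (2 * k) (\<lambda>e. X e - X0 e)"
      using low_rank_add[of d k X k "\<lambda>e. - 1 * X0 e"] low_rank_smult[of d k X0 "- 1"] X X0S
      by (simp add: low_rank_sphere_def mult_2)
    \<comment> \<open>Either the net point is near a flip or the perturbation exceeds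
      \<open>\<tau>\<close>; the second case is counted by a square, as in Chebyshev's
      inequality.\<close>
    have "D i \<le> indicat_real C i + (ip d (w i) (\<lambda>e. X e - X0 e))\<^sup>2 / \<tau>\<^sup>2" if i: "i < m" for i
    proof (cases "i \<in> C \<or> \<bar>ip d (w i) X - ip d (w i) X0\<bar> > \<tau>")
      case True
      thus ?thesis
      proof
        assume "i \<in> C" thus ?thesis by (simp add: D_def)
      next
        assume "\<bar>ip d (w i) X - ip d (w i) X0\<bar> > \<tau>"
        hence "\<tau>\<^sup>2 \<le> (ip d (w i) (\<lambda>e. X e - X0 e))\<^sup>2"
          unfolding ip_diff using pos by (intro abs_le_square_iff[THEN iffD1]) auto
        hence "1 \<le> (ip d (w i) (\<lambda>e. X e - X0 e))\<^sup>2 / \<tau>\<^sup>2" using pos by simp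
        thus ?thesis by (simp add: D_def indicator_def)
      qed
    next
      case False
      hence "\<sigma> i = \<rho> i" unfolding \<sigma>_def \<rho>_def
        by (intro sign_pm_stable[OF sh uJ]) (use i in \<open>auto simp: C_def\<close>)
      thus ?thesis by (simp add: D_def)
    qed
    hence "(\<Sum>i<m. D i) \<le> (\<Sum>i<m. indicat_real C i + (ip d (w i) (\<lambda>e. X e - X0 e))\<^sup>2 / \<tau>\<^sup>2)"
      by (intro sum_mono) auto
    also have "\<dots> = real (card C) + (\<Sum>i<m. (ip d (w i) (\<lambda>e. X e - X0 e))\<^sup>2) / \<tau>\<^sup>2"
    proof -
      have "{..<m} \<inter> {i. i \<in> C} = C" by (auto simp: C_def)
      thus ?thesis by (simp add: sum.distrib sum_divide_distrib indicator_def sum.If_cases)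
    qed
    also have "\<dots> \<le> real m * \<kappa> + (16 * real m * \<epsilon>\<^sup>2) / \<tau>\<^sup>2"
    proof (intro add_mono divide_right_mono)
      show "real (card C) \<le> real m * \<kappa>" unfolding C_def by (rule cnt[OF X0 c])
      have "(L2_set (\<lambda>e. X e - X0 e) (Sq d))\<^sup>2 \<le> \<epsilon>\<^sup>2" by (intro power_mono dX L2_set_nonneg)
      hence "16 * real m * (L2_set (\<lambda>e. X e - X0 e) (Sq d))\<^sup>2 \<le> 16 * real m * \<epsilon>\<^sup>2" by (intro mult_left_mono) auto
      with rip[OF lrd] show "(\<Sum>i<m. (ip d (w i) (\<lambda>e. X e - X0 e))\<^sup>2) \<le> 16 * real m * \<epsilon>\<^sup>2" by linarith
    qed simp
    finally show ?thesis by (simp add: algebra_simps)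
  qed
  note disagree = this

  have "\<bar>\<Sum>i<m. (\<sigma> i - \<rho> i) * t i\<bar> \<le> real m * (16 * \<alpha> + (\<kappa> + 16 * \<epsilon>\<^sup>2 / \<tau>\<^sup>2) / \<alpha>)"
  proof -
    have "\<bar>\<Sum>i<m. (\<sigma> i - \<rho> i) * t i\<bar> \<le> (\<Sum>i<m. \<bar>(\<sigma> i - \<rho> i) * t i\<bar>)" by (rule sum_abs)
    also have "\<dots> \<le> (\<Sum>i<m. \<alpha> * (t i)\<^sup>2 + D i / \<alpha>)"
    proof (rule sum_mono)
      fix i
      \<comment> \<open>The weighted arithmetic-geometric mean inequality in the role of
        Cauchy-Schwarz: no square roots of counts appear, and \<open>\<alpha>\<close> is chosen
        later.\<close>
      have "0 \<le> (\<alpha> * \<bar>t i\<bar> - 1)\<^sup>2 / \<alpha>" using pos by simp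
      also have "\<dots> = \<alpha> * (t i)\<^sup>2 - 2 * \<bar>t i\<bar> + 1 / \<alpha>" using pos by (simp add: power2_eq_square field_simps)
      finally have "2 * \<bar>t i\<bar> \<le> \<alpha> * (t i)\<^sup>2 + 1 / \<alpha>" by simp
      moreover have "0 \<le> \<alpha> * (t i)\<^sup>2" using pos by simp
      moreover have "\<bar>\<sigma> i - \<rho> i\<bar> = 2 * D i" by (auto simp: \<sigma>_def \<rho>_def D_def sign_pm_def)
      ultimately show "\<bar>(\<sigma> i - \<rho> i) * t i\<bar> \<le> \<alpha> * (t i)\<^sup>2 + D i / \<alpha>"
        by (auto simp: abs_mult D_def)
    qed
    also have "\<dots> = \<alpha> * (\<Sum>i<m. (t i)\<^sup>2) + (\<Sum>i<m. D i) / \<alpha>"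
      by (simp add: sum.distrib sum_distrib_left sum_divide_distrib)
    also have "\<dots> \<le> \<alpha> * (16 * real m) + (real m * (\<kappa> + 16 * \<epsilon>\<^sup>2 / \<tau>\<^sup>2)) / \<alpha>"
    proof (intro add_mono mult_left_mono divide_right_mono disagree)
      have "low_rank d (2 * k) (outer v)" by (rule low_rank_mono[OF low_rank_outer]) (use k in simp)
      from rip[OF this] show "(\<Sum>i<m. (t i)\<^sup>2) \<le> 16 * real m" by (simp add: t_def ov)
    qed (use pos in auto)
    finally show ?thesis by (simp add: algebra_simps)
  qed
  moreover have "\<bar>(\<Sum>i<m. \<rho> i * t i) - real m * \<Psi> a * ip d X0 (outer v)\<bar> \<le> real m * (x / (9 / 10))"
  proof -
    define B where "B e = (\<Sum>i<m. \<rho> i * w i e) - real m * \<Psi> a * X0 e" for e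
    have ipB: "ip d B (outer z) = (\<Sum>i<m. \<rho> i * ip d (w i) (outer z)) - real m * \<Psi> a * ip d X0 (outer z)" for z
    proof -
      have "ip d B (outer z) = (\<Sum>e\<in>Sq d. (\<Sum>i<m. \<rho> i * (w i e * outer z e)) - real m * \<Psi> a * (X0 e * outer z e))"
        unfolding ip_def B_def by (simp add: left_diff_distrib sum_distrib_right mult.assoc)
      also have "\<dots> = (\<Sum>i<m. \<Sum>e\<in>Sq d. \<rho> i * (w i e * outer z e)) - (\<Sum>e\<in>Sq d. real m * \<Psi> a * (X0 e * outer z e))"
        unfolding sum_subtractf by (subst sum.swap) simp
      finally show ?thesis unfolding ip_def sum_distrib_left .
    qed
    have "sym_on d B" unfolding sym_on_def B_def
    proof (intro allI impI)
      fix p r assume pr: "p < d" "r < d"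
      have "X0 (p, r) = X0 (r, p)" using X0S pr by (simp add: low_rank_sphere_def sym_on_def)
      moreover have "(\<Sum>i<m. \<rho> i * w i (p, r)) = (\<Sum>i<m. \<rho> i * w i (r, p))"
        by (rule sum.cong) (use wsym pr in \<open>auto simp: sym_on_def\<close>)
      ultimately show "(\<Sum>i<m. \<rho> i * w i (p, r)) - real m * \<Psi> a * X0 (p, r) = (\<Sum>i<m. \<rho> i * w i (r, p)) - real m * \<Psi> a * X0 (r, p)"
        by simp
    qed
    from quadratic_form_net[OF this V netV _ v, of "real m * x"]
    show ?thesis unfolding ipB using dev[OF X0 c] by (simp add: \<rho>_def t_def)
  qed
  moreover have "\<bar>real m * \<Psi> a * ip d X0 (outer v) - real m * \<Psi> u * ip d X (outer v)\<bar> \<le> real m * (y + \<epsilon>)"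
  proof -
    have a0: "0 \<le> a" using sh by (simp add: cell_shape_def)
    have "\<bar>ip d X0 (outer v)\<bar> \<le> 1"
      using abs_ip_le[of d X0 "outer v"] X0S by (simp add: ov low_rank_sphere_def)
    hence "\<bar>(\<Psi> a - \<Psi> u) * ip d X0 (outer v)\<bar> \<le> y * 1"
      unfolding abs_mult by (intro mult_mono) (use \<Psi>[OF c uJ] in \<open>auto simp: abs_minus_commute\<close>)
    moreover have "\<bar>\<Psi> u * (ip d X0 (outer v) - ip d X (outer v))\<bar> \<le> 1 * \<epsilon>"
    proof -
      have "ip d X (outer v) - ip d X0 (outer v) = ip d (\<lambda>e. X e - X0 e) (outer v)"
        by (simp add: ip_def left_diff_distrib sum_subtractf)
      hence "\<bar>ip d X0 (outer v) - ip d X (outer v)\<bar> \<le> \<epsilon>"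
        using abs_ip_le[of d "\<lambda>e. X e - X0 e" "outer v"] dX ov by (simp add: abs_minus_commute)
      thus ?thesis unfolding abs_mult by (intro mult_mono \<Psi>1 u) auto
    qed
    moreover have "real m * \<Psi> a * ip d X0 (outer v) - real m * \<Psi> u * ip d X (outer v) =
       real m * ((\<Psi> a - \<Psi> u) * ip d X0 (outer v) + \<Psi> u * (ip d X0 (outer v) - ip d X (outer v)))"
      by (simp add: algebra_simps)
    ultimately show ?thesis
      by (simp only: abs_mult[of "real m"] abs_of_nat) (rule mult_left_mono, linarith, simp)
  qed
  moreover have "(\<Sum>i<m. \<sigma> i * t i) = (\<Sum>i<m. (\<sigma> i - \<rho> i) * t i) + (\<Sum>i<m. \<rho> i * t i)"
    by (simp add: sum.distrib[symmetric] algebra_simps)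
  ultimately have "\<bar>(\<Sum>i<m. \<sigma> i * t i) - real m * \<Psi> u * ip d X (outer v)\<bar>
    \<le> real m * (16 * \<alpha> + (\<kappa> + 16 * \<epsilon>\<^sup>2 / \<tau>\<^sup>2) / \<alpha>) + real m * (x / (9 / 10)) + real m * (y + \<epsilon>)"
    by linarith
  thus ?thesis by (simp add: \<sigma>_def t_def algebra_simps)
qed

section \<open>A GOE matrix with an independent corruption\<close>

lemma coordinate_measurable [measurable]: "e \<in> Sq d \<Longrightarrow> (\<lambda>w. w e) \<in> borel_measurable (entry_space d)"
  unfolding entry_space_def Sq_def by (rule measurable_component_singleton)

lemma ip_measurable [measurable]: "(\<lambda>w. ip d w X) \<in> borel_measurable (entry_space d)"
  unfolding ip_def by (intro borel_measurable_sum borel_measurable_times coordinate_measurable) auto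

lemma flip_scale_measurable [measurable]: "flip_scale \<in> borel_measurable (borel \<Otimes>\<^sub>M borel)"
  unfolding flip_scale_def case_prod_beta by measurable

lemma near_flip_measurable:
  assumes "cell_shape c" shows "near_flip \<tau> c \<in> sets (borel \<Otimes>\<^sub>M borel)"
proof -
  obtain a b J where c: "c = (a, b, J)" by (cases c)
  have J: "J \<in> sets borel" using assms by (auto simp: c cell_shape_def)
  have "flip_scale -` J \<inter> space (borel \<Otimes>\<^sub>M borel) \<in> sets (borel \<Otimes>\<^sub>M borel)"
    by (rule measurable_sets[OF flip_scale_measurable J])
  moreover have "{z\<in>space (borel \<Otimes>\<^sub>M borel). \<bar>fst z - y * snd z\<bar> \<le> \<tau>} \<in> sets (borel \<Otimes>\<^sub>M borel)" for y :: real
    by measurable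
  moreover have "near_flip \<tau> c = (flip_scale -` J \<inter> space (borel \<Otimes>\<^sub>M borel)) \<union>
      {z\<in>space (borel \<Otimes>\<^sub>M borel). \<bar>fst z - a * snd z\<bar> \<le> \<tau>} \<union> {z\<in>space (borel \<Otimes>\<^sub>M borel). \<bar>fst z - b * snd z\<bar> \<le> \<tau>}"
    by (auto simp: near_flip_def c space_pair_measure)
  ultimately show ?thesis by simp
qed

lemma (in prob_space) distr_pair_of_rectangles:
  assumes X: "X \<in> measurable M S" and Y: "Y \<in> measurable M T"
    and rect: "\<And>U V. U \<in> sets S \<Longrightarrow> V \<in> sets T \<Longrightarrow>
      prob {\<omega>\<in>space M. X \<omega> \<in> U \<and> Y \<omega> \<in> V} = prob {\<omega>\<in>space M. X \<omega> \<in> U} * prob {\<omega>\<in>space M. Y \<omega> \<in> V}"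
  shows "distr M (S \<Otimes>\<^sub>M T) (\<lambda>\<omega>. (X \<omega>, Y \<omega>)) = distr M S X \<Otimes>\<^sub>M distr M T Y"
proof (rule pair_measure_eqI[symmetric])
  interpret S: prob_space "distr M S X" by (rule prob_space_distr[OF X])
  interpret T: prob_space "distr M T Y" by (rule prob_space_distr[OF Y])
  show "sigma_finite_measure (distr M S X)" "sigma_finite_measure (distr M T Y)" by unfold_locales
  fix U V assume "U \<in> sets (distr M S X)" "V \<in> sets (distr M T Y)"
  hence UV: "U \<in> sets S" "V \<in> sets T" by auto
  have XY: "(\<lambda>\<omega>. (X \<omega>, Y \<omega>)) \<in> measurable M (S \<Otimes>\<^sub>M T)" using X Y by measurable
  have "emeasure (distr M (S \<Otimes>\<^sub>M T) (\<lambda>\<omega>. (X \<omega>, Y \<omega>))) (U \<times> V) = emeasure M {\<omega>\<in>space M. X \<omega> \<in> U \<and> Y \<omega> \<in> V}"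
    by (subst emeasure_distr[OF XY]) (use UV in \<open>auto intro!: arg_cong2[where f = emeasure]\<close>)
  also have "\<dots> = ennreal (prob {\<omega>\<in>space M. X \<omega> \<in> U} * prob {\<omega>\<in>space M. Y \<omega> \<in> V})"
    unfolding emeasure_eq_measure rect[OF UV] ..
  also have "\<dots> = emeasure M {\<omega>\<in>space M. X \<omega> \<in> U} * emeasure M {\<omega>\<in>space M. Y \<omega> \<in> V}"
    by (simp add: emeasure_eq_measure ennreal_mult')
  also have "{\<omega>\<in>space M. X \<omega> \<in> U} = X -` U \<inter> space M" by auto
  also have "{\<omega>\<in>space M. Y \<omega> \<in> V} = Y -` V \<inter> space M" by auto
  finally show "emeasure (distr M S X) U * emeasure (distr M T Y) V = emeasure (distr M (S \<Otimes>\<^sub>M T) (\<lambda>\<omega>. (X \<omega>, Y \<omega>))) (U \<times> V)"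
    by (simp add: emeasure_distr X Y UV)
qed (simp cong: sets_pair_measure_cong)

definition sym_sphere :: "nat \<Rightarrow> (nat \<times> nat \<Rightarrow> real) set" where
  "sym_sphere d = {X. sym_on d X \<and> L2_set X (Sq d) = 1}"

lemma sym_sphere_nonempty:
  assumes "d \<ge> 1" shows "\<exists>Y. Y \<in> sym_sphere d"
proof -
  define Y where "Y = (\<lambda>e. if e = (0::nat, 0::nat) then 1 else 0 :: real)"
  have "(\<Sum>e\<in>Sq d. (Y e)\<^sup>2) = (\<Sum>e\<in>{(0, 0)}. (Y e)\<^sup>2)"
    by (rule sum.mono_neutral_right) (use assms in \<open>auto simp: Y_def Sq_def\<close>)
  hence "Y \<in> sym_sphere d" by (auto simp: sym_sphere_def sym_on_def L2_set_def Y_def)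
  thus ?thesis by blast
qed

text \<open>The mean of sign(g - u s) g for a standard Gaussian g independent of \<open>s\<close>;
  it needs no moment of \<open>s\<close>. Its average over the indices at
  \<open>u = 1 / frob_norm X\<close> is the scaling function.\<close>

definition sign_mean :: "'a measure \<Rightarrow> ('a \<Rightarrow> real) \<Rightarrow> real \<Rightarrow> real" where
  "sign_mean M s u = (\<integral>\<omega>. 2 * std_normal_density (u * s \<omega>) \<partial>M)"

text \<open>Independence is stated on rectangles only. Taking \<open>s\<close> constantly 0 gives
  the clean matrices on which the treatment of the arbitrary model is built.\<close>

locale noisy_GOE = prob_space M for M :: "'a measure" +
  fixes d :: nat and A :: "'a \<Rightarrow> real mat" and s :: "'a \<Rightarrow> real"
  assumes GOE: "GOE d A"
    and W_measurable [measurable]: "(\<lambda>\<omega>. entries d (A \<omega>)) \<in> measurable M (entry_space d)"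
    and s_measurable [measurable]: "s \<in> borel_measurable M"
    and indep: "\<And>U V. U \<in> sets (entry_space d) \<Longrightarrow> V \<in> sets borel \<Longrightarrow>
      prob {\<omega>\<in>space M. entries d (A \<omega>) \<in> U \<and> s \<omega> \<in> V} = prob {\<omega>\<in>space M. entries d (A \<omega>) \<in> U} * prob {\<omega>\<in>space M. s \<omega> \<in> V}"
begin

abbreviation "W \<omega> \<equiv> entries d (A \<omega>)"

lemma std: "X \<in> sym_sphere d \<Longrightarrow> std_gaussian (\<lambda>\<omega>. ip d (W \<omega>) X)"
  using GOE_projection[OF GOE] by (simp add: sym_sphere_def)

lemma pair_law: "distr M (borel \<Otimes>\<^sub>M borel) (\<lambda>\<omega>. (ip d (W \<omega>) X, s \<omega>)) = distr M borel (\<lambda>\<omega>. ip d (W \<omega>) X) \<Otimes>\<^sub>M distr M borel s"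
proof (rule distr_pair_of_rectangles)
  fix U V :: "real set" assume UV: "U \<in> sets borel" "V \<in> sets borel"
  let ?U = "(\<lambda>w. ip d w X) -` U \<inter> space (entry_space d)"
  have U: "?U \<in> sets (entry_space d)" by (rule measurable_sets[OF ip_measurable UV(1)])
  have eq: "ip d (W \<omega>) X \<in> U \<longleftrightarrow> W \<omega> \<in> ?U" if "\<omega> \<in> space M" for \<omega>
    using measurable_space[OF W_measurable that] by simp
  have "{\<omega>\<in>space M. ip d (W \<omega>) X \<in> U \<and> s \<omega> \<in> V} = {\<omega>\<in>space M. W \<omega> \<in> ?U \<and> s \<omega> \<in> V}"
    "{\<omega>\<in>space M. ip d (W \<omega>) X \<in> U} = {\<omega>\<in>space M. W \<omega> \<in> ?U}" using eq by blast+
  thus "prob {\<omega>\<in>space M. ip d (W \<omega>) X \<in> U \<and> s \<omega> \<in> V} = prob {\<omega>\<in>space M. ip d (W \<omega>) X \<in> U} * prob {\<omega>\<in>space M. s \<omega> \<in> V}"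
    using indep[OF U UV(2)] by simp
qed measurable

text \<open>All unit matrices give the same joint law, so cells built for one of them serve every
  net point.\<close>

lemma prob_pair_eq:
  assumes X: "X \<in> sym_sphere d" "Y \<in> sym_sphere d" and B: "B \<in> sets (borel \<Otimes>\<^sub>M borel)"
  shows "prob {\<omega>\<in>space M. (ip d (W \<omega>) X, s \<omega>) \<in> B} = prob {\<omega>\<in>space M. (ip d (W \<omega>) Y, s \<omega>) \<in> B}"
proof -
  have law: "distr M borel (\<lambda>\<omega>. ip d (W \<omega>) Z) = density lborel std_normal_density" if "Z \<in> sym_sphere d" for Z
    using std[OF that] by (simp add: distributed_def cong: distr_cong)
  have "prob {\<omega>\<in>space M. (ip d (W \<omega>) Z, s \<omega>) \<in> B} = measure (distr M (borel \<Otimes>\<^sub>M borel) (\<lambda>\<omega>. (ip d (W \<omega>) Z, s \<omega>))) B" for Z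
    by (subst measure_distr) (use B in \<open>auto intro!: arg_cong2[where f = measure]\<close>)
  thus ?thesis by (simp add: pair_law law[OF X(1)] law[OF X(2)])
qed

text \<open>Given the corruption, \<open>u * s\<close> is a fixed centre, so the Gaussian bound is
  uniform in \<open>u\<close> and in the law of \<open>s\<close>.\<close>

lemma small_ball:
  assumes X: "X \<in> sym_sphere d" and t: "t \<ge> 0"
  shows "prob {\<omega>\<in>space M. \<bar>ip d (W \<omega>) X - u * s \<omega>\<bar> \<le> t} \<le> t"
proof -
  let ?G = "distr M borel (\<lambda>\<omega>. ip d (W \<omega>) X)" and ?S = "distr M borel s"
  interpret G: prob_space ?G by (rule prob_space_distr) simp
  interpret S: prob_space ?S by (rule prob_space_distr) simp
  interpret P: pair_sigma_finite ?G ?S ..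
  define Q where "Q = {z\<in>space (borel \<Otimes>\<^sub>M borel). \<bar>fst z - u * snd z\<bar> \<le> t}"
  have Q: "Q \<in> sets (borel \<Otimes>\<^sub>M borel)" unfolding Q_def by measurable
  have "emeasure M {\<omega>\<in>space M. \<bar>ip d (W \<omega>) X - u * s \<omega>\<bar> \<le> t} = emeasure (distr M (borel \<Otimes>\<^sub>M borel) (\<lambda>\<omega>. (ip d (W \<omega>) X, s \<omega>))) Q"
    by (subst emeasure_distr) (use Q in \<open>auto simp: Q_def space_pair_measure intro!: arg_cong2[where f = emeasure]\<close>)
  also have "\<dots> = (\<integral>\<^sup>+y. emeasure ?G ((\<lambda>x. (x, y)) -` Q) \<partial>?S)"
    unfolding pair_law by (rule P.emeasure_pair_measure_alt2) (use Q in \<open>simp cong: sets_pair_measure_cong\<close>)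
  also have "\<dots> \<le> (\<integral>\<^sup>+y. ennreal t \<partial>?S)"
  proof (rule nn_integral_mono)
    fix y
    have "emeasure ?G ((\<lambda>x. (x, y)) -` Q) = emeasure ?G {x. \<bar>x - u * y\<bar> \<le> t}"
      by (simp add: Q_def space_pair_measure)
    also have "\<dots> = emeasure M {\<omega>\<in>space M. \<bar>ip d (W \<omega>) X - u * y\<bar> \<le> t}"
      by (subst emeasure_distr) (auto intro!: arg_cong2[where f = emeasure])
    also have "\<dots> \<le> ennreal t"
      unfolding emeasure_eq_measure by (intro ennreal_leI std_gaussian_small_ball[OF std[OF X] t])
    finally show "emeasure ?G ((\<lambda>x. (x, y)) -` Q) \<le> ennreal t" .
  qed
  also have "\<dots> = ennreal t" using S.emeasure_space_1 by simp
  finally show ?thesis using t by (simp add: emeasure_eq_measure)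
qed

lemma sign_moment_integrable:
  assumes "e \<in> Sq d"
  shows "integrable M (\<lambda>\<omega>. sign_pm (ip d (W \<omega>) X - u * s \<omega>) * W \<omega> e)"
proof -
  have We[measurable]: "(\<lambda>\<omega>. W \<omega> e) \<in> borel_measurable M"
    using measurable_compose[OF W_measurable coordinate_measurable[OF assms]] by simp
  obtain a b where e: "e = (a, b)" "a < d" "b < d" using assms by (auto simp: Sq_def)
  \<comment> \<open>A unit matrix supported on the entry and its mirror image. Off the diagonal its
    inner product with the random matrix is sqrt 2 times the entry, a standard Gaussian dominating
    the entry.\<close>
  define Y where "Y = (\<lambda>e'. if e' = (a, b) \<or> e' = (b, a) then (if a = b then 1 else 1 / sqrt 2) else 0 :: real)"
  have symA: "W \<omega> (b, a) = W \<omega> (a, b)" if "\<omega> \<in> space M" for \<omega>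
    using GOE_entries_sym[OF GOE that] e by (simp add: sym_on_def)
  have ab: "(a, b) \<in> Sq d" "(b, a) \<in> Sq d" using e by (auto simp: Sq_def)
  have sum2: "(\<Sum>e'\<in>Sq d. f e') = (\<Sum>e'\<in>{(a, b), (b, a)}. f e')" if "\<And>e'. e' \<notin> {(a, b), (b, a)} \<Longrightarrow> f e' = 0" for f :: "nat \<times> nat \<Rightarrow> real"
    by (rule sum.mono_neutral_right) (use ab that in auto)
  have "(\<Sum>e'\<in>Sq d. (Y e')\<^sup>2) = 1"
    by (subst sum2) (auto simp: Y_def power_divide)
  hence YS: "Y \<in> sym_sphere d" by (auto simp: sym_sphere_def sym_on_def L2_set_def Y_def)
  have ipY: "ip d (W \<omega>) Y = (if a = b then 1 else sqrt 2) * W \<omega> e" if "\<omega> \<in> space M" for \<omega>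
    unfolding ip_def by (subst sum2) (auto simp: Y_def e symA[OF that] field_simps)
  show ?thesis
  proof (rule dominated_by_gaussian_integrable[OF std[OF YS]])
    fix \<omega> assume w: "\<omega> \<in> space M"
    have "1 * \<bar>W \<omega> e\<bar> \<le> (if a = b then 1 else sqrt 2) * \<bar>W \<omega> e\<bar>" by (intro mult_right_mono) auto
    thus "\<bar>sign_pm (ip d (W \<omega>) X - u * s \<omega>) * W \<omega> e\<bar> \<le> \<bar>ip d (W \<omega>) Y\<bar>"
      unfolding ipY[OF w] by (auto simp: abs_mult)
  qed measurable
qed

lemma sign_moment:
  assumes X: "X \<in> sym_sphere d" and e: "e \<in> Sq d"
  shows "expectation (\<lambda>\<omega>. sign_pm (ip d (W \<omega>) X - u * s \<omega>) * W \<omega> e) = X e * sign_mean M s u"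
proof -
  note [measurable] = coordinate_measurable[OF e]
  let ?G = "distr M (entry_space d) W" and ?S = "distr M borel s"
  define f where "f w y = sign_pm (ip d w X - u * y) * w e" for w y
  have fm[measurable]: "case_prod f \<in> borel_measurable (entry_space d \<Otimes>\<^sub>M borel)" unfolding f_def by measurable
  have law: "distr M (entry_space d \<Otimes>\<^sub>M borel) (\<lambda>\<omega>. (W \<omega>, s \<omega>)) = ?G \<Otimes>\<^sub>M ?S"
    by (rule distr_pair_of_rectangles) (use indep in auto)
  interpret G: prob_space ?G by (rule prob_space_distr) simp
  interpret S: prob_space ?S by (rule prob_space_distr) simp
  interpret P: pair_sigma_finite ?G ?S ..
  have "integrable (?G \<Otimes>\<^sub>M ?S) (case_prod f)"
    unfolding law[symmetric] by (subst integrable_distr_eq) (use sign_moment_integrable[OF e] in \<open>auto simp: f_def\<close>)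
  from P.integral_snd[OF this] have "(\<integral>z. case_prod f z \<partial>(?G \<Otimes>\<^sub>M ?S)) = (\<integral>y. (\<integral>w. f w y \<partial>?G) \<partial>?S)" ..
  moreover have "(\<integral>z. case_prod f z \<partial>(?G \<Otimes>\<^sub>M ?S)) = expectation (\<lambda>\<omega>. f (W \<omega>) (s \<omega>))"
    unfolding law[symmetric] by (subst integral_distr) auto
  moreover have "(\<integral>w. f w y \<partial>?G) = X e * (2 * std_normal_density (u * y))" for y
  proof -
    have "(\<lambda>w. f w y) \<in> borel_measurable (entry_space d)" unfolding f_def by measurable
    hence "(\<integral>w. f w y \<partial>?G) = expectation (\<lambda>\<omega>. f (W \<omega>) y)" by (subst integral_distr) auto
    also have "\<dots> = X e * (2 * std_normal_density (u * y))"
      unfolding f_def by (rule GOE_sign_mean[OF GOE]) (use X e in \<open>auto simp: sym_sphere_def\<close>)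
    finally show ?thesis .
  qed
  moreover have "(\<integral>y. X e * (2 * std_normal_density (u * y)) \<partial>?S) = X e * sign_mean M s u"
    unfolding sign_mean_def by (subst integral_distr) auto
  ultimately show ?thesis by (simp add: f_def)
qed

lemma sign_projection_mean:
  assumes X: "X \<in> sym_sphere d"
  shows "expectation (\<lambda>\<omega>. sign_pm (ip d (W \<omega>) X - u * s \<omega>) * ip d (W \<omega>) Z) = sign_mean M s u * ip d X Z"
proof -
  have "expectation (\<lambda>\<omega>. sign_pm (ip d (W \<omega>) X - u * s \<omega>) * ip d (W \<omega>) Z)
     = expectation (\<lambda>\<omega>. \<Sum>e\<in>Sq d. Z e * (sign_pm (ip d (W \<omega>) X - u * s \<omega>) * W \<omega> e))"
    unfolding ip_def[of d _ Z] sum_distrib_left by (simp add: mult_ac)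
  also have "\<dots> = (\<Sum>e\<in>Sq d. Z e * (X e * sign_mean M s u))"
    by (subst Bochner_Integration.integral_sum) (auto simp: sign_moment[OF X] sign_moment_integrable)
  finally show ?thesis by (simp add: ip_def sum_distrib_left mult_ac)
qed

text \<open>Differentiating in \<open>u\<close> would bring in moments of \<open>s\<close>. Instead
  the mean is read as that of sign(g - u s) g, whose values at \<open>u\<close> and \<open>a\<close>
  differ only on the flip event; 2 |g| <= alpha g^2 + 1/alpha and E g^2 = 1 do the rest.\<close>

lemma sign_mean_variation:
  assumes X: "X \<in> sym_sphere d" and c: "cell_shape (a, b, J)" and u: "u \<in> J" and \<alpha>: "\<alpha> > 0"
  shows "\<bar>sign_mean M s u - sign_mean M s a\<bar> \<le> \<alpha> + prob {\<omega>\<in>space M. (ip d (W \<omega>) X, s \<omega>) \<in> near_flip 0 (a, b, J)} / \<alpha>"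
proof -
  define g where "g \<omega> = ip d (W \<omega>) X" for \<omega>
  define B where "B = {\<omega>\<in>space M. (g \<omega>, s \<omega>) \<in> near_flip 0 (a, b, J)}"
  define Y where "Y u \<omega> = sign_pm (g \<omega> - u * s \<omega>) * g \<omega>" for u \<omega>
  have gm[measurable]: "g \<in> borel_measurable M" unfolding g_def by measurable
  have B[measurable]: "B \<in> events" unfolding B_def
    using near_flip_measurable[OF c] by measurable
  note G = std_gaussian_integrable[OF std[OF X], folded g_def]
  have iB: "integrable M (indicat_real B)" by (rule integrable_const_bound[where B = 1]) (auto simp: indicator_def)
  have "ip d X X = (L2_set X (Sq d))\<^sup>2" unfolding L2_set_sq by (simp add: ip_def power2_eq_square)
  hence "ip d X X = 1" using X by (simp add: sym_sphere_def)
  hence mean: "expectation (Y y) = sign_mean M s y" for y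
    unfolding Y_def g_def using sign_projection_mean[OF X, of y X] by simp
  have Ym: "Y y \<in> borel_measurable M" for y unfolding Y_def by measurable
  have int: "integrable M (Y y)" for y
    by (rule dominated_by_gaussian_integrable[OF std[OF X], folded g_def]) (use Ym in \<open>auto simp: Y_def abs_mult g_def\<close>)
  have "\<bar>sign_mean M s u - sign_mean M s a\<bar> = \<bar>expectation (\<lambda>\<omega>. Y u \<omega> - Y a \<omega>)\<bar>"
    using int by (simp add: mean)
  also have "\<dots> \<le> expectation (\<lambda>\<omega>. \<bar>Y u \<omega> - Y a \<omega>\<bar>)" by (rule integral_abs_bound)
  also have "\<dots> \<le> expectation (\<lambda>\<omega>. \<alpha> * (g \<omega>)\<^sup>2 + indicat_real B \<omega> / \<alpha>)"
  proof (rule integral_mono)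
    show "integrable M (\<lambda>\<omega>. \<bar>Y u \<omega> - Y a \<omega>\<bar>)" using int by auto
    show "integrable M (\<lambda>\<omega>. \<alpha> * (g \<omega>)\<^sup>2 + indicat_real B \<omega> / \<alpha>)"
      using G(2) iB by (intro Bochner_Integration.integrable_add integrable_mult_right integrable_divide)
    fix \<omega> assume w: "\<omega> \<in> space M"
    show "\<bar>Y u \<omega> - Y a \<omega>\<bar> \<le> \<alpha> * (g \<omega>)\<^sup>2 + indicat_real B \<omega> / \<alpha>"
    proof (cases "\<omega> \<in> B")
      case True
      have "0 \<le> (\<alpha> * \<bar>g \<omega>\<bar> - 1)\<^sup>2 / \<alpha>" using \<alpha> by simp
      also have "\<dots> = \<alpha> * (g \<omega>)\<^sup>2 - 2 * \<bar>g \<omega>\<bar> + 1 / \<alpha>" using \<alpha> by (simp add: power2_eq_square field_simps)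
      finally have "2 * \<bar>g \<omega>\<bar> \<le> \<alpha> * (g \<omega>)\<^sup>2 + 1 / \<alpha>" by simp
      moreover have "\<bar>Y u \<omega> - Y a \<omega>\<bar> \<le> \<bar>Y u \<omega>\<bar> + \<bar>Y a \<omega>\<bar>" by (rule abs_triangle_ineq4)
      ultimately show ?thesis using True by (simp add: Y_def abs_mult)
    next
      case False
      hence "sign_pm (g \<omega> - u * s \<omega>) = sign_pm (g \<omega> - a * s \<omega>)"
        using w by (intro sign_pm_stable[OF c u, of _ _ 0]) (auto simp: B_def)
      thus ?thesis using \<alpha> by (simp add: Y_def)
    qed
  qed
  also have "\<dots> = \<alpha> + prob B / \<alpha>" using G(2,3) iB by simp
  finally show ?thesis by (simp add: B_def g_def)
qed

lemma sign_mean_bound: "\<bar>sign_mean M s u\<bar> \<le> 1"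
proof -
  have dens: "2 * std_normal_density x \<le> 1" for x using std_normal_density_le_half[of x] by simp
  have dens1: "std_normal_density x \<le> 1" for x
    using dens[of x] normal_density_nonneg[of 0 1 x] by linarith
  have "\<bar>sign_mean M s u\<bar> \<le> expectation (\<lambda>\<omega>. \<bar>2 * std_normal_density (u * s \<omega>)\<bar>)"
    unfolding sign_mean_def by (rule integral_abs_bound)
  also have "\<dots> \<le> expectation (\<lambda>\<omega>. 1)"
    by (rule integral_mono) (use dens dens1 in \<open>auto intro!: integrable_const_bound[where B = 1] simp: abs_mult\<close>)
  finally show ?thesis by (simp add: prob_space)
qed

text \<open>A nonnegative flip scale \<open>t\<close> means g = t s, which has probability 0 by the
  small ball bound at radius 0. The mass at -1, coming from s = 0, lies outside the half-line, so
  there closed intervals have the mass given by increments of the distribution function.\<close>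

lemma flip_scale_cell:
  assumes X: "X \<in> sym_sphere d" and t: "t \<ge> 0"
  defines "F \<equiv> cdf (distr M borel (\<lambda>\<omega>. flip_scale (ip d (W \<omega>) X, s \<omega>)))"
  shows "isCont F t" "mono F" "(F \<longlongrightarrow> 1) at_top" "F t \<ge> 0"
    "\<And>b. t \<le> b \<Longrightarrow> prob {\<omega>\<in>space M. flip_scale (ip d (W \<omega>) X, s \<omega>) \<in> {t..b}} = F b - F t"
    "prob {\<omega>\<in>space M. flip_scale (ip d (W \<omega>) X, s \<omega>) \<in> {t..}} = 1 - F t"
proof -
  define T where "T \<omega> = flip_scale (ip d (W \<omega>) X, s \<omega>)" for \<omega>
  have Tm[measurable]: "T \<in> borel_measurable M" unfolding T_def by measurable
  define \<nu> where "\<nu> = distr M borel T"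
  have F: "F = cdf \<nu>" unfolding F_def \<nu>_def T_def[abs_def] ..
  interpret N: real_distribution \<nu>
    unfolding \<nu>_def by (intro real_distribution.intro prob_space_distr) (auto simp: real_distribution_axioms_def)
  have P: "measure \<nu> B = prob {\<omega>\<in>space M. T \<omega> \<in> B}" if "B \<in> sets borel" for B
    unfolding \<nu>_def by (subst measure_distr) (use that in \<open>auto intro!: arg_cong2[where f = measure]\<close>)
  have atom: "measure \<nu> {t} = 0"
  proof -
    have "{\<omega>\<in>space M. T \<omega> \<in> {t}} \<subseteq> {\<omega>\<in>space M. \<bar>ip d (W \<omega>) X - t * s \<omega>\<bar> \<le> 0}"
      using t by (auto simp: T_def flip_scale_def split: if_splits)
    hence "prob {\<omega>\<in>space M. T \<omega> \<in> {t}} \<le> prob {\<omega>\<in>space M. \<bar>ip d (W \<omega>) X - t * s \<omega>\<bar> \<le> 0}"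
      by (rule finite_measure_mono) measurable
    also have "\<dots> \<le> 0" by (rule small_ball[OF X]) simp
    finally show ?thesis by (simp add: P measure_le_0_iff)
  qed
  show "isCont F t" unfolding F using N.isCont_cdf atom by simp
  show "mono F" unfolding F by (intro monoI N.cdf_nondecreasing)
  show "(F \<longlongrightarrow> 1) at_top" unfolding F by (rule N.cdf_lim_at_top_prob)
  show "F t \<ge> 0" unfolding F by (rule N.cdf_nonneg)
  have split: "measure \<nu> ({t} \<union> B) = measure \<nu> B" if "B \<in> sets borel" "t \<notin> B" for B
    using N.finite_measure_Union[of "{t}" B] that atom by simp
  show "prob {\<omega>\<in>space M. flip_scale (ip d (W \<omega>) X, s \<omega>) \<in> {t..b}} = F b - F t" if b: "t \<le> b" for b
  proof (cases "t = b")
    case True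
    thus ?thesis using atom P[of "{t..b}"] by (simp add: T_def)
  next
    case False
    have "{t..b} = {t} \<union> {t<..b}" using b by auto
    hence "measure \<nu> {t..b} = measure \<nu> {t<..b}" using split[of "{t<..b}"] by simp
    also have "\<dots> = F b - F t" unfolding F using N.cdf_diff_eq[of t b] b False by simp
    finally show ?thesis using P[of "{t..b}"] by (simp add: T_def)
  qed
  have "{t..} = {t} \<union> {t<..}" by auto
  hence "measure \<nu> {t..} = measure \<nu> {t<..}" using split[of "{t<..}"] by simp
  also have "{t<..} = space \<nu> - {..t}" by (auto simp: \<nu>_def)
  also have "measure \<nu> \<dots> = 1 - F t" unfolding F by (subst N.prob_compl) (auto simp: cdf_def)
  finally show "prob {\<omega>\<in>space M. flip_scale (ip d (W \<omega>) X, s \<omega>) \<in> {t..}} = 1 - F t"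
    using P[of "{t..}"] by (simp add: T_def)
qed

lemma prob_near_flip:
  assumes X: "X \<in> sym_sphere d" and c: "cell_shape (a, b, J)" and \<tau>: "\<tau> \<ge> 0"
  shows "prob {\<omega>\<in>space M. (ip d (W \<omega>) X, s \<omega>) \<in> near_flip \<tau> (a, b, J)}
    \<le> prob {\<omega>\<in>space M. flip_scale (ip d (W \<omega>) X, s \<omega>) \<in> J} + 2 * \<tau>"
proof -
  have J[measurable]: "J \<in> sets borel" using c by (auto simp: cell_shape_def)
  let ?T = "{\<omega>\<in>space M. flip_scale (ip d (W \<omega>) X, s \<omega>) \<in> J}"
  let ?E = "\<lambda>y. {\<omega>\<in>space M. \<bar>ip d (W \<omega>) X - y * s \<omega>\<bar> \<le> \<tau>}"
  have "{\<omega>\<in>space M. (ip d (W \<omega>) X, s \<omega>) \<in> near_flip \<tau> (a, b, J)} = (?T \<union> ?E a) \<union> ?E b"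
    by (auto simp: near_flip_def)
  moreover have "prob ((?T \<union> ?E a) \<union> ?E b) \<le> prob (?T \<union> ?E a) + prob (?E b)" by (rule measure_Un_le) measurable
  moreover have "prob (?T \<union> ?E a) \<le> prob ?T + prob (?E a)" by (rule measure_Un_le) measurable
  moreover have "prob (?E a) \<le> \<tau>" "prob (?E b) \<le> \<tau>" by (rule small_ball[OF X \<tau>])+
  ultimately show ?thesis by simp
qed

text \<open>The net errors of low-rank matrices need not be symmetric. Against a symmetric matrix
  only the symmetric part counts; its norm is no larger, and rescaling it to norm 1 can only
  increase the modulus.\<close>

lemma ip_dominated:
  assumes d: "d \<ge> 1" and X: "L2_set X (Sq d) \<le> 1"
  shows "\<exists>Y\<in>sym_sphere d. \<forall>\<omega>\<in>space M. \<bar>ip d (W \<omega>) X\<bar> \<le> \<bar>ip d (W \<omega>) Y\<bar>"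
proof -
  define S where "S = (\<lambda>e. X e / 2 + X (prod.swap e) / 2)"
  define n where "n = L2_set S (Sq d)"
  have swap: "(\<Sum>e\<in>Sq d. f (prod.swap e)) = (\<Sum>e\<in>Sq d. f e)" for f :: "nat \<times> nat \<Rightarrow> real"
    by (rule sum.reindex_bij_witness[of _ prod.swap prod.swap]) (auto simp: Sq_def)
  have symS: "sym_on d S" by (simp add: sym_on_def S_def)
  have "L2_set (\<lambda>e. X (prod.swap e)) (Sq d) = L2_set X (Sq d)"
    unfolding L2_set_def by (subst swap[of "\<lambda>e. (X e)\<^sup>2"]) simp
  hence "n \<le> 1"
    using L2_set_triangle_ineq[of "\<lambda>e. 1 / 2 * X e" "\<lambda>e. 1 / 2 * X (prod.swap e)" "Sq d"] X
    unfolding n_def S_def L2_set_smult by simp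
  have n0: "n \<ge> 0" by (simp add: n_def L2_set_nonneg)
  have symA: "W \<omega> (prod.swap e) = W \<omega> e" if "\<omega> \<in> space M" "e \<in> Sq d" for \<omega> e
    using GOE_entries_sym[OF GOE that(1)] that(2) by (auto simp: sym_on_def Sq_def)
  have ipS: "ip d (W \<omega>) X = ip d (W \<omega>) S" if w: "\<omega> \<in> space M" for \<omega>
  proof -
    have "ip d (W \<omega>) X = (\<Sum>e\<in>Sq d. W \<omega> (prod.swap e) * X (prod.swap e))"
      unfolding ip_def by (rule swap[symmetric, of "\<lambda>e. W \<omega> e * X e"])
    also have "\<dots> = (\<Sum>e\<in>Sq d. W \<omega> e * X (prod.swap e))" by (rule sum.cong) (simp_all add: symA[OF w])
    finally have "2 * ip d (W \<omega>) X = ip d (W \<omega>) X + (\<Sum>e\<in>Sq d. W \<omega> e * X (prod.swap e))" by simp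
    also have "\<dots> = 2 * ip d (W \<omega>) S"
      unfolding ip_def S_def sum_distrib_left sum.distrib[symmetric] by (rule sum.cong) (auto simp: algebra_simps)
    finally show ?thesis by simp
  qed
  show ?thesis
  \<comment> \<open>An antisymmetric matrix has inner product 0 with a symmetric one and is
    dominated by any unit matrix.\<close>
  proof (cases "n = 0")
    case True
    hence "ip d w S = 0" for w by (simp add: n_def L2_set_eq_0_iff ip_def)
    hence z: "ip d (W \<omega>) X = 0" if "\<omega> \<in> space M" for \<omega> using ipS[OF that] by simp
    obtain Y where "Y \<in> sym_sphere d" using sym_sphere_nonempty[OF d] by blast
    thus ?thesis using z by auto
  next
    case False
    have "L2_set (\<lambda>e. 1 / n * S e) (Sq d) = 1" unfolding L2_set_smult using False n0 by (simp add: n_def)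
    moreover have "sym_on d (\<lambda>e. 1 / n * S e)" using symS by (simp add: sym_on_def)
    ultimately have "(\<lambda>e. 1 / n * S e) \<in> sym_sphere d" by (simp add: sym_sphere_def)
    moreover have "\<bar>ip d (W \<omega>) X\<bar> \<le> \<bar>ip d (W \<omega>) (\<lambda>e. 1 / n * S e)\<bar>" if "\<omega> \<in> space M" for \<omega>
    proof -
      have "\<bar>ip d (W \<omega>) S\<bar> * n \<le> \<bar>ip d (W \<omega>) S\<bar> * 1" using \<open>n \<le> 1\<close> by (intro mult_left_mono) auto
      thus ?thesis unfolding ipS[OF that] ip_smult using False n0 by (simp add: abs_mult le_divide_eq)
    qed
    ultimately show ?thesis by blast
  qed
qed

end

section \<open>Tail bounds at the points of the net\<close>

lemma (in prob_space) count_event: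
  fixes m :: nat
  assumes "\<And>i. i < m \<Longrightarrow> \<Xi> i \<in> measurable M N" "\<And>i. i < m \<Longrightarrow> B i \<in> sets N"
  shows "{\<omega>\<in>space M. c \<le> real (card {i. i < m \<and> \<Xi> i \<omega> \<in> B i})} \<in> events"
proof -
  have card: "real (card {i. i < m \<and> \<Xi> i \<omega> \<in> B i}) = (\<Sum>i<m. indicat_real (B i) (\<Xi> i \<omega>))" for \<omega>
    by (simp add: indicator_def sum_of_bool_eq Int_def)
  have "(\<lambda>\<omega>. \<Sum>i<m. indicat_real (B i) (\<Xi> i \<omega>)) \<in> borel_measurable M"
    by (intro borel_measurable_sum measurable_compose[OF assms(1)] borel_measurable_indicator assms(2)) auto
  thus ?thesis unfolding card by measurable
qed

lemma (in prob_space) prob_UN_le: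
  assumes "finite I" "\<And>i. i \<in> I \<Longrightarrow> E i \<in> events" "\<And>i. i \<in> I \<Longrightarrow> prob (E i) \<le> x"
  shows "prob (\<Union>i\<in>I. E i) \<le> real (card I) * x"
proof -
  have "prob (\<Union>i\<in>I. E i) \<le> (\<Sum>i\<in>I. prob (E i))"
    by (rule finite_measure_subadditive_finite) (use assms in auto)
  also have "\<dots> \<le> (\<Sum>i\<in>I. x)" by (intro sum_mono assms(3))
  finally show ?thesis by simp
qed

lemma L2_set_net_error:
  assumes Y: "\<forall>j<4. L2_set (Y j) (Sq d) \<le> c" and eq: "\<forall>e\<in>Sq d. X e = X0 e + (\<Sum>j<4::nat. Y j e)"
  shows "L2_set (\<lambda>e. X e - X0 e) (Sq d) \<le> 4 * c"
proof -
  have "L2_set (\<lambda>e. X e - X0 e) (Sq d) = L2_set (\<lambda>e. Y 0 e + Y 1 e + Y 2 e + Y 3 e) (Sq d)"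
    by (rule L2_set_cong) (use eq in \<open>auto simp: eval_nat_numeral\<close>)
  also note tri = L2_set_triangle_ineq[where A = "Sq d"]
  have "L2_set (\<lambda>e. Y 0 e + Y 1 e + Y 2 e + Y 3 e) (Sq d) \<le>
     L2_set (Y 0) (Sq d) + L2_set (Y 1) (Sq d) + L2_set (Y 2) (Sq d) + L2_set (Y 3) (Sq d)"
    using tri[of "\<lambda>e. Y 0 e + Y 1 e + Y 2 e" "Y 3"] tri[of "\<lambda>e. Y 0 e + Y 1 e" "Y 2"] tri[of "Y 0" "Y 1"] by linarith
  also have "\<dots> \<le> 4 * c" using Y[rule_format, of 0] Y[rule_format, of 1] Y[rule_format, of 2] Y[rule_format, of 3] by simp
  finally show ?thesis .
qed

locale noisy_model = prob_space M for M :: "'a measure" +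
  fixes d m :: nat and A :: "nat \<Rightarrow> 'a \<Rightarrow> real mat" and s :: "nat \<Rightarrow> 'a \<Rightarrow> real"
  assumes noisy: "\<And>i. i < m \<Longrightarrow> noisy_GOE M d (A i) (s i)"
    and indep_pairs: "indep_vars (\<lambda>_. entry_space d \<Otimes>\<^sub>M borel) (\<lambda>i \<omega>. (entries d (A i \<omega>), s i \<omega>)) {..<m}"
    and d1: "d \<ge> 1" and m1: "m \<ge> 1"
begin

abbreviation "W i \<omega> \<equiv> entries d (A i \<omega>)"

definition \<Psi> :: "real \<Rightarrow> real" where "\<Psi> u = (\<Sum>i<m. sign_mean M (s i) u) / real m"

lemma W_ip_measurable: "i < m \<Longrightarrow> (\<lambda>\<omega>. ip d (W i \<omega>) X) \<in> borel_measurable M"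
  using measurable_compose[OF noisy_GOE.W_measurable[OF noisy] ip_measurable] by simp

lemma W_sym: "i < m \<Longrightarrow> \<omega> \<in> space M \<Longrightarrow> sym_on d (W i \<omega>)"
  by (rule GOE_entries_sym[OF noisy_GOE.GOE[OF noisy]])

text \<open>The cells come from the average over \<open>i\<close> of the distribution functions, so
  one family serves all indices although the laws of the corruptions differ. The price is that only
  the sum over \<open>i\<close> of the flip probabilities is small, which is what
  \<open>count_deviation\<close> takes. The term \<open>2 * \<tau>\<close> stems from the two
  endpoints.\<close>

lemma flip_cells:
  assumes n: "n \<ge> 1"
  obtains \<J> where "finite \<J>" "card \<J> \<le> n + 1" "\<And>c. c \<in> \<J> \<Longrightarrow> cell_shape c"
    "\<And>u. 0 \<le> u \<Longrightarrow> \<exists>(a, b, J)\<in>\<J>. u \<in> J"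
    "\<And>X c \<tau>. X \<in> sym_sphere d \<Longrightarrow> c \<in> \<J> \<Longrightarrow> \<tau> \<ge> 0 \<Longrightarrow>
      (\<Sum>i<m. prob {\<omega>\<in>space M. (ip d (W i \<omega>) X, s i \<omega>) \<in> near_flip \<tau> c}) \<le> real m * (1 / real n + 2 * \<tau>)"
proof -
  obtain X0 where X0: "X0 \<in> sym_sphere d" using sym_sphere_nonempty[OF d1] by blast
  define F where "F i = cdf (distr M borel (\<lambda>\<omega>. flip_scale (ip d (W i \<omega>) X0, s i \<omega>)))" for i
  note FS = noisy_GOE.flip_scale_cell[OF noisy X0, folded F_def]
  have m0: "real m > 0" using m1 by simp
  have 1: "(\<Sum>i<m. F i a) / real m \<le> (\<Sum>i<m. F i b) / real m" if "0 \<le> a" "a \<le> b" for a b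
    by (intro divide_right_mono sum_mono monoD[OF FS(2)]) (use that in auto)
  have 2: "isCont (\<lambda>t. (\<Sum>i<m. F i t) / real m) t" if "0 \<le> t" for t
    by (intro continuous_intros FS(1)) (use that m0 in auto)
  have "((\<lambda>t. (\<Sum>i<m. F i t) / real m) \<longlongrightarrow> (\<Sum>i<m. 1) / real m) at_top"
    by (intro tendsto_intros FS(3)[of _ 0]) (use m0 in auto)
  hence 3: "((\<lambda>t. (\<Sum>i<m. F i t) / real m) \<longlongrightarrow> 1) at_top" using m0 by simp
  have 4: "0 \<le> (\<Sum>i<m. F i t) / real m" for t
    by (intro divide_nonneg_nonneg sum_nonneg) (auto simp: F_def cdf_def)
  obtain \<J> where \<J>: "finite \<J>" "card \<J> \<le> n + 1" "\<And>u. 0 \<le> u \<Longrightarrow> \<exists>(a, b, J)\<in>\<J>. u \<in> J"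
    and cell: "\<And>a b J. (a, b, J) \<in> \<J> \<Longrightarrow> 0 \<le> a \<and>
       (J = {a..b} \<and> a \<le> b \<and> (\<Sum>i<m. F i b) / real m - (\<Sum>i<m. F i a) / real m \<le> 1 / real n \<or>
        J = {a..} \<and> b = a \<and> 1 - (\<Sum>i<m. F i a) / real m \<le> 1 / real n)"
    by (rule small_interval_cover[of "\<lambda>t. (\<Sum>i<m. F i t) / real m" n, OF 1 2 3 4 n that])
  have shape: "cell_shape c" if "c \<in> \<J>" for c
    using cell[of "fst c" "fst (snd c)" "snd (snd c)"] that by (auto simp: cell_shape_def)
  have "(\<Sum>i<m. prob {\<omega>\<in>space M. (ip d (W i \<omega>) X, s i \<omega>) \<in> near_flip \<tau> c}) \<le> real m * (1 / real n + 2 * \<tau>)"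
    if X: "X \<in> sym_sphere d" and c: "c \<in> \<J>" and \<tau>: "\<tau> \<ge> 0" for X c \<tau>
  proof -
    obtain a b J where abJ: "c = (a, b, J)" by (cases c)
    note sh = shape[OF c, unfolded abJ]
    have "(\<Sum>i<m. prob {\<omega>\<in>space M. (ip d (W i \<omega>) X, s i \<omega>) \<in> near_flip \<tau> c})
        \<le> (\<Sum>i<m. prob {\<omega>\<in>space M. flip_scale (ip d (W i \<omega>) X0, s i \<omega>) \<in> J} + 2 * \<tau>)"
    proof (rule sum_mono)
      fix i assume "i \<in> {..<m}"
      hence N: "noisy_GOE M d (A i) (s i)" using noisy by simp
      have "prob {\<omega>\<in>space M. (ip d (W i \<omega>) X, s i \<omega>) \<in> near_flip \<tau> c} = prob {\<omega>\<in>space M. (ip d (W i \<omega>) X0, s i \<omega>) \<in> near_flip \<tau> c}"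
        by (rule noisy_GOE.prob_pair_eq[OF N X X0 near_flip_measurable[OF shape[OF c]]])
      also have "\<dots> \<le> prob {\<omega>\<in>space M. flip_scale (ip d (W i \<omega>) X0, s i \<omega>) \<in> J} + 2 * \<tau>"
        unfolding abJ by (rule noisy_GOE.prob_near_flip[OF N X0 sh \<tau>])
      finally show "prob {\<omega>\<in>space M. (ip d (W i \<omega>) X, s i \<omega>) \<in> near_flip \<tau> c} \<le> prob {\<omega>\<in>space M. flip_scale (ip d (W i \<omega>) X0, s i \<omega>) \<in> J} + 2 * \<tau>" .
    qed
    also have "\<dots> = (\<Sum>i<m. prob {\<omega>\<in>space M. flip_scale (ip d (W i \<omega>) X0, s i \<omega>) \<in> J}) + real m * (2 * \<tau>)"
      by (simp add: sum.distrib)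
    also have "(\<Sum>i<m. prob {\<omega>\<in>space M. flip_scale (ip d (W i \<omega>) X0, s i \<omega>) \<in> J}) \<le> real m * (1 / real n)"
    proof -
      have a0: "0 \<le> a" using cell[OF c[unfolded abJ]] by simp
      from cell[OF c[unfolded abJ]] consider
        "J = {a..b}" "a \<le> b" "(\<Sum>i<m. F i b) / real m - (\<Sum>i<m. F i a) / real m \<le> 1 / real n"
        | "J = {a..}" "1 - (\<Sum>i<m. F i a) / real m \<le> 1 / real n" by blast
      thus ?thesis
      proof cases
        case 1
        have "(\<Sum>i<m. prob {\<omega>\<in>space M. flip_scale (ip d (W i \<omega>) X0, s i \<omega>) \<in> J}) = (\<Sum>i<m. F i b - F i a)"
          unfolding 1(1) by (rule sum.cong) (use FS(5)[OF _ a0 1(2)] in auto)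
        also have "\<dots> = real m * ((\<Sum>i<m. F i b) / real m - (\<Sum>i<m. F i a) / real m)"
          using m0 by (simp add: sum_subtractf right_diff_distrib)
        also have "\<dots> \<le> real m * (1 / real n)" by (intro mult_left_mono 1(3)) simp
        finally show ?thesis .
      next
        case 2
        have "(\<Sum>i<m. prob {\<omega>\<in>space M. flip_scale (ip d (W i \<omega>) X0, s i \<omega>) \<in> J}) = (\<Sum>i<m. 1 - F i a)"
          unfolding 2(1) by (rule sum.cong) (use FS(6)[OF _ a0] in auto)
        also have "\<dots> = real m * (1 - (\<Sum>i<m. F i a) / real m)"
          using m0 by (simp add: sum_subtractf right_diff_distrib)
        also have "\<dots> \<le> real m * (1 / real n)" by (intro mult_left_mono 2(2)) simp
        finally show ?thesis .
      qed
    qed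
    finally show ?thesis by (simp add: distrib_left)
  qed
  thus ?thesis using that \<J> shape by blast
qed

lemma square_sum_tail:
  assumes X: "L2_set X (Sq d) \<le> 1"
  shows "{\<omega>\<in>space M. 4 * real m \<le> (\<Sum>i<m. (ip d (W i \<omega>) X)\<^sup>2)} \<in> events"
    "prob {\<omega>\<in>space M. 4 * real m \<le> (\<Sum>i<m. (ip d (W i \<omega>) X)\<^sup>2)} \<le> exp (- real m / 2)"
proof -
  have "(\<lambda>\<omega>. \<Sum>i<m. (ip d (W i \<omega>) X)\<^sup>2) \<in> borel_measurable M"
    by (intro borel_measurable_sum borel_measurable_power W_ip_measurable) auto
  thus "{\<omega>\<in>space M. 4 * real m \<le> (\<Sum>i<m. (ip d (W i \<omega>) X)\<^sup>2)} \<in> events" by measurable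
  have "\<forall>i. \<exists>Y. i < m \<longrightarrow> Y \<in> sym_sphere d \<and> (\<forall>\<omega>\<in>space M. \<bar>ip d (W i \<omega>) X\<bar> \<le> \<bar>ip d (W i \<omega>) Y\<bar>)"
    using noisy_GOE.ip_dominated[OF noisy d1 X] by blast
  then obtain Y where Y: "\<And>i. i < m \<Longrightarrow> Y i \<in> sym_sphere d"
    "\<And>i \<omega>. i < m \<Longrightarrow> \<omega> \<in> space M \<Longrightarrow> \<bar>ip d (W i \<omega>) X\<bar> \<le> \<bar>ip d (W i \<omega>) (Y i)\<bar>" by metis
  have ind: "indep_vars (\<lambda>_. borel) (\<lambda>i \<omega>. ip d (fst (W i \<omega>, s i \<omega>)) X) {..<m}"
    by (rule indep_vars_compose2[OF indep_pairs, where Y = "\<lambda>_ z. ip d (fst z) X"])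
       (rule measurable_compose[OF measurable_fst ip_measurable])
  show "prob {\<omega>\<in>space M. 4 * real m \<le> (\<Sum>i<m. (ip d (W i \<omega>) X)\<^sup>2)} \<le> exp (- real m / 2)"
    by (rule gaussian_square_sum_tail[where g = "\<lambda>i \<omega>. ip d (W i \<omega>) (Y i)"])
       (use ind Y noisy_GOE.std[OF noisy] in auto)
qed

lemma near_flip_count_tail:
  assumes X: "X \<in> sym_sphere d" and c: "cell_shape c" and x: "0 \<le> x" "x \<le> 2"
    and q: "(\<Sum>i<m. prob {\<omega>\<in>space M. (ip d (W i \<omega>) X, s i \<omega>) \<in> near_flip \<tau> c}) \<le> real m * q"
  shows "{\<omega>\<in>space M. real m * (q + x) \<le> real (card {i. i < m \<and> (ip d (W i \<omega>) X, s i \<omega>) \<in> near_flip \<tau> c})} \<in> events"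
    "prob {\<omega>\<in>space M. real m * (q + x) \<le> real (card {i. i < m \<and> (ip d (W i \<omega>) X, s i \<omega>) \<in> near_flip \<tau> c})} \<le> exp (- real m * x\<^sup>2 / 4)"
proof -
  have sm: "i < m \<Longrightarrow> s i \<in> borel_measurable M" for i by (rule noisy_GOE.s_measurable[OF noisy])
  show "{\<omega>\<in>space M. real m * (q + x) \<le> real (card {i. i < m \<and> (ip d (W i \<omega>) X, s i \<omega>) \<in> near_flip \<tau> c})} \<in> events"
    by (rule count_event[where N = "borel \<Otimes>\<^sub>M borel"])
       (use W_ip_measurable sm near_flip_measurable[OF c] in auto)
  have "indep_vars (\<lambda>_. borel \<Otimes>\<^sub>M borel) (\<lambda>i \<omega>. (\<lambda>z. (ip d (fst z) X, snd z)) (W i \<omega>, s i \<omega>)) {..<m}"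
    by (rule indep_vars_compose2[OF indep_pairs, where Y = "\<lambda>_ z. (ip d (fst z) X, snd z)"])
       (intro measurable_Pair measurable_compose[OF measurable_fst ip_measurable] measurable_snd)
  hence ind: "indep_vars (\<lambda>_. borel \<Otimes>\<^sub>M borel) (\<lambda>i \<omega>. (ip d (W i \<omega>) X, s i \<omega>)) {..<m}" by simp
  show "prob {\<omega>\<in>space M. real m * (q + x) \<le> real (card {i. i < m \<and> (ip d (W i \<omega>) X, s i \<omega>) \<in> near_flip \<tau> c})} \<le> exp (- real m * x\<^sup>2 / 4)"
    by (rule count_deviation[OF ind near_flip_measurable[OF c] x q])
qed

lemma sign_sum_tail:
  assumes X: "X \<in> sym_sphere d" and v: "v \<in> unit_vecs d" and x: "0 \<le> x" "x \<le> 2"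
  shows "{\<omega>\<in>space M. real m * x \<le> \<bar>(\<Sum>i<m. sign_pm (ip d (W i \<omega>) X - u * s i \<omega>) * ip d (W i \<omega>) (outer v)) - real m * \<Psi> u * ip d X (outer v)\<bar>} \<in> events" (is ?ev)
    "prob {\<omega>\<in>space M. real m * x \<le> \<bar>(\<Sum>i<m. sign_pm (ip d (W i \<omega>) X - u * s i \<omega>) * ip d (W i \<omega>) (outer v)) - real m * \<Psi> u * ip d X (outer v)\<bar>} \<le> 2 * exp (- real m * x\<^sup>2 / 8)" (is ?pr)
proof -
  define Y where "Y i \<omega> = sign_pm (ip d (W i \<omega>) X - u * s i \<omega>) * ip d (W i \<omega>) (outer v)" for i \<omega>
  define f where "f z = sign_pm (ip d (fst z) X - u * snd z) * ip d (fst z) (outer v)" for z :: "(nat \<times> nat \<Rightarrow> real) \<times> real"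
  have fm: "f \<in> borel_measurable (entry_space d \<Otimes>\<^sub>M borel)" unfolding f_def
    by (intro borel_measurable_times measurable_compose[OF _ sign_pm_measurable] borel_measurable_diff
        measurable_compose[OF measurable_fst ip_measurable] borel_measurable_const measurable_snd)
  have ind: "indep_vars (\<lambda>_. borel) (\<lambda>i \<omega>. f (W i \<omega>, s i \<omega>)) {..<m}"
    by (rule indep_vars_compose2[OF indep_pairs, where Y = "\<lambda>_. f"]) (rule fm)
  hence indY: "indep_vars (\<lambda>_. borel) Y {..<m}" by (simp add: f_def Y_def[abs_def])
  \<comment> \<open>A unit vector gives a rank-one matrix of norm 1, so its projection is standard
    Gaussian and dominates the signed summand.\<close>
  have oS: "outer v \<in> sym_sphere d" using v by (simp add: sym_sphere_def sym_on_outer L2_set_outer unit_vecs_def)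
  have mean: "expectation (Y i) = sign_mean M (s i) u * ip d X (outer v)" if "i < m" for i
    unfolding Y_def[abs_def] by (rule noisy_GOE.sign_projection_mean[OF noisy[OF that] X])
  have "real m * \<Psi> u * ip d X (outer v) = (\<Sum>i<m. expectation (Y i))"
    using m1 by (simp add: \<Psi>_def mean sum_distrib_right)
  hence eq: "(\<Sum>i<m. Y i \<omega>) - real m * \<Psi> u * ip d X (outer v) = (\<Sum>i<m. Y i \<omega> - expectation (Y i))" for \<omega>
    by (simp add: sum_subtractf)
  have "(\<lambda>\<omega>. \<Sum>i<m. Y i \<omega> - expectation (Y i)) \<in> borel_measurable M"
    by (intro borel_measurable_sum borel_measurable_diff borel_measurable_const) (use indY in \<open>auto simp: indep_vars_def\<close>)
  thus ?ev unfolding Y_def[symmetric] eq by measurable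
  show ?pr unfolding Y_def[symmetric] eq
    by (rule gaussian_dominated_deviation[OF indY noisy_GOE.std[OF noisy oS] _ x]) (auto simp: Y_def abs_mult)
qed

end

text \<open>All entropies are multiples of P = d k L: 28 for the isometry net, 68 for the net of the
  sphere, 13 for the cells, 8 for the vectors. The binding case is the second: 81 P must be at most
  half of m eta^2 / 4 = m delta^4 / 16000000. This is where 3000000000 and the rate 1 / 32000000
  come from.\<close>

lemma net_size_bounds:
  fixes \<delta> m :: real and d k :: nat
  assumes \<delta>: "0 < \<delta>" "\<delta> \<le> 1" and d: "d \<ge> 1" and k: "k \<ge> 1"
    and m: "m \<ge> 3000000000 * (real d * real k * max (ln (1 / \<delta>)) 1 / \<delta> ^ 4)"
  defines "\<eta> \<equiv> \<delta>\<^sup>2 / 2000"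
  shows "(exp 1 * (3 + 2 / (1 / 16))) ^ (2 * d * (2 * k)) * exp (- m / 2) \<le> exp (- m * \<delta> ^ 4 / 32000000)"
    "(exp 1 * (3 + 2 / (\<eta>\<^sup>2 / 32))) ^ (2 * d * k) * ((1 / \<eta> + 2) * exp (- m * \<eta>\<^sup>2 / 4)) \<le> exp (- m * \<delta> ^ 4 / 32000000)"
    "(exp 1 * (3 + 2 / (\<eta>\<^sup>2 / 32))) ^ (2 * d * k) * ((1 / \<eta> + 2) * ((exp 1 * (3 + 2 / (1 / 40))) ^ d * (2 * exp (- m * (\<delta> / 10)\<^sup>2 / 8))))
       \<le> 2 * exp (- m * \<delta> ^ 4 / 32000000)"
proof -
  define L where "L = max (ln (1 / \<delta>)) 1"
  define P where "P = real d * real k * L"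
  have L: "L \<ge> 1" by (simp add: L_def)
  have "1 \<le> real d * real k" using d k by (metis mult_mono' mult_1 of_nat_1 of_nat_le_iff zero_le_one)
  hence P1: "real d * real k \<le> P" "L \<le> P" unfolding P_def
    using mult_left_mono[OF L, of "real d * real k"] mult_right_mono[of 1 "real d * real k" L] L by auto
  have dk: "real d \<le> real d * real k" using k by (simp add: mult_le_cancel_left1)
  have d4: "\<delta> ^ 4 > 0" "\<delta> ^ 4 \<le> 1" "\<delta> ^ 4 \<le> \<delta>\<^sup>2"
    using \<delta> power_decreasing[of 2 4 \<delta>] by (auto simp: power_le_one)
  have mP: "m * \<delta> ^ 4 \<ge> 3000000000 * P"
    using m d4(1) unfolding L_def[symmetric] P_def by (simp add: divide_le_eq)
  have "0 \<le> P" using P1 L by linarith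
  hence m0: "m > 0" using mP d4 P1 L by (smt (verit) zero_less_mult_iff mult_less_0_iff)
  have m1: "m * \<delta> ^ 4 \<le> m" "m * \<delta> ^ 4 \<le> m * \<delta>\<^sup>2"
    using m0 d4 mult_left_mono[of "\<delta> ^ 4" 1 m] by (auto intro: mult_left_mono)
  have two: "2 ^ n \<le> exp (real n)" for n
    using power_mono[of 2 "exp 1 :: real" n] exp_ge_add_one_self[of 1] by (simp add: exp_of_nat_mult[symmetric])
  have e3: "exp 1 \<le> (3::real)" by (rule exp_le)
  have b1: "exp 1 * (3 + 2 / (1 / 16)) \<le> exp (7::real)"
    using two[of 7] e3 by simp
  have b3: "exp 1 * (3 + 2 / (1 / 40)) \<le> exp (8::real)"
    using two[of 8] e3 by simp
  have inv: "1 / \<delta> \<le> exp L"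
  proof -
    have "1 / \<delta> = exp (ln (1 / \<delta>))" using \<delta> by (subst exp_ln) auto
    moreover have "exp (ln (1 / \<delta>)) \<le> exp L" unfolding L_def exp_le_cancel_iff by (rule max.cobounded1)
    ultimately show ?thesis by linarith
  qed
  have inv4: "1 / \<delta> ^ 4 \<le> exp (4 * L)" and inv2: "1 / \<delta>\<^sup>2 \<le> exp (2 * L)"
    using power_mono[OF inv, of 4] power_mono[OF inv, of 2] \<delta>
    by (auto simp: power_one_over exp_of_nat_mult[symmetric])
  have inv_ge: "1 \<le> 1 / \<delta> ^ 4" "1 \<le> 1 / \<delta>\<^sup>2" using d4 \<delta> by (auto simp: power_le_one)
  have \<eta>2: "\<eta>\<^sup>2 = \<delta> ^ 4 / 4000000" by (simp add: \<eta>_def power_divide)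
  have b2: "exp 1 * (3 + 2 / (\<eta>\<^sup>2 / 32)) \<le> exp (34 * L)"
  proof -
    have "2 / (\<eta>\<^sup>2 / 32) = 256000000 * (1 / \<delta> ^ 4)" unfolding \<eta>2 by simp
    hence "exp 1 * (3 + 2 / (\<eta>\<^sup>2 / 32)) \<le> 3 * (3 * (1 / \<delta> ^ 4) + 256000000 * (1 / \<delta> ^ 4))"
      using e3 inv_ge by (intro mult_mono) auto
    also have "\<dots> \<le> 2 ^ 30 * (1 / \<delta> ^ 4)" using inv_ge by simp
    also have "\<dots> \<le> exp 30 * exp (4 * L)" using two[of 30] inv4 d4 by (intro mult_mono) auto
    also have "\<dots> \<le> exp (34 * L)" using L by (simp add: exp_add[symmetric])
    finally show ?thesis .
  qed
  have b4: "1 / \<eta> + 2 \<le> exp (13 * L)"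
  proof -
    have "1 / \<eta> + 2 \<le> 2 ^ 11 * (1 / \<delta>\<^sup>2)" using inv_ge by (simp add: \<eta>_def)
    also have "\<dots> \<le> exp 11 * exp (2 * L)" using two[of 11] inv2 by (intro mult_mono) auto
    also have "\<dots> \<le> exp (13 * L)" using L by (simp add: exp_add[symmetric])
    finally show ?thesis .
  qed
  have pow: "x ^ n \<le> exp (real n * y)" if "0 \<le> x" "x \<le> exp y" for x y :: real and n
    using power_mono[OF that(2,1), of n] by (simp add: exp_of_nat_mult)
  have \<eta>0: "\<eta> > 0" using \<delta> by (simp add: \<eta>_def)
  have p2: "(exp 1 * (3 + 2 / (\<eta>\<^sup>2 / 32))) ^ (2 * d * k) \<le> exp (68 * P)"
    using pow[OF _ b2, of "2 * d * k"] \<eta>0 by (simp add: P_def mult_ac)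
  have p1: "(exp 1 * (3 + 2 / (1 / 16))) ^ (2 * d * (2 * k)) \<le> exp (28 * P)"
  proof -
    have "(exp 1 * (3 + 2 / (1 / 16)) :: real) ^ (2 * d * (2 * k)) \<le> exp (real (2 * d * (2 * k)) * 7)" by (rule pow[OF _ b1]) simp
    also have "\<dots> \<le> exp (28 * P)" using P1 by simp
    finally show ?thesis .
  qed
  have p3: "(exp 1 * (3 + 2 / (1 / 40)) :: real) ^ d \<le> exp (8 * P)"
  proof -
    have "(exp 1 * (3 + 2 / (1 / 40)) :: real) ^ d \<le> exp (real d * 8)" by (rule pow[OF _ b3]) simp
    also have "\<dots> \<le> exp (8 * P)" using P1 dk by simp
    finally show ?thesis .
  qed
  have p4: "1 / \<eta> + 2 \<le> exp (13 * P)" using b4 P1 by (smt (verit) exp_le_cancel_iff)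
  have "(exp 1 * (3 + 2 / (1 / 16))) ^ (2 * d * (2 * k)) * exp (- m / 2) \<le> exp (28 * P) * exp (- m / 2)"
    by (intro mult_right_mono p1) simp
  also have "\<dots> = exp (28 * P - m / 2)" by (simp add: exp_add[symmetric])
  also have "\<dots> \<le> exp (- m * \<delta> ^ 4 / 32000000)" using mP m1 \<open>0 \<le> P\<close> by simp
  finally show "(exp 1 * (3 + 2 / (1 / 16))) ^ (2 * d * (2 * k)) * exp (- m / 2) \<le> exp (- m * \<delta> ^ 4 / 32000000)" .
  have "(exp 1 * (3 + 2 / (\<eta>\<^sup>2 / 32))) ^ (2 * d * k) * ((1 / \<eta> + 2) * exp (- m * \<eta>\<^sup>2 / 4)) \<le> exp (68 * P) * (exp (13 * P) * exp (- m * \<eta>\<^sup>2 / 4))"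
    by (intro mult_mono p2 p4) (use \<eta>0 in auto)
  also have "\<dots> = exp (81 * P - m * \<delta> ^ 4 / 16000000)" by (simp add: exp_add[symmetric] \<eta>2)
  also have "\<dots> \<le> exp (- m * \<delta> ^ 4 / 32000000)" using mP \<open>0 \<le> P\<close> by simp
  finally show "(exp 1 * (3 + 2 / (\<eta>\<^sup>2 / 32))) ^ (2 * d * k) * ((1 / \<eta> + 2) * exp (- m * \<eta>\<^sup>2 / 4)) \<le> exp (- m * \<delta> ^ 4 / 32000000)" .
  have "(exp 1 * (3 + 2 / (\<eta>\<^sup>2 / 32))) ^ (2 * d * k) * ((1 / \<eta> + 2) * ((exp 1 * (3 + 2 / (1 / 40))) ^ d * (2 * exp (- m * (\<delta> / 10)\<^sup>2 / 8))))
     \<le> exp (68 * P) * (exp (13 * P) * (exp (8 * P) * (2 * exp (- m * (\<delta> / 10)\<^sup>2 / 8))))"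
    by (intro mult_mono p2 p4 p3) (use \<eta>0 in auto)
  also have "\<dots> = 2 * exp (89 * P - m * \<delta>\<^sup>2 / 800)" by (simp add: exp_add[symmetric] power_divide)
  also have "\<dots> \<le> 2 * exp (- m * \<delta> ^ 4 / 32000000)" using mP m1 \<open>0 \<le> P\<close> by simp
  finally show "(exp 1 * (3 + 2 / (\<eta>\<^sup>2 / 32))) ^ (2 * d * k) * ((1 / \<eta> + 2) * ((exp 1 * (3 + 2 / (1 / 40))) ^ d * (2 * exp (- m * (\<delta> / 10)\<^sup>2 / 8))))
       \<le> 2 * exp (- m * \<delta> ^ 4 / 32000000)" .
qed

section \<open>The uniform bound over low-rank matrices, scales and vectors\<close>

context noisy_model
begin

text \<open>The error budget: with \<open>\<tau> = \<eta>\<close> the flipped fraction is at most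
  1/n + 3 eta + eta^2 <= 5 eta, which the weight delta / 64 turns into 0.16 delta. The energy term
  is delta / 4, the vector net gives delta / 9, the variation of the mean about 0.07 delta. The
  three exceptional sets have probability 1, 1 and 2 times the same exponential.\<close>

lemma uniform_sign_sum:
  assumes \<delta>: "0 < \<delta>" "\<delta> \<le> 1" and k: "k \<ge> 1"
    and m: "real m \<ge> 3000000000 * (real d * real k * max (ln (1 / \<delta>)) 1 / \<delta> ^ 4)"
  shows "\<exists>E\<in>events. 1 - 4 * exp (- real m * \<delta> ^ 4 / 32000000) \<le> prob E \<and>
    (\<forall>\<omega>\<in>E. \<forall>X\<in>low_rank_sphere d k. \<forall>u\<ge>0. \<forall>v\<in>unit_vecs d.
      \<bar>(\<Sum>i<m. sign_pm (ip d (W i \<omega>) X - u * s i \<omega>) * ip d (W i \<omega>) (outer v)) - real m * \<Psi> u * ip d X (outer v)\<bar> \<le> real m * \<delta>)"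
proof -
  define \<eta> where "\<eta> = \<delta>\<^sup>2 / 2000"
  define n where "n = nat \<lceil>1 / \<eta>\<rceil>"
  have d2: "\<delta>\<^sup>2 \<le> \<delta>" "\<delta>\<^sup>2 \<le> 1" using \<delta> by (auto simp: power2_eq_square mult_left_le intro: mult_le_one)
  have \<eta>: "\<eta> > 0" "\<eta> \<le> \<delta> / 2000" "\<eta> \<le> 1 / 2000" using \<delta> d2 by (auto simp: \<eta>_def)
  have n_ge: "1 / \<eta> \<le> real n" and n_le: "real n \<le> 1 / \<eta> + 1"
    using \<eta> unfolding n_def by (auto simp: of_nat_nat ceiling_correct)
  have n0: "real n > 0" using n_ge \<eta> by (smt (verit) zero_less_divide_1_iff)
  hence n1: "n \<ge> 1" by simp
  have rn: "1 / real n \<le> \<eta>" using n_ge \<eta> n0 by (simp add: field_simps)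

  \<comment> \<open>Rank \<open>2 * k\<close>, since the isometry bound is applied to differences of
    two matrices of rank at most \<open>k\<close>; precision 1/16 makes the pieces of size
    1/8.\<close>
  obtain N2 where N2: "N2 \<subseteq> {X. low_rank d (2 * k) X \<and> L2_set X (Sq d) \<le> 1}" "finite N2"
    "real (card N2) \<le> (exp 1 * (3 + 2 / (1 / 16))) ^ (2 * d * (2 * k))"
    "\<And>X. X \<in> {X. low_rank d (2 * k) X \<and> L2_set X (Sq d) \<le> 1} \<Longrightarrow> \<exists>X0\<in>N2. \<exists>Y. (\<forall>j<4. low_rank d (2 * k) (Y j) \<and> L2_set (Y j) (Sq d) \<le> 2 * (1 / 16)) \<and>
        (\<forall>e\<in>Sq d. X e = X0 e + (\<Sum>j<4::nat. Y j e))"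
    by (rule low_rank_net[of "{X. low_rank d (2 * k) X \<and> L2_set X (Sq d) \<le> 1}" d "2 * k" "1 / 16"])
       (use d1 k in auto)
  \<comment> \<open>Four pieces of size \<open>2 * (\<eta>\<^sup>2 / 32)\<close> add up to
    \<open>\<eta>\<^sup>2 / 4\<close>, for which 16 epsilon^2 / tau^2 equals eta^2.\<close>
  have \<epsilon>0: "0 < \<eta>\<^sup>2 / 32" "\<eta>\<^sup>2 / 32 \<le> 1"
    using \<eta> power_le_one[of \<eta> 2] by auto
  obtain N where N: "N \<subseteq> low_rank_sphere d k" "finite N"
    "real (card N) \<le> (exp 1 * (3 + 2 / (\<eta>\<^sup>2 / 32))) ^ (2 * d * k)"
    "\<And>X. X \<in> low_rank_sphere d k \<Longrightarrow> \<exists>X0\<in>N. \<exists>Y. (\<forall>j<4. low_rank d k (Y j) \<and> L2_set (Y j) (Sq d) \<le> 2 * (\<eta>\<^sup>2 / 32)) \<and>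
        (\<forall>e\<in>Sq d. X e = X0 e + (\<Sum>j<4::nat. Y j e))"
    by (rule low_rank_net[of "low_rank_sphere d k" d k "\<eta>\<^sup>2 / 32", OF _ \<epsilon>0 d1 k])
       (auto simp: low_rank_sphere_def)
  obtain V where V: "V \<subseteq> unit_vecs d" "finite V" "real (card V) \<le> (exp 1 * (3 + 2 / (1 / 40))) ^ card {..<d}"
    "\<And>v. v \<in> unit_vecs d \<Longrightarrow> \<exists>v0\<in>V. L2_set (\<lambda>i. v i - v0 i) {..<d} \<le> 2 * (1 / 40)"
    by (rule unit_ball_net[of "{..<d}" "unit_vecs d" "1 / 40"]) (use d1 in \<open>auto simp: unit_vecs_def lessThan_empty_iff\<close>)
  obtain \<J> where \<J>: "finite \<J>" "card \<J> \<le> n + 1" "\<And>c. c \<in> \<J> \<Longrightarrow> cell_shape c"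
    "\<And>u. 0 \<le> u \<Longrightarrow> \<exists>(a, b, J)\<in>\<J>. u \<in> J"
    and near: "\<And>X c \<tau>. X \<in> sym_sphere d \<Longrightarrow> c \<in> \<J> \<Longrightarrow> \<tau> \<ge> 0 \<Longrightarrow>
      (\<Sum>i<m. prob {\<omega>\<in>space M. (ip d (W i \<omega>) X, s i \<omega>) \<in> near_flip \<tau> c}) \<le> real m * (1 / real n + 2 * \<tau>)"
    using flip_cells[OF n1] by blast
  have NS: "X0 \<in> sym_sphere d" if "X0 \<in> N" for X0
    using that N(1) by (auto simp: low_rank_sphere_def sym_sphere_def)

  define B1 where "B1 X0 = {\<omega>\<in>space M. 4 * real m \<le> (\<Sum>i<m. (ip d (W i \<omega>) X0)\<^sup>2)}" for X0
  \<comment> \<open>The mean of the count is at most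
    \<open>real m * (1 / real n + 2 * \<eta>)\<close>; the last \<open>\<eta>\<close> is the allowed
    deviation, and its square is the source of delta^4.\<close>
  define B2 where "B2 X0 c = {\<omega>\<in>space M. real m * ((1 / real n + 2 * \<eta>) + \<eta>) \<le> real (card {i. i < m \<and> (ip d (W i \<omega>) X0, s i \<omega>) \<in> near_flip \<eta> c})}" for X0 c
  define B3 where "B3 X0 c v = {\<omega>\<in>space M. real m * (\<delta> / 10) \<le> \<bar>(\<Sum>i<m. sign_pm (ip d (W i \<omega>) X0 - fst c * s i \<omega>) * ip d (W i \<omega>) (outer v)) - real m * \<Psi> (fst c) * ip d X0 (outer v)\<bar>}" for X0 v and c :: "real \<times> real \<times> real set"
  have B1: "B1 X0 \<in> events" "prob (B1 X0) \<le> exp (- real m / 2)" if "X0 \<in> N2" for X0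
    using square_sum_tail[of X0] that N2(1) unfolding B1_def by auto
  have B2: "B2 X0 c \<in> events" "prob (B2 X0 c) \<le> exp (- real m * \<eta>\<^sup>2 / 4)" if "X0 \<in> N" "c \<in> \<J>" for X0 c
  proof -
    have e: "0 \<le> \<eta>" "\<eta> \<le> 2" using \<eta> by auto
    note t = near_flip_count_tail[OF NS[OF that(1)] \<J>(3)[OF that(2)] e near[OF NS[OF that(1)] that(2) e(1)]]
    show "B2 X0 c \<in> events" unfolding B2_def by (rule t(1))
    show "prob (B2 X0 c) \<le> exp (- real m * \<eta>\<^sup>2 / 4)" unfolding B2_def by (rule t(2))
  qed
  have B3: "B3 X0 c v \<in> events" "prob (B3 X0 c v) \<le> 2 * exp (- real m * (\<delta> / 10)\<^sup>2 / 8)" if "X0 \<in> N" "v \<in> V" for X0 c v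
  proof -
    have v: "v \<in> unit_vecs d" and e: "0 \<le> \<delta> / 10" "\<delta> / 10 \<le> 2" using that V(1) \<delta> by auto
    show "B3 X0 c v \<in> events" unfolding B3_def by (rule sign_sum_tail(1)[OF NS[OF that(1)] v e])
    show "prob (B3 X0 c v) \<le> 2 * exp (- real m * (\<delta> / 10)\<^sup>2 / 8)"
      unfolding B3_def by (rule sign_sum_tail(2)[OF NS[OF that(1)] v e])
  qed
  define U1 where "U1 = (\<Union>X0\<in>N2. B1 X0)"
  define U2 where "U2 = (\<Union>X0\<in>N. \<Union>c\<in>\<J>. B2 X0 c)"
  define U3 where "U3 = (\<Union>X0\<in>N. \<Union>c\<in>\<J>. \<Union>v\<in>V. B3 X0 c v)"
  have ev: "U1 \<in> events" "U2 \<in> events" "U3 \<in> events"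
    unfolding U1_def U2_def U3_def
    by (intro sets.finite_UN N2(2) N(2) V(2) \<J>(1); (rule B1(1) B2(1) B3(1); assumption))+
  note sizes = net_size_bounds[OF \<delta> d1 k m, folded \<eta>_def]
  have cJ: "real (card \<J>) \<le> 1 / \<eta> + 2" using \<J>(2) n_le by linarith
  have "prob U1 \<le> real (card N2) * exp (- real m / 2)"
    unfolding U1_def by (rule prob_UN_le) (use N2 B1 in auto)
  also have "\<dots> \<le> (exp 1 * (3 + 2 / (1 / 16))) ^ (2 * d * (2 * k)) * exp (- real m / 2)"
    by (intro mult_right_mono N2(3)) simp
  also note sizes(1)
  finally have P1: "prob U1 \<le> exp (- real m * \<delta> ^ 4 / 32000000)" .
  have "prob U2 \<le> real (card N) * (real (card \<J>) * exp (- real m * \<eta>\<^sup>2 / 4))"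
    unfolding U2_def by (intro prob_UN_le sets.finite_UN N(2) \<J>(1); (rule B2; assumption))
  also have "\<dots> \<le> (exp 1 * (3 + 2 / (\<eta>\<^sup>2 / 32))) ^ (2 * d * k) * ((1 / \<eta> + 2) * exp (- real m * \<eta>\<^sup>2 / 4))"
    by (intro mult_mono N(3) cJ) (use \<eta> in auto)
  also note sizes(2)
  finally have P2: "prob U2 \<le> exp (- real m * \<delta> ^ 4 / 32000000)" .
  have "prob U3 \<le> real (card N) * (real (card \<J>) * (real (card V) * (2 * exp (- real m * (\<delta> / 10)\<^sup>2 / 8))))"
    unfolding U3_def by (intro prob_UN_le sets.finite_UN N(2) \<J>(1) V(2); (rule B3; assumption))
  also have "\<dots> \<le> (exp 1 * (3 + 2 / (\<eta>\<^sup>2 / 32))) ^ (2 * d * k) * ((1 / \<eta> + 2) * ((exp 1 * (3 + 2 / (1 / 40))) ^ d * (2 * exp (- real m * (\<delta> / 10)\<^sup>2 / 8))))"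
    by (intro mult_mono N(3) cJ) (use \<eta> V(3) in auto)
  also note sizes(3)
  finally have P3: "prob U3 \<le> 2 * exp (- real m * \<delta> ^ 4 / 32000000)" .
  define E where "E = space M - (U1 \<union> U2 \<union> U3)"
  have "prob ((U1 \<union> U2) \<union> U3) \<le> prob (U1 \<union> U2) + prob U3" by (rule measure_Un_le) (use ev in auto)
  moreover have "prob (U1 \<union> U2) \<le> prob U1 + prob U2" by (rule measure_Un_le) (use ev in auto)
  moreover have "prob E = 1 - prob (U1 \<union> U2 \<union> U3)" unfolding E_def by (rule prob_compl) (use ev in auto)
  ultimately have PE: "1 - 4 * exp (- real m * \<delta> ^ 4 / 32000000) \<le> prob E" using P1 P2 P3 by linarith

  have \<Psi>_var: "\<bar>\<Psi> u - \<Psi> a\<bar> \<le> \<delta> / 16 + (1 / real n) / (\<delta> / 16)" if c: "(a, b, J) \<in> \<J>" and u: "u \<in> J" for a b J u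
  proof -
    obtain X0 where X0: "X0 \<in> sym_sphere d" using sym_sphere_nonempty[OF d1] by blast
    let ?p = "\<lambda>i. prob {\<omega>\<in>space M. (ip d (W i \<omega>) X0, s i \<omega>) \<in> near_flip 0 (a, b, J)}"
    have "\<bar>\<Psi> u - \<Psi> a\<bar> = \<bar>\<Sum>i<m. sign_mean M (s i) u - sign_mean M (s i) a\<bar> / real m"
      by (simp add: \<Psi>_def sum_subtractf diff_divide_distrib[symmetric])
    also have "\<dots> \<le> (\<Sum>i<m. \<delta> / 16 + ?p i / (\<delta> / 16)) / real m"
      using \<delta> by (intro divide_right_mono order_trans[OF sum_abs] sum_mono noisy_GOE.sign_mean_variation[OF noisy X0 \<J>(3)[OF c] u]) auto
    also have "\<dots> = \<delta> / 16 + ((\<Sum>i<m. ?p i) / real m) / (\<delta> / 16)"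
      using m1 by (simp add: sum.distrib sum_divide_distrib[symmetric] add_divide_distrib sum_distrib_right[symmetric])
    also have "\<dots> \<le> \<delta> / 16 + (1 / real n) / (\<delta> / 16)"
      using near[OF X0 c, of 0] m1 \<delta> by (intro add_left_mono divide_right_mono) (auto simp: divide_le_eq mult.commute)
    finally show ?thesis .
  qed
  have \<Psi>1: "\<bar>\<Psi> u\<bar> \<le> 1" for u
  proof -
    have "\<bar>\<Psi> u\<bar> \<le> (\<Sum>i<m. 1) / real m" unfolding \<Psi>_def abs_divide
      by (simp only: abs_of_nat) (intro divide_right_mono order_trans[OF sum_abs] sum_mono noisy_GOE.sign_mean_bound[OF noisy]; simp)
    thus ?thesis using m1 by simp
  qed
  have main: "\<bar>(\<Sum>i<m. sign_pm (ip d (W i \<omega>) X - u * s i \<omega>) * ip d (W i \<omega>) (outer v)) - real m * \<Psi> u * ip d X (outer v)\<bar> \<le> real m * \<delta>"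
    if w: "\<omega> \<in> E" and X: "X \<in> low_rank_sphere d k" and u: "0 \<le> u" and v: "v \<in> unit_vecs d" for \<omega> X u v
  proof -
    have wS: "\<omega> \<in> space M" and wU: "\<omega> \<notin> U1" "\<omega> \<notin> U2" "\<omega> \<notin> U3" using w by (auto simp: E_def)
    have "\<bar>(\<Sum>i<m. sign_pm (ip d (W i \<omega>) X - u * s i \<omega>) * ip d (W i \<omega>) (outer v)) - real m * \<Psi> u * ip d X (outer v)\<bar>
      \<le> real m * (16 * (\<delta> / 64) + (((1 / real n + 2 * \<eta>) + \<eta>) + 16 * (\<eta>\<^sup>2 / 4)\<^sup>2 / \<eta>\<^sup>2) / (\<delta> / 64)
           + (\<delta> / 10) / (9 / 10) + (\<delta> / 16 + (1 / real n) / (\<delta> / 16)) + \<eta>\<^sup>2 / 4)"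
    proof (rule sign_sum_uniform_bound[where N = N and V = V and \<J> = \<J> and \<tau> = \<eta>])
      show "(\<Sum>i<m. (ip d (W i \<omega>) Y)\<^sup>2) \<le> 16 * real m * (L2_set Y (Sq d))\<^sup>2" if "low_rank d (2 * k) Y" for Y
      proof (rule restricted_isometry_of_net[OF _ _ that, where N = N2])
        show "\<exists>X0\<in>N2. \<exists>Y. (\<forall>j<4. low_rank d (2 * k) (Y j) \<and> L2_set (Y j) (Sq d) \<le> 1 / 8) \<and> (\<forall>e\<in>Sq d. Z e = X0 e + (\<Sum>j<4::nat. Y j e))"
          if "low_rank d (2 * k) Z" "L2_set Z (Sq d) \<le> 1" for Z
          using N2(4)[of Z] that by simp
        show "(\<Sum>i<m. (ip d (W i \<omega>) X0)\<^sup>2) \<le> 4 * real m" if "X0 \<in> N2" for X0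
          using wU(1) wS that by (force simp: U1_def B1_def)
      qed
      show "\<exists>X0\<in>N. L2_set (\<lambda>e. Z e - X0 e) (Sq d) \<le> \<eta>\<^sup>2 / 4" if Z: "Z \<in> low_rank_sphere d k" for Z
      proof -
        obtain X0 Y where XY: "X0 \<in> N" "\<forall>j<4. low_rank d k (Y j) \<and> L2_set (Y j) (Sq d) \<le> 2 * (\<eta>\<^sup>2 / 32)"
          "\<forall>e\<in>Sq d. Z e = X0 e + (\<Sum>j<4::nat. Y j e)" using N(4)[OF Z] by blast
        have "L2_set (\<lambda>e. Z e - X0 e) (Sq d) \<le> 4 * (2 * (\<eta>\<^sup>2 / 32))"
          by (rule L2_set_net_error[OF _ XY(3)]) (use XY(2) in blast)
        thus ?thesis using XY(1) by (intro bexI[of _ X0]) auto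
      qed
      show "\<exists>v0\<in>V. L2_set (\<lambda>i. z i - v0 i) {..<d} \<le> 1 / 20" if "z \<in> unit_vecs d" for z
        using V(4)[OF that] by simp
      show "real (card {i. i < m \<and> (ip d (W i \<omega>) X0, s i \<omega>) \<in> near_flip \<eta> c}) \<le> real m * ((1 / real n + 2 * \<eta>) + \<eta>)"
        if "X0 \<in> N" "c \<in> \<J>" for X0 c
      proof -
        have "\<omega> \<notin> B2 X0 c" using wU(2) that by (auto simp: U2_def)
        thus ?thesis using wS by (simp add: B2_def)
      qed
      show "\<bar>(\<Sum>i<m. sign_pm (ip d (W i \<omega>) X0 - a * s i \<omega>) * ip d (W i \<omega>) (outer z)) - real m * \<Psi> a * ip d X0 (outer z)\<bar> \<le> real m * (\<delta> / 10)"
        if "X0 \<in> N" "(a, b, J) \<in> \<J>" "z \<in> V" for X0 a b J z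
      proof -
        have "\<omega> \<notin> B3 X0 (a, b, J) z" using wU(3) that unfolding U3_def by blast
        thus ?thesis using wS by (simp add: B3_def)
      qed
      show "\<bar>\<Psi> y - \<Psi> a\<bar> \<le> \<delta> / 16 + (1 / real n) / (\<delta> / 16)" if "(a, b, J) \<in> \<J>" "y \<in> J" for a b J y
        by (rule \<Psi>_var[OF that])
    qed (use k W_sym wS N V \<J> \<eta> \<delta> \<Psi>1 X u v in \<open>auto\<close>)
    also have "\<dots> \<le> real m * \<delta>"
    proof (rule mult_left_mono)
      have e1: "16 * (\<eta>\<^sup>2 / 4)\<^sup>2 / \<eta>\<^sup>2 = \<eta>\<^sup>2" using \<eta> by (simp add: power_divide power2_eq_square)
      have e2: "\<eta>\<^sup>2 \<le> \<eta>" using \<eta> by (simp add: power2_eq_square mult_left_le)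
      have "(((1 / real n + 2 * \<eta>) + \<eta>) + \<eta>\<^sup>2) / (\<delta> / 64) \<le> (5 * \<eta>) / (\<delta> / 64)"
        using \<delta> rn e2 by (intro divide_right_mono) auto
      also have "\<dots> = 320 * \<delta> / 2000" using \<delta> by (simp add: \<eta>_def power2_eq_square)
      finally have t1: "(((1 / real n + 2 * \<eta>) + \<eta>) + \<eta>\<^sup>2) / (\<delta> / 64) \<le> 320 * \<delta> / 2000" .
      have "(1 / real n) / (\<delta> / 16) \<le> \<eta> / (\<delta> / 16)" using \<delta> rn by (intro divide_right_mono) auto
      also have "\<dots> = 16 * \<delta> / 2000" using \<delta> by (simp add: \<eta>_def power2_eq_square)
      finally have t2: "(1 / real n) / (\<delta> / 16) \<le> 16 * \<delta> / 2000" .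
      have gen: "16 * (\<delta> / 64) + z + (\<delta> / 10) / (9 / 10) + (\<delta> / 16 + z') + \<eta>\<^sup>2 / 4 \<le> \<delta>"
        if "z \<le> 320 * \<delta> / 2000" "z' \<le> 16 * \<delta> / 2000" for z z'
      proof -
        have "(\<delta> / 10) / (9 / 10) = \<delta> / 9" by simp
        thus ?thesis using that e2 \<eta>(2) \<delta>(1) by simp
      qed
      show "16 * (\<delta> / 64) + (((1 / real n + 2 * \<eta>) + \<eta>) + 16 * (\<eta>\<^sup>2 / 4)\<^sup>2 / \<eta>\<^sup>2) / (\<delta> / 64)
           + (\<delta> / 10) / (9 / 10) + (\<delta> / 16 + (1 / real n) / (\<delta> / 16)) + \<eta>\<^sup>2 / 4 \<le> \<delta>"
        unfolding e1 by (rule gen[OF t1 t2])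
    qed simp
    finally show ?thesis .
  qed
  show ?thesis
    by (rule bexI[of _ E]) (use PE main ev in \<open>auto simp: E_def\<close>)
qed

end

section \<open>From quadratic forms to the RDPP\<close>

text \<open>The columns are expanded in a maximal independent subset of the columns, whose size is
  the rank: the left factors are the basis vectors, the right ones the coefficients.\<close>

lemma (in vec_space) rank_factorization:
  assumes A: "A \<in> carrier_mat n nc"
  shows "\<exists>q r. \<forall>i<n. \<forall>j<nc. A $$ (i, j) = (\<Sum>l<rank A. q l i * r l j)"
proof -
  let ?P = "\<lambda>T. T \<subseteq> set (cols A) \<and> lin_indpt T"
  have C: "set (cols A) \<subseteq> carrier_vec n" using cols_dim A by blast
  have "lin_indpt {}" by (auto simp: lin_dep_def)
  hence "\<exists>S. finite S \<and> maximal S ?P \<and> {} \<subseteq> S"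
    by (intro maximal_exists_superset[of "set (cols A)"]) auto
  then obtain S where S: "finite S" "maximal S ?P" by blast
  have SC: "S \<subseteq> set (cols A)" and indS: "lin_indpt S" using S(2) by (auto simp: maximal_def)
  have Scarr: "S \<subseteq> carrier_vec n" using SC C by blast
  have rk: "rank A = card S" by (rule rank_card_indpt[OF A S(2)])
  obtain h where h: "bij_betw h {0..<card S} S" using ex_bij_betw_nat_finite[OF S(1)] by blast
  have "\<exists>a. col A j = lincomb a S" if j: "j < nc" for j
  proof -
    have cj: "col A j \<in> set (cols A)" using j A by (metis carrier_matD(2) cols_length cols_nth nth_mem)
    have "col A j \<in> span S"
    proof (cases "col A j \<in> S")
      case True thus ?thesis using span_mem Scarr by auto
    next
      case False
      have "lin_dep (insert (col A j) S)"
      proof (rule ccontr)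
        assume "\<not> lin_dep (insert (col A j) S)"
        hence "?P (insert (col A j) S)" using SC cj by auto
        hence "S = insert (col A j) S" using S(2) unfolding maximal_def by (metis subset_insertI)
        thus False using False by blast
      qed
      thus ?thesis using lin_dep_iff_in_span[OF _ indS _ False] Scarr cj C by auto
    qed
    thus ?thesis unfolding finite_span[OF S(1) Scarr] by blast
  qed
  then obtain a where a: "\<And>j. j < nc \<Longrightarrow> col A j = lincomb (a j) S" by metis
  have "A $$ (i, j) = (\<Sum>l<rank A. vec_index (h l) i * a j (h l))" if ij: "i < n" "j < nc" for i j
  proof -
    have "A $$ (i, j) = vec_index (col A j) i" using A ij by simp
    also have "\<dots> = (\<Sum>x\<in>S. a j x * vec_index x i)" unfolding a[OF ij(2)] by (rule lincomb_index[OF ij(1) Scarr])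
    also have "\<dots> = (\<Sum>l\<in>{0..<card S}. a j (h l) * vec_index (h l) i)"
      by (rule sum.reindex_bij_betw[OF h, symmetric])
    finally show ?thesis by (simp add: rk lessThan_atLeast0 mult.commute)
  qed
  thus ?thesis by (intro exI[of _ "\<lambda>l i. vec_index (h l) i"] exI[of _ "\<lambda>l j. a j (h l)"]) simp
qed

lemma low_rank_of_rank:
  assumes X: "X \<in> carrier_mat d d" and rk: "vec_space.rank d X \<le> k"
  shows "low_rank d k (\<lambda>e. X $$ e)"
proof -
  obtain q r where "\<forall>i<d. \<forall>j<d. X $$ (i, j) = (\<Sum>l<vec_space.rank d X. q l i * r l j)"
    using vec_space.rank_factorization[OF X] by blast
  hence "low_rank d (vec_space.rank d X) (\<lambda>e. X $$ e)" unfolding low_rank_def by blast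
  thus ?thesis by (rule low_rank_mono[OF _ rk])
qed

lemma inner_mat_eq:
  assumes "A \<in> carrier_mat d d" "X \<in> carrier_mat d d"
  shows "inner_mat A X = (\<Sum>e\<in>Sq d. A $$ e * X $$ e)"
proof -
  have "inner_mat A X = (\<Sum>j<d. \<Sum>i<d. A $$ (i, j) * X $$ (i, j))"
    unfolding inner_mat_def trace_mat_def using assms
    by (auto simp: scalar_prod_def lessThan_atLeast0 intro!: sum.cong)
  also have "\<dots> = (\<Sum>e\<in>Sq d. A $$ e * X $$ e)"
    unfolding Sq_def by (subst sum.swap) (simp add: sum.cartesian_product case_prod_beta)
  finally show ?thesis .
qed

lemma frob_norm_eq: "X \<in> carrier_mat d d \<Longrightarrow> frob_norm X = L2_set (\<lambda>e. X $$ e) (Sq d)"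
  by (simp add: frob_norm_def inner_mat_eq L2_set_def power2_eq_square)

text \<open>With w = B v one has |w|^2 = B(w, v) <= beta |w|, so the quadratic form controls the
  operator norm of a symmetric matrix without spectral theory.\<close>

lemma op_norm_le:
  assumes B: "B \<in> carrier_mat d d" and sym: "transpose_mat B = B" and d: "d \<ge> 1"
    and bnd: "\<And>v. v \<in> unit_vecs d \<Longrightarrow> \<bar>ip d (\<lambda>e. B $$ e) (outer v)\<bar> \<le> \<beta>"
  shows "op_norm B \<le> \<beta>"
proof -
  have eucl: "euclid_norm v = L2_set (vec_index v) {..<d}" if "v \<in> carrier_vec d" for v
    using that by (simp add: euclid_norm_def scalar_prod_def L2_set_def power2_eq_square lessThan_atLeast0)
  have symB: "sym_on d (\<lambda>e. B $$ e)" unfolding sym_on_def using symmetric_mat_index[OF B sym] by blast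
  \<comment> \<open>A unit vector: it makes the supremum run over a nonempty set and
    \<open>\<beta>\<close> nonnegative.\<close>
  define e0 where "e0 = (\<lambda>i. if i = (0::nat) then 1 else 0 :: real)"
  have "(\<Sum>i<d. (e0 i)\<^sup>2) = (\<Sum>i\<in>{0}. (e0 i)\<^sup>2)"
    by (rule sum.mono_neutral_right) (use d in \<open>auto simp: e0_def\<close>)
  hence e0: "L2_set e0 {..<d} = 1" by (simp add: L2_set_def e0_def)
  hence \<beta>0: "\<beta> \<ge> 0" using bnd[of e0] by (force simp: unit_vecs_def)
  have "L2_set (vec_index (Matrix.vec d e0)) {..<d} = L2_set e0 {..<d}" by (rule L2_set_cong) auto
  hence ne: "Matrix.vec d e0 \<in> {v \<in> carrier_vec (dim_col B). euclid_norm v = 1}"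
    using B e0 by (simp add: eucl)
  show ?thesis unfolding op_norm_def
  proof (rule cSUP_least)
    show "{v \<in> carrier_vec (dim_col B). euclid_norm v = 1} \<noteq> {}" using ne by blast
    fix v assume "v \<in> {v \<in> carrier_vec (dim_col B). euclid_norm v = 1}"
    hence v: "v \<in> carrier_vec d" "L2_set (vec_index v) {..<d} = 1" using B by (auto simp: eucl)
    define w where "w = B *\<^sub>v v"
    have w: "w \<in> carrier_vec d" using B v by (simp add: w_def)
    have wi: "vec_index w a = (\<Sum>b<d. B $$ (a, b) * vec_index v b)" if "a < d" for a
      using B v that by (simp add: w_def scalar_prod_def lessThan_atLeast0)
    let ?n = "L2_set (vec_index w) {..<d}"
    have "?n\<^sup>2 = (\<Sum>a<d. vec_index w a * (\<Sum>b<d. B $$ (a, b) * vec_index v b))"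
      unfolding L2_set_sq by (rule sum.cong) (simp_all add: power2_eq_square wi)
    also have "\<dots> = bil_form d (\<lambda>e. B $$ e) (vec_index w) (vec_index v)"
      by (simp add: bil_form_def sum_distrib_left mult_ac)
    also have "\<dots> \<le> \<beta> * ?n * 1"
      using symmetric_bil_form_bound[OF symB bnd \<beta>0, of "vec_index w" "vec_index v"] v(2) by simp
    finally have "?n * ?n \<le> \<beta> * ?n" by (simp add: power2_eq_square)
    hence "?n \<le> \<beta>" using \<beta>0 L2_set_nonneg[of "vec_index w" "{..<d}"]
      by (cases "?n = 0") (auto simp: mult_le_cancel_right)
    thus "euclid_norm (B *\<^sub>v v) \<le> \<beta>" using eucl[OF w] by (simp add: w_def)
  qed
qed

text \<open>Here \<open>u\<close> stands for \<open>1 / \<parallel>X\<parallel>\<close>: rescaling \<open>X\<close> to the unit sphere rescales the corruption.\<close>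

lemma RDPP_of_quadratic_forms:
  assumes d: "d \<ge> 1" and m: "m \<ge> 1" and A: "\<And>i. i < m \<Longrightarrow> A i \<in> carrier_mat d d \<and> transpose_mat (A i) = A i"
    and bnd: "\<And>X u v. X \<in> low_rank_sphere d k \<Longrightarrow> 0 < u \<Longrightarrow> v \<in> unit_vecs d \<Longrightarrow>
      \<bar>(\<Sum>i<m. sign_pm (ip d (entries d (A i)) X - u * s i) * ip d (entries d (A i)) (outer v))
         - real m * \<Psi> u * ip d X (outer v)\<bar> \<le> real m * \<delta>"
    and \<psi>: "\<And>X. X \<in> carrier_mat d d \<Longrightarrow> frob_norm X > 0 \<Longrightarrow> \<psi> X = \<Psi> (1 / frob_norm X)"
  shows "RDPP d m k \<delta> \<psi> A s"
  unfolding RDPP_def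
proof (intro ballI impI)
  fix X :: "real mat" assume X: "X \<in> carrier_mat d d"
    and "X \<noteq> 0\<^sub>m d d \<and> transpose_mat X = X \<and> vec_space.rank d X \<le> k"
  hence X0: "X \<noteq> 0\<^sub>m d d" and Xs: "transpose_mat X = X" and rk: "vec_space.rank d X \<le> k" by auto
  have symX: "X $$ (a, b) = X $$ (b, a)" if "a < d" "b < d" for a b
    by (rule symmetric_mat_index[OF X Xs that])
  have symA: "A i $$ (a, b) = A i $$ (b, a)" if "i < m" "a < d" "b < d" for i a b
    using symmetric_mat_index A that by blast
  define r where "r = frob_norm X"
  have r: "r = L2_set (\<lambda>e. X $$ e) (Sq d)" unfolding r_def by (rule frob_norm_eq[OF X])
  have r0: "r > 0"
  proof -
    have "r \<noteq> 0"
    proof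
      assume "r = 0"
      hence "\<forall>e\<in>Sq d. X $$ e = 0" unfolding r by (simp add: L2_set_eq_0_iff)
      hence "X = 0\<^sub>m d d" using X by (intro eq_matI) (auto simp: Sq_def)
      thus False using X0 by simp
    qed
    thus ?thesis using L2_set_nonneg[of "\<lambda>e. X $$ e" "Sq d"] unfolding r by linarith
  qed
  define Y where "Y = (\<lambda>e. 1 / r * X $$ e)"
  have "L2_set Y (Sq d) = 1" unfolding Y_def L2_set_smult r[symmetric] using r0 by simp
  moreover have "low_rank d k Y" unfolding Y_def by (rule low_rank_smult[OF low_rank_of_rank[OF X rk]])
  moreover have "sym_on d Y" using symX by (simp add: sym_on_def Y_def)
  ultimately have Y: "Y \<in> low_rank_sphere d k" by (simp add: low_rank_sphere_def)
  have W: "ip d (entries d (A i)) Z = (\<Sum>e\<in>Sq d. A i $$ e * Z e)" for i Z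
    unfolding ip_def by (rule sum.cong) (simp_all add: entries_def Sq_def)
  have sg: "sign_pm (inner_mat (A i) X - s i) = sign_pm (ip d (entries d (A i)) Y - 1 / r * s i)" if "i < m" for i
  proof -
    have "inner_mat (A i) X - s i = r * (ip d (entries d (A i)) Y - 1 / r * s i)"
      using r0 A[OF that] X by (simp add: inner_mat_eq W Y_def sum_distrib_left right_diff_distrib)
    thus ?thesis using r0 by (simp add: sign_pm_def mult_less_0_iff)
  qed
  let ?B = "D_mat d m A s X - (\<psi> X / frob_norm X) \<cdot>\<^sub>m X"
  have Bab: "?B $$ e = (1 / real m) * (\<Sum>i<m. sign_pm (inner_mat (A i) X - s i) * A i $$ e) - \<psi> X / r * X $$ e"
    if "e \<in> Sq d" for e
    using that X by (cases e) (simp add: D_mat_def r_def Sq_def)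
  have Bc: "?B \<in> carrier_mat d d" using X by (intro minus_carrier_mat smult_carrier_mat)
  show "op_norm ?B \<le> \<delta>"
  proof (rule op_norm_le[OF Bc _ d])
    show "transpose_mat ?B = ?B"
    proof (rule eq_matI)
      fix a b assume "a < dim_row ?B" "b < dim_col ?B"
      hence ab: "a < d" "b < d" using Bc by auto
      have "transpose_mat ?B $$ (a, b) = ?B $$ (b, a)" using Bc ab by (subst index_transpose_mat) auto
      also have "\<dots> = ?B $$ (a, b)"
        using ab symX[OF ab] by (subst (1 2) Bab) (auto simp: Sq_def symA intro!: sum.cong arg_cong2[where f = "(-)"])
      finally show "transpose_mat ?B $$ (a, b) = ?B $$ (a, b)" .
    qed (use X in auto)
    fix v assume v: "v \<in> unit_vecs d"
    have "ip d (\<lambda>e. ?B $$ e) (outer v) = (\<Sum>e\<in>Sq d. (1 / real m) * (\<Sum>i<m. sign_pm (inner_mat (A i) X - s i) * (A i $$ e * outer v e)) - \<psi> X * (Y e * outer v e))"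
      unfolding ip_def by (rule sum.cong) (simp_all add: Bab Y_def left_diff_distrib sum_distrib_right mult.assoc)
    also have "\<dots> = (1 / real m) * (\<Sum>e\<in>Sq d. \<Sum>i<m. sign_pm (inner_mat (A i) X - s i) * (A i $$ e * outer v e)) - \<psi> X * ip d Y (outer v)"
      by (simp add: sum_subtractf sum_distrib_left ip_def)
    also have "(\<Sum>e\<in>Sq d. \<Sum>i<m. sign_pm (inner_mat (A i) X - s i) * (A i $$ e * outer v e)) = (\<Sum>i<m. sign_pm (ip d (entries d (A i)) Y - 1 / r * s i) * ip d (entries d (A i)) (outer v))"
      by (subst sum.swap) (auto simp: W sg sum_distrib_left intro!: sum.cong)
    also have "(1 / real m) * \<dots> - \<psi> X * ip d Y (outer v) =
       ((\<Sum>i<m. sign_pm (ip d (entries d (A i)) Y - 1 / r * s i) * ip d (entries d (A i)) (outer v)) - real m * \<Psi> (1 / r) * ip d Y (outer v)) / real m"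
      using m r0 \<psi>[OF X] by (simp add: r_def[symmetric] diff_divide_distrib)
    finally show "\<bar>ip d (\<lambda>e. ?B $$ e) (outer v)\<bar> \<le> \<delta>"
      using bnd[OF Y _ v, of "1 / r"] r0 m by (simp add: abs_divide divide_le_eq mult.commute)
  qed
qed

text \<open>Rectangles form an intersection-stable generator of the product sigma-algebra. For them
  the probability factors first between the two families, by \<open>joint\<close>, then within each,
  and the factors are regrouped by index.\<close>

lemma (in prob_space) indep_vars_pairs:
  assumes X: "indep_vars (\<lambda>_. S) X I" and Y: "indep_vars (\<lambda>_. T) Y I"
    and joint: "\<And>J U V. J \<noteq> {} \<Longrightarrow> finite J \<Longrightarrow> J \<subseteq> I \<Longrightarrow> (\<And>j. j \<in> J \<Longrightarrow> U j \<in> sets S) \<Longrightarrow> (\<And>j. j \<in> J \<Longrightarrow> V j \<in> sets T) \<Longrightarrow>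
      prob ((\<Inter>j\<in>J. X j -` U j \<inter> space M) \<inter> (\<Inter>j\<in>J. Y j -` V j \<inter> space M))
        = prob (\<Inter>j\<in>J. X j -` U j \<inter> space M) * prob (\<Inter>j\<in>J. Y j -` V j \<inter> space M)"
  shows "indep_vars (\<lambda>_. S \<Otimes>\<^sub>M T) (\<lambda>i \<omega>. (X i \<omega>, Y i \<omega>)) I"
proof -
  have Xm: "X i \<in> measurable M S" and Ym: "Y i \<in> measurable M T" if "i \<in> I" for i
    using X Y that by (auto simp: indep_vars_def)
  define R where "R = {U \<times> V | U V. U \<in> sets S \<and> V \<in> sets T}"
  define G where "G i = {(\<lambda>\<omega>. (X i \<omega>, Y i \<omega>)) -` C \<inter> space M | C. C \<in> R}" for i
  have vim: "(\<lambda>\<omega>. (X i \<omega>, Y i \<omega>)) -` (U \<times> V) \<inter> space M = (X i -` U \<inter> space M) \<inter> (Y i -` V \<inter> space M)" for i U V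
    by auto
  have indG: "indep_sets G I"
  proof (rule indep_setsI)
    fix i assume i: "i \<in> I"
    show "G i \<subseteq> events" using Xm[OF i] Ym[OF i] by (auto simp: G_def R_def vim)
  next
    fix C J assume J: "J \<noteq> {}" "J \<subseteq> I" "finite J" and C: "\<forall>j\<in>J. C j \<in> G j"
    have "\<forall>j\<in>J. \<exists>U V. U \<in> sets S \<and> V \<in> sets T \<and> C j = (X j -` U \<inter> space M) \<inter> (Y j -` V \<inter> space M)"
    proof
      fix j assume "j \<in> J"
      with C have "C j \<in> G j" by simp
      then obtain U V where "U \<in> sets S" "V \<in> sets T" "C j = (\<lambda>\<omega>. (X j \<omega>, Y j \<omega>)) -` (U \<times> V) \<inter> space M"
        unfolding G_def R_def by blast
      thus "\<exists>U V. U \<in> sets S \<and> V \<in> sets T \<and> C j = (X j -` U \<inter> space M) \<inter> (Y j -` V \<inter> space M)"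
        unfolding vim by blast
    qed
    from bchoice[OF this] obtain U where
      "\<forall>j\<in>J. \<exists>V. U j \<in> sets S \<and> V \<in> sets T \<and> C j = (X j -` U j \<inter> space M) \<inter> (Y j -` V \<inter> space M)" ..
    from bchoice[OF this] obtain V where
      "\<forall>j\<in>J. U j \<in> sets S \<and> V j \<in> sets T \<and> C j = (X j -` U j \<inter> space M) \<inter> (Y j -` V j \<inter> space M)" ..
    hence UV: "\<And>j. j \<in> J \<Longrightarrow> U j \<in> sets S" "\<And>j. j \<in> J \<Longrightarrow> V j \<in> sets T"
      "\<And>j. j \<in> J \<Longrightarrow> C j = (X j -` U j \<inter> space M) \<inter> (Y j -` V j \<inter> space M)" by simp_all
    have "(\<Inter>j\<in>J. C j) = (\<Inter>j\<in>J. (X j -` U j \<inter> space M) \<inter> (Y j -` V j \<inter> space M))"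
      using UV(3) by (rule INF_cong[OF refl])
    also have "\<dots> = (\<Inter>j\<in>J. X j -` U j \<inter> space M) \<inter> (\<Inter>j\<in>J. Y j -` V j \<inter> space M)"
      by (rule INF_inf_distrib[symmetric])
    finally have IC: "(\<Inter>j\<in>J. C j) = (\<Inter>j\<in>J. X j -` U j \<inter> space M) \<inter> (\<Inter>j\<in>J. Y j -` V j \<inter> space M)" .
    have "prob (\<Inter>j\<in>J. C j) = prob (\<Inter>j\<in>J. X j -` U j \<inter> space M) * prob (\<Inter>j\<in>J. Y j -` V j \<inter> space M)"
      unfolding IC by (intro joint[OF J(1,3,2)] UV)
    also have "\<dots> = (\<Prod>j\<in>J. prob (X j -` U j \<inter> space M)) * (\<Prod>j\<in>J. prob (Y j -` V j \<inter> space M))"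
      using indep_varsD[OF X J(1,3,2), of U] indep_varsD[OF Y J(1,3,2), of V] UV by simp
    also have "\<dots> = (\<Prod>j\<in>J. prob (X j -` U j \<inter> space M) * prob (Y j -` V j \<inter> space M))"
      by (simp add: prod.distrib)
    also have "\<dots> = (\<Prod>j\<in>J. prob (C j))"
    proof (rule prod.cong[OF refl])
      fix j assume j: "j \<in> J"
      \<comment> \<open>The one-element case of \<open>joint\<close> recombines the two factors of
        an index.\<close>
      show "prob (X j -` U j \<inter> space M) * prob (Y j -` V j \<inter> space M) = prob (C j)"
        using joint[of "{j}" U V] UV j J by auto
    qed
    finally show "prob (\<Inter>j\<in>J. C j) = (\<Prod>j\<in>J. prob (C j))" .
  qed
  have "Int_stable (G i)" for i
  proof (rule Int_stableI)
    fix a b assume "a \<in> G i" "b \<in> G i"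
    then obtain U V U' V' where "U \<in> sets S" "V \<in> sets T" "U' \<in> sets S" "V' \<in> sets T"
      "a = (\<lambda>\<omega>. (X i \<omega>, Y i \<omega>)) -` (U \<times> V) \<inter> space M" "b = (\<lambda>\<omega>. (X i \<omega>, Y i \<omega>)) -` (U' \<times> V') \<inter> space M"
      by (auto simp: G_def R_def)
    thus "a \<inter> b \<in> G i" unfolding G_def R_def
      by (intro CollectI exI[of _ "(U \<inter> U') \<times> (V \<inter> V')"]) auto
  qed
  from indep_sets_sigma[OF indG this] have "indep_sets (\<lambda>i. sigma_sets (space M) (G i)) I" .
  moreover have "sigma_sets (space M) (G i) = {(\<lambda>\<omega>. (X i \<omega>, Y i \<omega>)) -` C \<inter> space M | C. C \<in> sets (S \<Otimes>\<^sub>M T)}" if i: "i \<in> I" for i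
  proof -
    have "(\<lambda>\<omega>. (X i \<omega>, Y i \<omega>)) \<in> space M \<rightarrow> space S \<times> space T"
      using measurable_space[OF Xm[OF i]] measurable_space[OF Ym[OF i]] by auto
    from sigma_sets_vimage_commute[OF this, of R] show ?thesis
      by (simp add: G_def sets_pair_measure R_def conj_commute)
  qed
  ultimately have "indep_sets (\<lambda>i. {(\<lambda>\<omega>. (X i \<omega>, Y i \<omega>)) -` C \<inter> space M | C. C \<in> sets (S \<Otimes>\<^sub>M T)}) I"
    by (simp cong: indep_sets_cong)
  thus ?thesis unfolding indep_vars_def2 using Xm Ym by auto
qed

section \<open>The corruption models\<close>

text \<open>The law of a corruption is known only through its values on sets; the standard induction
  over measurable functions carries the mixture over to integrals.\<close>

lemma nn_integral_two_point_mixture: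
  fixes f :: "real \<Rightarrow> ennreal"
  assumes \<mu>: "sets \<mu> = sets borel" and P: "sets P = sets borel"
    and mix: "\<And>B. B \<in> sets borel \<Longrightarrow> emeasure \<mu> B = q * indicator B x0 + r * emeasure P B"
    and f: "f \<in> borel_measurable borel"
  shows "(\<integral>\<^sup>+x. f x \<partial>\<mu>) = q * f x0 + r * (\<integral>\<^sup>+x. f x \<partial>P)"
  using f
proof (induction rule: borel_measurable_induct)
  case (cong f g)
  thus ?case by (simp add: fun_eq_iff)
next
  case (set A)
  thus ?case using \<mu> P mix by simp
next
  case (mult u c)
  thus ?case using \<mu> P by (simp add: nn_integral_cmult cong: measurable_cong_sets) (simp add: distrib_left mult_ac)
next
  case (add u v)
  thus ?case using \<mu> P by (simp add: nn_integral_add cong: measurable_cong_sets) (simp add: algebra_simps)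
next
  case (seq U)
  have U: "U i \<in> borel_measurable \<mu>" "U i \<in> borel_measurable P" for i
    using seq(1) \<mu> P by (simp_all cong: measurable_cong_sets)
  have inc: "incseq (\<lambda>i. U i x0)" using seq(3) by (auto simp: incseq_def le_fun_def)
  have incP: "incseq (\<lambda>i. \<integral>\<^sup>+x. U i x \<partial>P)" using seq(3) by (auto simp: incseq_def le_fun_def intro!: nn_integral_mono)
  have "(\<integral>\<^sup>+x. (SUP i. U i) x \<partial>\<mu>) = (SUP i. \<integral>\<^sup>+x. U i x \<partial>\<mu>)"
    unfolding SUP_apply by (rule nn_integral_monotone_convergence_SUP[OF seq(3) U(1)])
  also have "\<dots> = (SUP i. q * U i x0 + r * (\<integral>\<^sup>+x. U i x \<partial>P))" by (simp add: seq.IH)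
  also have "\<dots> = (SUP i. q * U i x0) + (SUP i. r * (\<integral>\<^sup>+x. U i x \<partial>P))"
    by (rule ennreal_SUP_add) (use inc incP in \<open>auto simp: incseq_def intro!: mult_left_mono\<close>)
  also have "\<dots> = q * (SUP i. U i x0) + r * (SUP i. \<integral>\<^sup>+x. U i x \<partial>P)"
    by (simp add: SUP_mult_left_ennreal)
  also have "(SUP i. \<integral>\<^sup>+x. U i x \<partial>P) = (\<integral>\<^sup>+x. (SUP i. U i) x \<partial>P)"
    unfolding SUP_apply by (rule nn_integral_monotone_convergence_SUP[OF seq(3) U(2), symmetric])
  finally show ?case by (simp only: SUP_apply)
qed

lemma two_std_normal_density: "2 * std_normal_density x = sqrt (2 / pi) * exp (- (x\<^sup>2 / 2))"
proof -
  have "2 / sqrt (2 * pi) = sqrt (2 / pi)"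
    by (simp add: real_sqrt_mult real_sqrt_divide field_simps)
  moreover have "2 * std_normal_density x = 2 / sqrt (2 * pi) * exp (- (x\<^sup>2 / 2))"
    by (simp add: std_normal_density_def)
  ultimately show ?thesis by simp
qed

section \<open>The two models: reduction to independent pairs, and the corrupted part\<close>

context prob_space
begin

lemma sign_mean_zero: "sign_mean M (\<lambda>_. 0) u = sqrt (2 / pi)"
  by (simp add: sign_mean_def two_std_normal_density prob_space)

text \<open>The point mass at 0 contributes exp 0 = 1, hence the term \<open>1 - p\<close>. At
  \<open>r = 0\<close> the convention that a quotient by 0 is 0 makes both exponents vanish.\<close>

lemma sign_mean_mixture:
  assumes s: "s \<in> borel_measurable M" and P: "prob_space P" "sets P = sets borel" and p: "0 \<le> p" "p \<le> 1"
    and law: "\<And>B. B \<in> sets borel \<Longrightarrow> prob {\<omega>\<in>space M. s \<omega> \<in> B} = (1 - p) * indicator B 0 + p * measure P B"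
  shows "sign_mean M s (1 / r) = sqrt (2 / pi) * (1 - p + p * (\<integral>t. exp (- (t\<^sup>2 / (2 * r\<^sup>2))) \<partial>P))"
proof -
  interpret P: prob_space P by fact
  define f where "f t = exp (- (t\<^sup>2 / (2 * r\<^sup>2)))" for t
  have fm[measurable]: "f \<in> borel_measurable borel" unfolding f_def by measurable
  have fP: "f \<in> borel_measurable P" using P(2) fm by (simp cong: measurable_cong_sets)
  have f01: "0 \<le> f t" "f t \<le> 1" for t by (auto simp: f_def)
  have intP: "integrable P f" by (rule P.integrable_const_bound[where B = 1]) (use f01 fP in auto)
  have intM: "integrable M (\<lambda>\<omega>. f (s \<omega>))" by (rule integrable_const_bound[where B = 1]) (use f01 s in auto)
  have "ennreal (expectation (\<lambda>\<omega>. f (s \<omega>))) = (\<integral>\<^sup>+\<omega>. ennreal (f (s \<omega>)) \<partial>M)"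
    by (rule nn_integral_eq_integral[symmetric, OF intM]) (use f01 in auto)
  also have "\<dots> = (\<integral>\<^sup>+x. ennreal (f x) \<partial>distr M borel s)" by (subst nn_integral_distr) (use s in auto)
  also have "\<dots> = ennreal (1 - p) * ennreal (f 0) + ennreal p * (\<integral>\<^sup>+x. ennreal (f x) \<partial>P)"
  proof (rule nn_integral_two_point_mixture)
    fix B :: "real set" assume B: "B \<in> sets borel"
    have "emeasure (distr M borel s) B = ennreal (prob {\<omega>\<in>space M. s \<omega> \<in> B})"
      by (subst emeasure_distr) (use B s in \<open>auto simp: emeasure_eq_measure intro!: arg_cong2[where f = measure]\<close>)
    also have "\<dots> = ennreal (1 - p) * ennreal (indicator B 0) + ennreal p * ennreal (measure P B)"
      unfolding law[OF B] using p by (subst ennreal_plus) (auto simp: ennreal_mult)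
    finally show "emeasure (distr M borel s) B = ennreal (1 - p) * indicator B 0 + ennreal p * emeasure P B"
      by (simp add: P.emeasure_eq_measure ennreal_indicator)
  qed (use P in auto)
  also have "(\<integral>\<^sup>+x. ennreal (f x) \<partial>P) = ennreal (\<integral>x. f x \<partial>P)"
    by (rule nn_integral_eq_integral[OF intP]) (use f01 in auto)
  also have "ennreal (1 - p) * ennreal (f 0) + ennreal p * ennreal (\<integral>x. f x \<partial>P) = ennreal (1 - p + p * (\<integral>x. f x \<partial>P))"
    using p f01 by (subst ennreal_plus) (auto simp: ennreal_mult f_def)
  finally have "expectation (\<lambda>\<omega>. f (s \<omega>)) = 1 - p + p * (\<integral>x. f x \<partial>P)"
    by (subst (asm) ennreal_inj) (use p f01 in \<open>auto intro!: add_nonneg_nonneg mult_nonneg_nonneg integral_nonneg\<close>)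
  moreover have "sign_mean M s (1 / r) = sqrt (2 / pi) * expectation (\<lambda>\<omega>. f (s \<omega>))"
    unfolding sign_mean_def two_std_normal_density f_def by (simp add: power_divide mult.commute)
  ultimately show ?thesis by (simp add: f_def)
qed

lemma iid_GOE_D:
  assumes "iid_GOE d m A"
  shows "i < m \<Longrightarrow> GOE d (A i)" "indep_vars (\<lambda>_. entry_space d) (\<lambda>i \<omega>. entries d (A i \<omega>)) {..<m}"
    "i < m \<Longrightarrow> (\<lambda>\<omega>. entries d (A i \<omega>)) \<in> measurable M (entry_space d)"
  using assms by (auto simp: iid_GOE_def indep_vars_def)

text \<open>Corruptions of the arbitrary model may depend on the matrices in any way, so the uniform
  bound is applied to the clean matrices and the corruption is treated as a perturbation.\<close>

lemma noisy_model_zero: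
  assumes A: "iid_GOE d m A" and d: "d \<ge> 1" and m: "m \<ge> 1"
  shows "noisy_model M d m A (\<lambda>_ _. 0)"
proof (intro noisy_model.intro noisy_model_axioms.intro)
  show "prob_space M" by (rule prob_space_axioms)
  fix i assume i: "i < m"
  show "noisy_GOE M d (A i) (\<lambda>_. 0)"
  proof (intro noisy_GOE.intro noisy_GOE_axioms.intro)
    fix U and V :: "real set" assume "U \<in> sets (entry_space d)" "V \<in> sets borel"
    show "prob {\<omega>\<in>space M. entries d (A i \<omega>) \<in> U \<and> 0 \<in> V} = prob {\<omega>\<in>space M. entries d (A i \<omega>) \<in> U} * prob {\<omega>\<in>space M. 0 \<in> V}"
      by (cases "0 \<in> V") (auto simp: prob_space)
  qed (use prob_space_axioms iid_GOE_D[OF A] i in auto)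
next
  show "indep_vars (\<lambda>_. entry_space d \<Otimes>\<^sub>M borel) (\<lambda>i \<omega>. (entries d (A i \<omega>), 0::real)) {..<m}"
    by (rule indep_vars_compose2[OF iid_GOE_D(2)[OF A], where Y = "\<lambda>_ w. (w, 0)"]) measurable
qed (use d m in auto)

lemma indep_of_mats_prob:
  assumes "indep_of_mats d m A N Y" and U: "U \<in> sets (PiM {..<m} (\<lambda>_. entry_space d))" and V: "V \<in> sets N"
  defines "Z \<equiv> \<lambda>\<omega>. \<lambda>i\<in>{..<m}. entries d (A i \<omega>)"
  shows "prob ((Z -` U \<inter> space M) \<inter> (Y -` V \<inter> space M)) = prob (Z -` U \<inter> space M) * prob (Y -` V \<inter> space M)"
proof -
  have "indep_set {Z -` U \<inter> space M |U. U \<in> sets (PiM {..<m} (\<lambda>_. entry_space d))} {Y -` V \<inter> space M |V. V \<in> sets N}"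
    using assms(1) unfolding indep_of_mats_def Let_def Z_def by simp
  from indep_setD[OF this] show ?thesis using U V by blast
qed

lemma cylinder_sets:
  assumes J: "finite J" "J \<subseteq> I" and U: "\<And>j. j \<in> J \<Longrightarrow> U j \<in> sets N"
  shows "{z\<in>space (PiM I (\<lambda>_. N)). \<forall>j\<in>J. z j \<in> U j} \<in> sets (PiM I (\<lambda>_. N))"
proof (rule sets.sets_Collect_finite_All[OF _ J(1)])
  fix j assume j: "j \<in> J"
  have "(\<lambda>z. z j) \<in> measurable (PiM I (\<lambda>_. N)) N" using j J by (intro measurable_component_singleton) auto
  from measurable_sets[OF this U[OF j]] show "{z\<in>space (PiM I (\<lambda>_. N)). z j \<in> U j} \<in> sets (PiM I (\<lambda>_. N))"
    by (simp add: vimage_def Int_def conj_commute)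
qed

text \<open>Independence of the two families as wholes is applied to cylinders, which gives the
  factorisation for each finite set of indices.\<close>

lemma noisy_model_random:
  assumes A: "iid_GOE d m A" and s: "random_corruption d m p P A s" and d: "d \<ge> 1" and m: "m \<ge> 1"
  shows "noisy_model M d m A s"
proof -
  have ind_s: "indep_vars (\<lambda>_. borel) s {..<m}"
    and ind: "indep_of_mats d m A (PiM {..<m} (\<lambda>_. borel)) (\<lambda>\<omega>. \<lambda>i\<in>{..<m}. s i \<omega>)"
    using s unfolding random_corruption_def by auto
  define Z where "Z \<omega> = (\<lambda>i\<in>{..<m}. entries d (A i \<omega>))" for \<omega>
  define Y where "Y \<omega> = (\<lambda>i\<in>{..<m}. s i \<omega>)" for \<omega>
  note Wm = iid_GOE_D(3)[OF A]
  have sm: "s i \<in> borel_measurable M" if "i < m" for i using ind_s that by (auto simp: indep_vars_def)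
  have Zs: "Z \<omega> \<in> space (PiM {..<m} (\<lambda>_. entry_space d))" if "\<omega> \<in> space M" for \<omega>
    using measurable_space[OF Wm that] by (auto simp: Z_def space_PiM)
  have Ys: "Y \<omega> \<in> space (PiM {..<m} (\<lambda>_. borel))" for \<omega> by (auto simp: Y_def space_PiM)
  have joint: "prob ((\<Inter>j\<in>J. (\<lambda>\<omega>. entries d (A j \<omega>)) -` U j \<inter> space M) \<inter> (\<Inter>j\<in>J. s j -` V j \<inter> space M))
      = prob (\<Inter>j\<in>J. (\<lambda>\<omega>. entries d (A j \<omega>)) -` U j \<inter> space M) * prob (\<Inter>j\<in>J. s j -` V j \<inter> space M)"
    if J: "J \<noteq> {}" "finite J" "J \<subseteq> {..<m}" and U: "\<And>j. j \<in> J \<Longrightarrow> U j \<in> sets (entry_space d)"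
      and V: "\<And>j. j \<in> J \<Longrightarrow> V j \<in> sets borel" for J U V
  proof -
    define QU where "QU = {z\<in>space (PiM {..<m} (\<lambda>_. entry_space d)). \<forall>j\<in>J. z j \<in> U j}"
    define QV where "QV = {z\<in>space (PiM {..<m} (\<lambda>_. borel :: real measure)). \<forall>j\<in>J. z j \<in> V j}"
    have "(\<Inter>j\<in>J. (\<lambda>\<omega>. entries d (A j \<omega>)) -` U j \<inter> space M) = Z -` QU \<inter> space M"
      using J Zs by (auto simp: QU_def Z_def)
    moreover have "(\<Inter>j\<in>J. s j -` V j \<inter> space M) = Y -` QV \<inter> space M"
      using J Ys by (auto simp: QV_def Y_def)
    moreover have "QU \<in> sets (PiM {..<m} (\<lambda>_. entry_space d))" "QV \<in> sets (PiM {..<m} (\<lambda>_. borel))"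
      unfolding QU_def QV_def by (rule cylinder_sets[OF J(2,3)]; use U V in blast)+
    ultimately show ?thesis
      using indep_of_mats_prob[OF ind, of QU QV] by (simp add: Z_def[abs_def] Y_def[abs_def])
  qed
  show ?thesis
  proof (intro noisy_model.intro noisy_model_axioms.intro)
    show "prob_space M" by (rule prob_space_axioms)
    fix i assume i: "i < m"
    show "noisy_GOE M d (A i) (s i)"
    proof (intro noisy_GOE.intro noisy_GOE_axioms.intro)
      fix U and V :: "real set" assume UV: "U \<in> sets (entry_space d)" "V \<in> sets borel"
      have "{\<omega>\<in>space M. entries d (A i \<omega>) \<in> U \<and> s i \<omega> \<in> V} = ((\<lambda>\<omega>. entries d (A i \<omega>)) -` U \<inter> space M) \<inter> (s i -` V \<inter> space M)"
        "{\<omega>\<in>space M. entries d (A i \<omega>) \<in> U} = (\<lambda>\<omega>. entries d (A i \<omega>)) -` U \<inter> space M"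
        "{\<omega>\<in>space M. s i \<omega> \<in> V} = s i -` V \<inter> space M" by auto
      thus "prob {\<omega>\<in>space M. entries d (A i \<omega>) \<in> U \<and> s i \<omega> \<in> V} = prob {\<omega>\<in>space M. entries d (A i \<omega>) \<in> U} * prob {\<omega>\<in>space M. s i \<omega> \<in> V}"
        using joint[of "{i}" "\<lambda>_. U" "\<lambda>_. V"] i UV by simp
    qed (use prob_space_axioms iid_GOE_D[OF A] sm i in auto)
  next
    show "indep_vars (\<lambda>_. entry_space d \<Otimes>\<^sub>M borel) (\<lambda>i \<omega>. (entries d (A i \<omega>), s i \<omega>)) {..<m}"
      by (rule indep_vars_pairs[OF iid_GOE_D(2)[OF A] ind_s joint])
  qed (use d m in auto)
qed

lemma prob_Int_ge:
  assumes "E \<in> events" "F \<in> events" shows "prob E + prob F - 1 \<le> prob (E \<inter> F)"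
proof -
  have "prob E = prob (E \<inter> F) + prob (E - F)"
    using finite_measure_Diff'[OF assms] by simp
  moreover have "prob (E - F) \<le> prob (space M - F)"
    by (rule finite_measure_mono) (use assms sets.sets_into_space in auto)
  moreover have "prob (space M - F) = 1 - prob F" by (rule prob_compl[OF assms(2)])
  ultimately show ?thesis by linarith
qed

text \<open>Independence of the support from the matrices allows a bound for each fixed support,
  without a union bound over the supports.\<close>

lemma corrupted_sum_event:
  fixes S :: "'a \<Rightarrow> nat set"
  assumes A: "iid_GOE d m A" and ind: "indep_of_mats d m A (count_space UNIV) S"
    and \<T>: "\<T> \<noteq> {}" "\<And>T. T \<in> \<T> \<Longrightarrow> T \<subseteq> {..<m}"
    and law: "distr M (count_space UNIV) S = measure_pmf (pmf_of_set \<T>)"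
    and V: "finite V" and b: "b \<ge> 0"
    and bnd: "\<And>T v. T \<in> \<T> \<Longrightarrow> v \<in> V \<Longrightarrow> prob {\<omega>\<in>space M. x \<le> (\<Sum>i\<in>T. \<bar>ip d (entries d (A i \<omega>)) (outer v)\<bar>)} \<le> b"
  shows "\<exists>E\<in>events. 1 - real (card V) * b \<le> prob E \<and>
    (\<forall>\<omega>\<in>E. S \<omega> \<in> \<T> \<and> (\<forall>v\<in>V. (\<Sum>i\<in>S \<omega>. \<bar>ip d (entries d (A i \<omega>)) (outer v)\<bar>) \<le> x))"
proof -
  define Z where "Z \<omega> = (\<lambda>i\<in>{..<m}. entries d (A i \<omega>))" for \<omega>
  have fin\<T>: "finite \<T>" by (rule finite_subset[of _ "Pow {..<m}"]) (use \<T>(2) in auto)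
  have Sm: "S \<in> measurable M (count_space UNIV)" using ind unfolding indep_of_mats_def Let_def by simp
  note Wm = iid_GOE_D(3)[OF A]
  have Zs: "Z \<omega> \<in> space (PiM {..<m} (\<lambda>_. entry_space d))" if "\<omega> \<in> space M" for \<omega>
    using measurable_space[OF Wm that] by (auto simp: Z_def space_PiM)
  \<comment> \<open>The bad set in the space of matrix families for a fixed support; its preimage
    under \<open>Z\<close> is independent of \<open>S\<close>.\<close>
  define Q where "Q T = (\<Union>v\<in>V. {z\<in>space (PiM {..<m} (\<lambda>_. entry_space d)). x \<le> (\<Sum>i\<in>T. \<bar>ip d (z i) (outer v)\<bar>)})" for T
  have Q: "Q T \<in> sets (PiM {..<m} (\<lambda>_. entry_space d))" if T: "T \<in> \<T>" for T
    unfolding Q_def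
  proof (rule sets.finite_UN[OF V])
    fix v
    have "(\<lambda>z. \<Sum>i\<in>T. \<bar>ip d (z i) (outer v)\<bar>) \<in> borel_measurable (PiM {..<m} (\<lambda>_. entry_space d))"
    proof (intro borel_measurable_sum borel_measurable_abs)
      fix i assume "i \<in> T"
      hence "(\<lambda>z. z i) \<in> measurable (PiM {..<m} (\<lambda>_. entry_space d)) (entry_space d)"
        using \<T>(2)[OF T] by (intro measurable_component_singleton) auto
      thus "(\<lambda>z. ip d (z i) (outer v)) \<in> borel_measurable (PiM {..<m} (\<lambda>_. entry_space d))"
        by (rule measurable_compose[OF _ ip_measurable])
    qed
    thus "{z\<in>space (PiM {..<m} (\<lambda>_. entry_space d)). x \<le> (\<Sum>i\<in>T. \<bar>ip d (z i) (outer v)\<bar>)} \<in> sets (PiM {..<m} (\<lambda>_. entry_space d))"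
      by measurable
  qed
  have Zv: "Z -` Q T \<inter> space M = (\<Union>v\<in>V. {\<omega>\<in>space M. x \<le> (\<Sum>i\<in>T. \<bar>ip d (entries d (A i \<omega>)) (outer v)\<bar>)})" if T: "T \<in> \<T>" for T
  proof -
    have "(\<Sum>i\<in>T. \<bar>ip d (Z \<omega> i) (outer v)\<bar>) = (\<Sum>i\<in>T. \<bar>ip d (entries d (A i \<omega>)) (outer v)\<bar>)" for \<omega> v
      by (rule sum.cong) (use \<T>(2)[OF T] in \<open>auto simp: Z_def\<close>)
    thus ?thesis using Zs by (auto simp: Q_def)
  qed
  have pQ: "prob (Z -` Q T \<inter> space M) \<le> real (card V) * b" if T: "T \<in> \<T>" for T
    unfolding Zv[OF T]
  proof (rule prob_UN_le[OF V])
    fix v assume v: "v \<in> V"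
    have "(\<lambda>\<omega>. \<Sum>i\<in>T. \<bar>ip d (entries d (A i \<omega>)) (outer v)\<bar>) \<in> borel_measurable M"
      by (intro borel_measurable_sum borel_measurable_abs measurable_compose[OF Wm ip_measurable]) (use \<T>(2)[OF T] in auto)
    thus "{\<omega>\<in>space M. x \<le> (\<Sum>i\<in>T. \<bar>ip d (entries d (A i \<omega>)) (outer v)\<bar>)} \<in> events" by measurable
  qed (rule bnd[OF T])
  define G where "G T = S -` {T} \<inter> space M" for T
  have G: "G T \<in> events" for T unfolding G_def by (rule measurable_sets[OF Sm]) simp
  have ZQ: "Z -` Q T \<inter> space M \<in> events" if "T \<in> \<T>" for T
  proof -
    have "Z \<in> measurable M (PiM {..<m} (\<lambda>_. entry_space d))"
      using ind unfolding indep_of_mats_def Let_def Z_def[abs_def] by simp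
    from measurable_sets[OF this Q[OF that]] show ?thesis .
  qed
  \<comment> \<open>By independence the probability is an average of the bounds for fixed
    \<open>T\<close> with weights \<open>prob (G T)\<close>, which sum to at most 1.\<close>
  define U where "U = (\<Union>T\<in>\<T>. (Z -` Q T \<inter> space M) \<inter> G T)"
  have U: "U \<in> events" unfolding U_def by (intro sets.finite_UN[OF fin\<T>] sets.Int ZQ G)
  have "prob U \<le> (\<Sum>T\<in>\<T>. prob ((Z -` Q T \<inter> space M) \<inter> G T))"
    unfolding U_def by (rule finite_measure_subadditive_finite[OF fin\<T>]) (use ZQ G in auto)
  also have "\<dots> = (\<Sum>T\<in>\<T>. prob (Z -` Q T \<inter> space M) * prob (G T))"
    using indep_of_mats_prob[OF ind Q] unfolding G_def Z_def[abs_def] by (intro sum.cong) auto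
  also have "\<dots> \<le> (\<Sum>T\<in>\<T>. (real (card V) * b) * prob (G T))"
    by (intro sum_mono mult_right_mono pQ) auto
  also have "\<dots> = (real (card V) * b) * prob (\<Union>T\<in>\<T>. G T)"
    unfolding sum_distrib_left[symmetric]
    by (subst finite_measure_finite_Union[OF fin\<T>]) (use G in \<open>auto simp: disjoint_family_on_def G_def\<close>)
  also have "\<dots> \<le> (real (card V) * b) * 1" by (intro mult_left_mono) (use b in auto)
  finally have pU: "prob U \<le> real (card V) * b" by simp
  \<comment> \<open>Supports outside \<open>\<T>\<close> have probability 0; they are cut away
    because the bound covers only members of \<open>\<T>\<close>.\<close>
  define E0 where "E0 = S -` \<T> \<inter> space M"
  have E0: "E0 \<in> events" unfolding E0_def by (rule measurable_sets[OF Sm]) simp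
  have "prob E0 = measure (distr M (count_space UNIV) S) \<T>"
    unfolding E0_def by (subst measure_distr[OF Sm]) auto
  also have "\<dots> = 1"
    unfolding law using \<T>(1) fin\<T> by (simp add: measure_pmf_of_set)
  finally have pE0: "prob E0 = 1" .
  have "prob (E0 - U) = prob E0 - prob (E0 \<inter> U)" by (rule finite_measure_Diff'[OF E0 U])
  moreover have "prob (E0 \<inter> U) \<le> prob U" by (rule finite_measure_mono) (use U in auto)
  ultimately have pE: "1 - real (card V) * b \<le> prob (E0 - U)" using pU pE0 by linarith
  have good: "S \<omega> \<in> \<T> \<and> (\<forall>v\<in>V. (\<Sum>i\<in>S \<omega>. \<bar>ip d (entries d (A i \<omega>)) (outer v)\<bar>) \<le> x)" if w: "\<omega> \<in> E0 - U" for \<omega>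
  proof -
    have S: "S \<omega> \<in> \<T>" and ws: "\<omega> \<in> space M" using w by (auto simp: E0_def)
    have "\<omega> \<notin> Z -` Q (S \<omega>) \<inter> space M" using w S ws by (auto simp: U_def G_def)
    thus ?thesis using S ws unfolding Zv[OF S] by force
  qed
  show ?thesis by (rule bexI[of _ "E0 - U"]) (use pE good E0 U in auto)
qed

end

text \<open>The clean bound is used with half the error. This costs 2^4 in the fourth power and at
  most 2 in the logarithm, and 32 times 3000000000 is below 10^11.\<close>

lemma halved_sample_size:
  fixes \<delta> m :: real and d k :: nat
  assumes \<delta>: "0 < \<delta>" "\<delta> \<le> 1"
    and m: "m \<ge> 100000000000 * (real d * real k * max (ln (1 / \<delta>)) 1 / \<delta> ^ 4)"
  shows "m \<ge> 3000000000 * (real d * real k * max (ln (1 / (\<delta> / 2))) 1 / (\<delta> / 2) ^ 4)"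
proof -
  define L where "L = max (ln (1 / \<delta>)) 1"
  have "ln (1 / (\<delta> / 2)) = ln 2 + ln (1 / \<delta>)" using \<delta> by (simp add: ln_div)
  also have "\<dots> \<le> 1 + ln (1 / \<delta>)" using ln_2_less_1 by simp
  finally have "max (ln (1 / (\<delta> / 2))) 1 \<le> 2 * L" unfolding L_def by linarith
  hence "real d * real k * max (ln (1 / (\<delta> / 2))) 1 / (\<delta> / 2) ^ 4 \<le> real d * real k * (2 * L) / (\<delta> / 2) ^ 4"
    by (intro divide_right_mono mult_left_mono) auto
  also have "\<dots> = 32 * (real d * real k * L / \<delta> ^ 4)" by (simp add: power_divide)
  finally have "3000000000 * (real d * real k * max (ln (1 / (\<delta> / 2))) 1 / (\<delta> / 2) ^ 4)
    \<le> 96000000000 * (real d * real k * L / \<delta> ^ 4)" by simp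
  also have "\<dots> \<le> 100000000000 * (real d * real k * L / \<delta> ^ 4)"
    using \<delta> by (intro mult_right_mono divide_nonneg_nonneg mult_nonneg_nonneg) (auto simp: L_def)
  finally show ?thesis using m by (simp add: L_def)
qed

text \<open>The constant in \<open>3 p\<close> enters here: \<open>(9 / 10)\<^sup>2 (3 p)\<^sup>2 / (8 p) > p ln 2\<close>.\<close>

lemma corrupted_sum_exponent:
  fixes p \<delta> m :: real and n :: nat
  assumes n: "n \<ge> 1" "real n \<le> p * m" and \<delta>: "\<delta> > 0" and p: "p \<ge> 0" and m: "m > 0"
  defines "x \<equiv> 9 / 20 * m * (\<delta> / 2 + 3 * p)"
  shows "2 ^ n * exp (- x\<^sup>2 / (2 * real n)) \<le> exp (- (3 / 10) * m * \<delta>)"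
proof -
  have pm: "p * m > 0" using n by linarith
  hence p0: "p > 0" using m p by (simp add: zero_less_mult_iff)
  \<comment> \<open>The square of delta / 2 is dropped; the cross term provides the decay in
    delta.\<close>
  have sq: "(\<delta> / 2 + 3 * p)\<^sup>2 \<ge> 9 * p\<^sup>2 + 3 * p * \<delta>"
    using zero_le_power2[of "\<delta> / 2"] by (simp add: power2_eq_square algebra_simps)
  have "81 / 400 * m\<^sup>2 * (9 * p\<^sup>2 + 3 * p * \<delta>) \<le> x\<^sup>2"
  proof -
    have "x\<^sup>2 = 81 / 400 * m\<^sup>2 * (\<delta> / 2 + 3 * p)\<^sup>2"
      unfolding x_def power_mult_distrib by (simp add: power_divide)
    thus ?thesis using sq by (simp only:) (intro mult_left_mono, auto)
  qed
  hence "81 / 400 * m\<^sup>2 * (9 * p\<^sup>2 + 3 * p * \<delta>) / (2 * (p * m)) \<le> x\<^sup>2 / (2 * (p * m))"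
    using pm by (intro divide_right_mono) auto
  also have "\<dots> \<le> x\<^sup>2 / (2 * real n)" using n pm p0 m by (intro divide_left_mono mult_pos_pos) auto
  also have "81 / 400 * m\<^sup>2 * (9 * p\<^sup>2 + 3 * p * \<delta>) / (2 * (p * m)) = 81 / 800 * (9 * (p * m) + 3 * (m * \<delta>))"
    using p0 m by (simp add: power2_eq_square field_simps)
  finally have x: "81 / 800 * (9 * (p * m) + 3 * (m * \<delta>)) \<le> x\<^sup>2 / (2 * real n)" .
  \<comment> \<open>The gain 729/800 per unit of \<open>p * m\<close> beats the entropy ln 2 < 7/10,
    and 243/800 > 3/10 is left for m delta.\<close>
  have "real n * ln 2 \<le> (p * m) * (7 / 10)"
    by (intro mult_mono n(2)) (use ln2_le_25_over_36 pm in auto)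
  hence "real n * ln 2 - x\<^sup>2 / (2 * real n) \<le> - (3 / 10) * (m * \<delta>)"
  proof -
    have gen: "l - y \<le> - (3 / 10) * b" if "l \<le> a * (7 / 10)" "81 / 800 * (9 * a + 3 * b) \<le> y" "0 < a" "0 < b"
      for a b l y :: real using that by (simp add: algebra_simps)
    show ?thesis if "real n * ln 2 \<le> p * m * (7 / 10)"
      by (rule gen[OF that x pm mult_pos_pos[OF m \<delta>]])
  qed
  hence "real n * ln 2 + - x\<^sup>2 / (2 * real n) \<le> - (3 / 10) * m * \<delta>" by simp
  moreover have "2 ^ n * exp (- x\<^sup>2 / (2 * real n)) = exp (real n * ln 2 + - x\<^sup>2 / (2 * real n))"
    unfolding exp_add exp_of_nat_mult by simp
  ultimately show ?thesis by simp
qed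

section \<open>The probability bounds for the RDPP in the two models\<close>

context prob_space
begin

lemma rdpp_random:
  assumes d: "d \<ge> 1" and k: "k \<ge> 1" and \<delta>: "0 < \<delta>" "\<delta> \<le> 1"
    and m: "real m \<ge> 3000000000 * (real d * real k * max (ln (1 / \<delta>)) 1 / \<delta> ^ 4)"
    and A: "iid_GOE d m A" and p: "0 < p" "p < 1" and s: "random_corruption d m p P A s"
  shows "with_prob_ge (1 - 4 * exp (- real m * \<delta> ^ 4 / 32000000))
    (\<lambda>\<omega>. RDPP d m k \<delta> (psi_random m p P) (\<lambda>i. A i \<omega>) (\<lambda>i. s i \<omega>))"
proof -
  have "0 < 3000000000 * (real d * real k * max (ln (1 / \<delta>)) 1 / \<delta> ^ 4)" using d k \<delta> by simp
  hence m1: "m \<ge> 1" using m by (cases m) auto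
  interpret N: noisy_model M d m A s by (rule noisy_model_random[OF A s d m1])
  obtain E where E: "E \<in> events" "1 - 4 * exp (- real m * \<delta> ^ 4 / 32000000) \<le> prob E"
    and good: "\<forall>\<omega>\<in>E. \<forall>X\<in>low_rank_sphere d k. \<forall>u\<ge>0. \<forall>v\<in>unit_vecs d.
      \<bar>(\<Sum>i<m. sign_pm (ip d (entries d (A i \<omega>)) X - u * s i \<omega>) * ip d (entries d (A i \<omega>)) (outer v)) - real m * N.\<Psi> u * ip d X (outer v)\<bar> \<le> real m * \<delta>"
    using N.uniform_sign_sum[OF \<delta> k m] by (elim bexE conjE)
  have \<psi>: "psi_random m p P X = N.\<Psi> (1 / frob_norm X)" for X
  proof -
    have "sign_mean M (s i) (1 / frob_norm X) = sqrt (2 / pi) * (1 - p + p * (\<integral>t. exp (- (t\<^sup>2 / (2 * (frob_norm X)\<^sup>2))) \<partial>(P i)))"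
      if i: "i < m" for i
      by (rule sign_mean_mixture) (use s i p in \<open>auto simp: random_corruption_def indep_vars_def\<close>)
    thus ?thesis by (simp add: psi_random_def N.\<Psi>_def)
  qed
  have "RDPP d m k \<delta> (psi_random m p P) (\<lambda>i. A i \<omega>) (\<lambda>i. s i \<omega>)" if w: "\<omega> \<in> E" for \<omega>
  proof (rule RDPP_of_quadratic_forms[OF d m1, where \<Psi> = N.\<Psi>])
    have "\<omega> \<in> space M" using w E(1) sets.sets_into_space by blast
    thus "A i \<omega> \<in> carrier_mat d d \<and> transpose_mat (A i \<omega>) = A i \<omega>" if "i < m" for i
      using iid_GOE_D(1)[OF A that] by (simp add: GOE_def)
  qed (use good w \<psi> in auto)
  thus ?thesis unfolding with_prob_ge_def using E by (intro bexI[of _ E]) auto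
qed

text \<open>The sign sum is the clean one plus a correction with coefficients -2, 0 or 2, supported
  on the corrupted indices. Bounding their moduli by 2 makes the correction uniform in
  \<open>X\<close> and \<open>u\<close>, so only a net of vectors is paid for, and its size exp(8 d)
  is absorbed by exp(-(3/10) m delta).\<close>

lemma rdpp_arbitrary:
  assumes d: "d \<ge> 1" and k: "k \<ge> 1" and \<delta>: "0 < \<delta>" "\<delta> \<le> 1"
    and m: "real m \<ge> 100000000000 * (real d * real k * max (ln (1 / \<delta>)) 1 / \<delta> ^ 4)"
    and A: "iid_GOE d m A" and p: "0 \<le> p" "p \<le> 1" and s: "arbitrary_corruption d m p A s"
  shows "with_prob_ge (1 - exp (- real m * \<delta> ^ 4 / 1024000000))
    (\<lambda>\<omega>. RDPP d m k (\<delta> + 3 * p) psi_arbitrary (\<lambda>i. A i \<omega>) (\<lambda>i. s i \<omega>))"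
proof -
  define L where "L = max (ln (1 / \<delta>)) 1"
  have L: "L \<ge> 1" by (simp add: L_def)
  have m_pos: "0 < 100000000000 * (real d * real k * max (ln (1 / \<delta>)) 1 / \<delta> ^ 4)" using d k \<delta> by simp
  hence m1: "m \<ge> 1" using m by (cases m) auto
  have d4: "\<delta> ^ 4 > 0" "\<delta> ^ 4 \<le> \<delta>" using \<delta> power_decreasing[of 1 4 \<delta>] by auto
  have "1 * 1 \<le> real k * L" by (rule mult_mono) (use k L in auto)
  hence "real d * 1 \<le> real d * (real k * L)" by (intro mult_left_mono) auto
  moreover have "100000000000 * (real d * real k * L) \<le> real m * \<delta> ^ 4"
    using m d4(1) unfolding L_def[symmetric] by (simp add: divide_le_eq)
  ultimately have md: "100000000000 * real d \<le> real m * \<delta> ^ 4" by (simp add: mult_ac)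
  have md': "real m * \<delta> ^ 4 \<le> real m * \<delta>" by (intro mult_left_mono d4) simp
  have \<delta>2: "0 < \<delta> / 2" "\<delta> / 2 \<le> 1" using \<delta> by auto

  interpret N: noisy_model M d m A "\<lambda>_ _. 0" by (rule noisy_model_zero[OF A d m1])
  obtain E1 where E1: "E1 \<in> events" "1 - 4 * exp (- real m * (\<delta> / 2) ^ 4 / 32000000) \<le> prob E1"
    and clean: "\<forall>\<omega>\<in>E1. \<forall>X\<in>low_rank_sphere d k. \<forall>u\<ge>0. \<forall>v\<in>unit_vecs d.
      \<bar>(\<Sum>i<m. sign_pm (ip d (entries d (A i \<omega>)) X - u * 0) * ip d (entries d (A i \<omega>)) (outer v)) - real m * N.\<Psi> u * ip d X (outer v)\<bar> \<le> real m * (\<delta> / 2)"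
    using N.uniform_sign_sum[OF \<delta>2 k halved_sample_size[OF \<delta> m]] by (elim bexE conjE)
  have \<Psi>: "N.\<Psi> u = sqrt (2 / pi)" for u using m1 by (simp add: N.\<Psi>_def sign_mean_zero)

  obtain V where V: "V \<subseteq> unit_vecs d" "finite V" "real (card V) \<le> (exp 1 * (3 + 2 / (1 / 40))) ^ card {..<d}"
    "\<And>v. v \<in> unit_vecs d \<Longrightarrow> \<exists>v0\<in>V. L2_set (\<lambda>i. v i - v0 i) {..<d} \<le> 2 * (1 / 40)"
    by (rule unit_ball_net[of "{..<d}" "unit_vecs d" "1 / 40"]) (use d in \<open>auto simp: unit_vecs_def lessThan_empty_iff\<close>)
  have cV: "real (card V) \<le> exp (8 * real d)"
  proof -
    have "exp 1 * (3 + 2 / (1 / 40)) \<le> (2::real) ^ 8" using exp_le by simp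
    also have "\<dots> \<le> exp 1 ^ 8" by (rule power_mono) (use exp_ge_add_one_self[of 1] in auto)
    finally have "(exp 1 * (3 + 2 / (1 / 40)) :: real) ^ d \<le> (exp 1 ^ 8) ^ d" by (rule power_mono) simp
    also have "\<dots> = exp (8 * real d)" by (simp add: exp_of_nat_mult[symmetric] power_mult[symmetric])
    finally show ?thesis using V(3) by simp
  qed
  define S where "S \<omega> = {i \<in> {..<m}. s i \<omega> \<noteq> 0}" for \<omega>
  define n where "n = nat \<lfloor>p * real m\<rfloor>"
  define \<T> where "\<T> = {T. T \<subseteq> {..<m} \<and> card T = n}"
  have ind: "indep_of_mats d m A (count_space UNIV) S"
    and law: "distr M (count_space UNIV) S = measure_pmf (pmf_of_set \<T>)"
    using s unfolding arbitrary_corruption_def Let_def S_def[abs_def] \<T>_def n_def by auto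
  have pm0: "0 \<le> p * real m" using p by simp
  have n_le: "real n \<le> p * real m" unfolding n_def using pm0 by linarith
  have "p * real m \<le> 1 * real m" by (intro mult_right_mono p) simp
  hence "n \<le> m" using n_le by simp
  hence \<T>: "\<T> \<noteq> {}" "\<And>T. T \<in> \<T> \<Longrightarrow> T \<subseteq> {..<m}"
    unfolding \<T>_def by (auto intro!: exI[of _ "{..<n}"])
  \<comment> \<open>Chosen so that 2 x / (9/10), with the 2 from the flipped signs and the 9/10 from
    the vector net, is m (delta / 2 + 3 p).\<close>
  define x where "x = 9 / 20 * real m * (\<delta> / 2 + 3 * p)"
  have x0: "x > 0" using m1 \<delta> p by (simp add: x_def add_pos_nonneg)
  obtain E2 where E2: "E2 \<in> events" "1 - real (card V) * exp (- (3 / 10) * real m * \<delta>) \<le> prob E2"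
    and corr: "\<forall>\<omega>\<in>E2. S \<omega> \<in> \<T> \<and> (\<forall>v\<in>V. (\<Sum>i\<in>S \<omega>. \<bar>ip d (entries d (A i \<omega>)) (outer v)\<bar>) \<le> x)"
  proof -
    have tail: "prob {\<omega>\<in>space M. x \<le> (\<Sum>i\<in>T. \<bar>ip d (entries d (A i \<omega>)) (outer v)\<bar>)} \<le> exp (- (3 / 10) * real m * \<delta>)"
      if T: "T \<in> \<T>" and v: "v \<in> V" for T v
    \<comment> \<open>Without corrupted indices the sum is 0 and stays below the positive
      \<open>x\<close>.\<close>
    proof (cases "n = 0")
      case True
      have "finite T" using \<T>(2)[OF T] finite_subset by blast
      hence "T = {}" using T True by (auto simp: \<T>_def)
      thus ?thesis using x0 by simp
    next
      case False
      have Tn: "T \<subseteq> {..<m}" "card T = n" using T by (auto simp: \<T>_def)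
      hence Tf: "finite T" "T \<noteq> {}" using False finite_subset by (blast, auto)
      have oS: "outer v \<in> sym_sphere d" using v V(1) by (auto simp: sym_sphere_def sym_on_outer L2_set_outer unit_vecs_def)
      have indT: "indep_vars (\<lambda>_. borel) (\<lambda>i \<omega>. ip d (entries d (A i \<omega>)) (outer v)) T"
        by (rule indep_vars_compose2[OF indep_vars_subset[OF iid_GOE_D(2)[OF A] Tn(1)], where Y = "\<lambda>_ w. ip d w (outer v)"]) measurable
      have "prob {\<omega>\<in>space M. x \<le> (\<Sum>i\<in>T. \<bar>ip d (entries d (A i \<omega>)) (outer v)\<bar>)} \<le> 2 ^ card T * exp (- x\<^sup>2 / (2 * real (card T)))"
        by (rule gaussian_abs_sum_tail[OF Tf indT])
           (use Tn x0 noisy_GOE.std[OF N.noisy oS] in auto)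
      also have "\<dots> \<le> exp (- (3 / 10) * real m * \<delta>)"
        unfolding Tn(2) x_def by (rule corrupted_sum_exponent) (use False n_le \<delta> p m1 in auto)
      finally show ?thesis .
    qed
    have "\<exists>E\<in>events. 1 - real (card V) * exp (- (3 / 10) * real m * \<delta>) \<le> prob E \<and>
        (\<forall>\<omega>\<in>E. S \<omega> \<in> \<T> \<and> (\<forall>v\<in>V. (\<Sum>i\<in>S \<omega>. \<bar>ip d (entries d (A i \<omega>)) (outer v)\<bar>) \<le> x))"
      by (rule corrupted_sum_event[OF A ind \<T>(1) _ law V(2) exp_ge_zero]) (use \<T>(2) tail in auto)
    thus ?thesis by (elim bexE conjE) (rule that)
  qed
  \<comment> \<open>The exponent of the clean part at delta / 2: 16 times 32000000 is
    512000000.\<close>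
  define z where "z = real m * \<delta> ^ 4 / 512000000"
  have "real (card V) * exp (- (3 / 10) * real m * \<delta>) \<le> exp (8 * real d) * exp (- (3 / 10) * real m * \<delta>)"
    by (intro mult_right_mono cV) simp
  also have "\<dots> \<le> exp (- z)"
    using md md' d unfolding z_def exp_add[symmetric] by simp
  finally have P2: "1 - exp (- z) \<le> prob E2" using E2(2) by linarith
  have P1: "1 - 4 * exp (- z) \<le> prob E1"
    using E1(2) by (simp add: z_def power_divide)
  \<comment> \<open>The failure probabilities add up to 5 exp(-z). As m delta^4 >= 10^11 d, half of
    the exponent absorbs the factor 5, which doubles the denominator to 1024000000.\<close>
  have "5 \<le> exp (z / 2)"
  proof -
    have "5 \<le> 1 + z / 2" using md d by (simp add: z_def)
    also have "\<dots> \<le> exp (z / 2)" by (rule exp_ge_add_one_self)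
    finally show ?thesis .
  qed
  hence "5 * exp (- z) \<le> exp (z / 2) * exp (- z)" by (intro mult_right_mono) auto
  also have "\<dots> = exp (- real m * \<delta> ^ 4 / 1024000000)" by (simp add: exp_add[symmetric] z_def)
  finally have PE: "1 - exp (- real m * \<delta> ^ 4 / 1024000000) \<le> prob (E1 \<inter> E2)"
    using prob_Int_ge[OF E1(1) E2(1)] P1 P2 by linarith

  have "RDPP d m k (\<delta> + 3 * p) psi_arbitrary (\<lambda>i. A i \<omega>) (\<lambda>i. s i \<omega>)" if w: "\<omega> \<in> E1 \<inter> E2" for \<omega>
  proof (rule RDPP_of_quadratic_forms[OF d m1, where \<Psi> = "\<lambda>_. sqrt (2 / pi)"])
    have ws: "\<omega> \<in> space M" using w E1(1) sets.sets_into_space by blast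
    show "A i \<omega> \<in> carrier_mat d d \<and> transpose_mat (A i \<omega>) = A i \<omega>" if "i < m" for i
      using iid_GOE_D(1)[OF A that] ws by (simp add: GOE_def)
    fix X u v assume X: "X \<in> low_rank_sphere d k" and u: "0 < (u::real)" and v: "v \<in> unit_vecs d"
    define W where "W i = entries d (A i \<omega>)" for i
    define c where "c i = sign_pm (ip d (W i) X - u * s i \<omega>) - sign_pm (ip d (W i) X)" for i
    \<comment> \<open>The correction as a matrix that does not depend on \<open>v\<close>, so that
      the net bound for quadratic forms applies.\<close>
    define B where "B e = (\<Sum>i<m. c i * W i e)" for e
    have ipB: "ip d B (outer y) = (\<Sum>i<m. c i * ip d (W i) (outer y))" for y
    proof -
      have "ip d B (outer y) = (\<Sum>e\<in>Sq d. \<Sum>i<m. c i * (W i e * outer y e))"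
        by (simp add: ip_def B_def sum_distrib_right mult.assoc)
      also have "\<dots> = (\<Sum>i<m. c i * ip d (W i) (outer y))"
        by (subst sum.swap) (simp add: ip_def sum_distrib_left)
      finally show ?thesis .
    qed
    have "sym_on d B" unfolding sym_on_def B_def
    proof (intro allI impI sum.cong refl)
      fix a b i assume "a < d" "b < d" "i \<in> {..<m}"
      thus "c i * W i (a, b) = c i * W i (b, a)" using N.W_sym[OF _ ws, of i] by (simp add: W_def sym_on_def)
    qed
    moreover have "\<bar>ip d B (outer y)\<bar> \<le> 2 * x" if y: "y \<in> V" for y
    proof -
      have "\<bar>ip d B (outer y)\<bar> \<le> (\<Sum>i<m. \<bar>c i\<bar> * \<bar>ip d (W i) (outer y)\<bar>)"
        unfolding ipB abs_mult[symmetric] by (rule sum_abs)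
      also have "\<dots> = (\<Sum>i\<in>S \<omega>. \<bar>c i\<bar> * \<bar>ip d (W i) (outer y)\<bar>)"
        by (rule sum.mono_neutral_right) (auto simp: S_def c_def)
      also have "\<dots> \<le> (\<Sum>i\<in>S \<omega>. 2 * \<bar>ip d (W i) (outer y)\<bar>)"
        by (intro sum_mono mult_right_mono) (auto simp: c_def sign_pm_def)
      also have "\<dots> \<le> 2 * x" using corr w y by (simp add: sum_distrib_left[symmetric] W_def)
      finally show ?thesis .
    qed
    ultimately have "\<bar>ip d B (outer v)\<bar> \<le> 2 * x / (9 / 10)"
      by (intro quadratic_form_net[OF _ V(1) _ _ v]) (use V(4) in auto)
    also have "\<dots> = real m * (\<delta> / 2 + 3 * p)" by (simp add: x_def)
    finally have 1: "\<bar>ip d B (outer v)\<bar> \<le> real m * (\<delta> / 2 + 3 * p)" .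
    have 2: "\<bar>(\<Sum>i<m. sign_pm (ip d (W i) X) * ip d (W i) (outer v)) - real m * sqrt (2 / pi) * ip d X (outer v)\<bar> \<le> real m * (\<delta> / 2)"
      using clean[rule_format, of \<omega> X u v] w X u v by (simp add: \<Psi> W_def)
    have 3: "(\<Sum>i<m. sign_pm (ip d (W i) X - u * s i \<omega>) * ip d (W i) (outer v)) = ip d B (outer v) + (\<Sum>i<m. sign_pm (ip d (W i) X) * ip d (W i) (outer v))"
      unfolding ipB sum.distrib[symmetric] by (rule sum.cong) (auto simp: c_def algebra_simps)
    have 4: "real m * (\<delta> + 3 * p) = real m * (\<delta> / 2 + 3 * p) + real m * (\<delta> / 2)" by (simp add: algebra_simps)
    show "\<bar>(\<Sum>i<m. sign_pm (ip d (entries d (A i \<omega>)) X - u * s i \<omega>) * ip d (entries d (A i \<omega>)) (outer v)) - real m * sqrt (2 / pi) * ip d X (outer v)\<bar> \<le> real m * (\<delta> + 3 * p)"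
      using 1 2 unfolding W_def[symmetric] 3 4 by linarith
  qed (simp add: psi_arbitrary_def)
  thus ?thesis unfolding with_prob_ge_def using E1(1) E2(1) PE by (intro bexI[of _ "E1 \<inter> E2"]) auto
qed

lemma with_prob_ge_mono:
  assumes "with_prob_ge b Q" "b' \<le> b" "\<And>\<omega>. Q \<omega> \<Longrightarrow> Q' \<omega>"
  shows "with_prob_ge b' Q'"
  using assms unfolding with_prob_ge_def by (meson order_trans)

end

lemma RDPP_mono: "RDPP d m k \<delta> \<psi> A s \<Longrightarrow> \<delta> \<le> \<delta>' \<Longrightarrow> RDPP d m k \<delta>' \<psi> A s"
  unfolding RDPP_def by (meson order_trans)

theorem proposition2p2:
  shows "\<exists>C0 c c' C :: real. C0 > 0 \<and> c > 0 \<and> c' > 0 \<and> C > 0 \<and>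
    (\<forall>(d::nat) (m::nat) (k::nat) (\<delta>::real) (M :: 'w measure) (A :: nat \<Rightarrow> 'w \<Rightarrow> real mat).
       d \<ge> 1 \<longrightarrow> k \<ge> 1 \<longrightarrow> 0 < \<delta> \<longrightarrow> \<delta> \<le> 1 \<longrightarrow>
       real m \<ge> C0 * (real d * real k * max (ln (1 / \<delta>)) 1 / \<delta> ^ 4) \<longrightarrow>
       prob_space M \<longrightarrow> prob_space.iid_GOE M d m A \<longrightarrow>
       (\<forall>(p::real) (s :: nat \<Rightarrow> 'w \<Rightarrow> real).
          0 \<le> p \<longrightarrow> p \<le> 1 \<longrightarrow> prob_space.arbitrary_corruption M d m p A s \<longrightarrow>
          prob_space.with_prob_ge M
            (1 - exp (- (p * real m + real d)) - exp (- c' * real m * \<delta> ^ 4))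
            (\<lambda>\<omega>. RDPP d m k (\<delta> + 3 * sqrt (real d * p / real m) + 3 * p) psi_arbitrary
                   (\<lambda>i. A i \<omega>) (\<lambda>i. s i \<omega>))) \<and>
       (\<forall>(p::real) (P :: nat \<Rightarrow> real measure) (s :: nat \<Rightarrow> 'w \<Rightarrow> real).
          0 < p \<longrightarrow> p < 1 \<longrightarrow> prob_space.random_corruption M d m p P A s \<longrightarrow>
          prob_space.with_prob_ge M
            (1 - C * exp (- c * real m * \<delta> ^ 4))
            (\<lambda>\<omega>. RDPP d m k \<delta> (psi_random m p P) (\<lambda>i. A i \<omega>) (\<lambda>i. s i \<omega>))))"
\<comment> \<open>10^11 serves the arbitrary model, which uses the clean bound at delta / 2, and
  exceeds the 3 * 10^9 of the random model; 4 is the total weight of the exceptional sets.\<close>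
proof (rule exI[of _ 100000000000], rule exI[of _ "1 / 32000000"], rule exI[of _ "1 / 1024000000"], rule exI[of _ 4],
    intro conjI allI impI)
  fix d m k :: nat and \<delta> :: real and M :: "'w measure" and A :: "nat \<Rightarrow> 'w \<Rightarrow> real mat"
  assume d: "d \<ge> 1" and k: "k \<ge> 1" and \<delta>: "0 < \<delta>" "\<delta> \<le> 1"
    and m: "real m \<ge> 100000000000 * (real d * real k * max (ln (1 / \<delta>)) 1 / \<delta> ^ 4)"
    and M: "prob_space M" and A: "prob_space.iid_GOE M d m A"
  fix p :: real and s :: "nat \<Rightarrow> 'w \<Rightarrow> real"
  assume p: "0 \<le> p" "p \<le> 1" and s: "prob_space.arbitrary_corruption M d m p A s"
  \<comment> \<open>The radius delta + 3 p and the single exponential of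
    \<open>rdpp_arbitrary\<close> are at least as good as what is asked, so monotonicity
    finishes.\<close>
  show "prob_space.with_prob_ge M (1 - exp (- (p * real m + real d)) - exp (- (1 / 1024000000) * real m * \<delta> ^ 4))
     (\<lambda>\<omega>. RDPP d m k (\<delta> + 3 * sqrt (real d * p / real m) + 3 * p) psi_arbitrary (\<lambda>i. A i \<omega>) (\<lambda>i. s i \<omega>))"
    by (rule prob_space.with_prob_ge_mono[OF M prob_space.rdpp_arbitrary[OF M d k \<delta> m A p s]])
       (use p in \<open>auto elim!: RDPP_mono\<close>)
next
  fix d m k :: nat and \<delta> :: real and M :: "'w measure" and A :: "nat \<Rightarrow> 'w \<Rightarrow> real mat"
  assume d: "d \<ge> 1" and k: "k \<ge> 1" and \<delta>: "0 < \<delta>" "\<delta> \<le> 1"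
    and m: "real m \<ge> 100000000000 * (real d * real k * max (ln (1 / \<delta>)) 1 / \<delta> ^ 4)"
    and M: "prob_space M" and A: "prob_space.iid_GOE M d m A"
  fix p :: real and P :: "nat \<Rightarrow> real measure" and s :: "nat \<Rightarrow> 'w \<Rightarrow> real"
  assume p: "0 < p" "p < 1" and s: "prob_space.random_corruption M d m p P A s"
  have "3000000000 * (real d * real k * max (ln (1 / \<delta>)) 1 / \<delta> ^ 4) \<le> 100000000000 * (real d * real k * max (ln (1 / \<delta>)) 1 / \<delta> ^ 4)"
    using \<delta> by (intro mult_right_mono divide_nonneg_nonneg mult_nonneg_nonneg) auto
  from prob_space.rdpp_random[OF M d k \<delta> order_trans[OF this m] A p s]
  show "prob_space.with_prob_ge M (1 - 4 * exp (- (1 / 32000000) * real m * \<delta> ^ 4))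
     (\<lambda>\<omega>. RDPP d m k \<delta> (psi_random m p P) (\<lambda>i. A i \<omega>) (\<lambda>i. s i \<omega>))"
    by simp
qed simp_all

end
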